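(* Let $f_\pm\colon\mathbb R\to\mathbb R$ be smooth, and let $u_0\in\mathbb R$ satisfy $f_+'(u_0)=f_-'(u_0)$, $f_+''(u_0)<f_-''(u_0)$, $f_-'''(u_0)>0$. For small $\varepsilon>0$ let $u_-$ be the unique root in $(u_0,u_0+2\varepsilon)$ of the equation $$f_-'(u+\varepsilon)-f_+'(u-\varepsilon)-2\varepsilon f_-''(u+\varepsilon)=0.$$ Then for all sufficiently small $\varepsilon>0$ there exists an NW-fissure with a spine function $T$ defined on some interval $[v_++\varepsilon,u_-+\varepsilon]$ such that: 1. $T(u_0+\varepsilon)=0$ and $T(u_-+\varepsilon)=-\varepsilon$; 2. $v_+<u_0-\varepsilon$ and $T(v_++\varepsilon)=\varepsilon$; 3. the function $$B(x)=\begin{cases}\dfrac{\varepsilon-x_2}{\varepsilon-T}A+\dfrac{x_2-T}{\varepsilon-T}f_+, & x_2\ge T(u),\\[2mm] \dfrac{\varepsilon+x_2}{\varepsilon+T}A+\dfrac{T-x_2}{\varepsilon+T}f_-, & x_2\le T(u),\end{cases}\qquad u=u(x),$$ with $$A=\frac{\varepsilon^2-T^2}{2\varepsilon T}\Big[(\varepsilon+T)f_+'-(\varepsilon-T)f_-'\Big]+\frac{(\varepsilon+T)f_++(\varepsilon-T)f_-}{2\varepsilon},$$ is a Bellman candidate on the region $\Omega^{NW}_\varepsilon(v_+,u_-)$ foliated by this fissure; 4. there exists $\delta=\delta(\varepsilon)>0$ such that the function equal to $$\frac{\varepsilon+x_2}{2\varepsilon}f_+(x_1+x_2-\varepsilon)+\frac{\varepsilon-x_2}{2\varepsilon}f_-(x_1+x_2+\varepsilon)\quad\text{on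 }\Omega^L_\varepsilon(u_-,u_-+\delta),$$ $$\frac{\varepsilon+x_2}{2\varepsilon}f_+(x_1-x_2+\varepsilon)+\frac{\varepsilon-x_2}{2\varepsilon}f_-(x_1-x_2-\varepsilon)\quad\text{on }\Omega^R_\varepsilon(v_+-\delta,v_+),$$ and to the function $B$ of item 3 on $\Omega^{NW}_\varepsilon(v_+,u_-)$, is a $C^1$-smooth Bellman candidate on the union of these three regions.
   Context: Let $\Omega_\varepsilon=\{(x_1,x_2)\in\mathbb R^2: -\varepsilon\le x_2\le\varepsilon\}$, $\partial\Omega_\varepsilon=\{x_2=\pm\varepsilon\}$. For $a<b$ put $\Omega^{R}_\varepsilon(a,b)=\{x\in\Omega_\varepsilon: a\le x_1-x_2\le b\}$ and $\Omega^{L}_\varepsilon(a,b)=\{x\in\Omega_\varepsilon: a\le x_1+x_2\le b\}$. The functions $f_\pm$ do not depend on $\varepsilon$. The root $u_-$ exists and is unique for small $\varepsilon$. A function on a two-dimensional domain is diagonally concave if it is concave along every segment of the domain lying on a line $x_1+x_2=\mathrm{const}$ or $x_1-x_2=\mathrm{const}$. A function $B$ on a subdomain $\Omega\subset\Omega_\varepsilon$ is a Bellman candidate on $\Omega$ if: (1) $B$ is diagonally concave on $\Omega$; (2) $B(x_1,\pm\varepsilon)=f_\pm(x_1)$ at the points of $\Omega\cap\partial\Omega_\varepsilon$; (3) for every $y\in\Omega$, either there is a straight line segment in one of the directions $x_1\pm x_2=\mathrm{const}$ connecting $y$ with some point of $\partial\Omega_\varepsilon$ on which $B$ is linear, or $B$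 is linear in both directions $x_1\pm x_2=\mathrm{const}$ in a neighborhood of $y$. Left horizontal herringbone: given a $C^1$ spine function $T$ on an interval, with values in $[-\varepsilon,\varepsilon]$, $|T'|\le1$ and $|T'|<1$ except possibly at finitely many points, from each spine point $(u,T(u))$ start two ribs: the upper rib, the segment to $(u+T(u)-\varepsilon,\varepsilon)$, and the lower rib, the segment to $(u-T(u)-\varepsilon,-\varepsilon)$ (a rib degenerates to a point when $T(u)=\varepsilon$, resp. $T(u)=-\varepsilon$). A fissure is a horizontal herringbone whose spine connects the two opposite boundaries of the strip; an NW-fissure is a left herringbone whose spine goes, from left to right, from the top boundary $x_2=\varepsilon$ to the bottom boundary $x_2=-\varepsilon$. The region $\Omega^{NW}_\varepsilon(v_+,u_-)$ is the union of all ribs, i.e. $\{x\in\Omega_\varepsilon: x_1-x_2\ge v_+,\ x_1+x_2\le u_-\}$. For $x$ in this region, $u=u(x)$ is the parameter of the rib containing $x$: $x_1+x_2=u+T(u)$ on upper ribs ($x_2\ge T(u)$), $x_1-x_2=u-T(u)$ on lower ribs ($x_2\le T(u)$). In the formulas for $B$ and $A$ in item 3, $A,T$ are evaluated at $u$, $f_+$ and its derivatives at $u+T(u)-\varepsilon$, $f_-$ and its derivatives at $u-T(u)-\varepsilon$. At $u=u_0+\varepsilon$ (where $T=0$) $A$ is understood as extended by continuity; on the degenerate ribs at the endpoints of the spine $B$ equals the boundary value. *)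

theory Defs
  imports "HOL-Analysis.Analysis"
begin

definition smooth_fun :: "(real \<Rightarrow> real) \<Rightarrow> bool" where
  "smooth_fun f \<longleftrightarrow> (\<forall>n x. ((deriv ^^ n) f) field_differentiable (at x))"

type_synonym plane = "real \<times> real"

definition strip :: "real \<Rightarrow> plane set" where
  "strip \<epsilon> = {x. - \<epsilon> \<le> snd x \<and> snd x \<le> \<epsilon>}"

definition strip_boundary :: "real \<Rightarrow> plane set" where
  "strip_boundary \<epsilon> = {x. snd x = \<epsilon> \<or> snd x = - \<epsilon>}"

definition Omega_R :: "real \<Rightarrow> real \<Rightarrow> real \<Rightarrow> plane set" where
  "Omega_R \<epsilon> a b = {x \<in> strip \<epsilon>. a \<le> fst x - snd x \<and> fst x - snd x \<le> b}"

definition Omega_L :: "real \<Rightarrow> real \<Rightarrow> real \<Rightarrow> plane set" where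
  "Omega_L \<epsilon> a b = {x \<in> strip \<epsilon>. a \<le> fst x + snd x \<and> fst x + snd x \<le> b}"

definition Omega_NW :: "real \<Rightarrow> real \<Rightarrow> real \<Rightarrow> plane set" where
  "Omega_NW \<epsilon> vp um = {x \<in> strip \<epsilon>. vp \<le> fst x - snd x \<and> fst x + snd x \<le> um}"

definition same_diagonal :: "plane \<Rightarrow> plane \<Rightarrow> bool" where
  "same_diagonal p q \<longleftrightarrow>
     fst p + snd p = fst q + snd q \<or> fst p - snd p = fst q - snd q"

definition diagonally_concave_on :: "plane set \<Rightarrow> (plane \<Rightarrow> real) \<Rightarrow> bool" where
  "diagonally_concave_on \<Omega> B \<longleftrightarrow>
     (\<forall>p q. same_diagonal p q \<and> closed_segment p q \<subseteq> \<Omega> \<longrightarrow> concave_on (closed_segment p q) B)"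

text \<open>``Linear along a segment'' means affine there.\<close>

definition linear_on_segment :: "(plane \<Rightarrow> real) \<Rightarrow> plane \<Rightarrow> plane \<Rightarrow> bool" where
  "linear_on_segment B p q \<longleftrightarrow>
     (\<forall>t\<in>{0..1}. B ((1 - t) *\<^sub>R p + t *\<^sub>R q) = (1 - t) * B p + t * B q)"

text \<open>In the last clause, the segment is nondegenerate, starts at a boundary point \<open>p\<close> and
  contains \<open>y\<close>. If \<open>y\<close> is off the boundary this is the same as asking for a linearity segment from
  \<open>y\<close> to the boundary; if \<open>y\<close> is itself a boundary point, it excludes the trivial choice of the
  one-point segment. Neighbourhoods of \<open>y\<close> are taken relative to \<open>\<Omega>\<close>.\<close>

definition bellman_candidate ::
  "real \<Rightarrow> (real \<Rightarrow> real) \<Rightarrow> (real \<Rightarrow> real) \<Rightarrow> plane set \<Rightarrow> (plane \<Rightarrow> real) \<Rightarrow> bool" where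
  "bellman_candidate \<epsilon> fp fm \<Omega> B \<longleftrightarrow>
     \<Omega> \<subseteq> strip \<epsilon> \<and>
     diagonally_concave_on \<Omega> B \<and>
     (\<forall>x1. (x1, \<epsilon>) \<in> \<Omega> \<longrightarrow> B (x1, \<epsilon>) = fp x1) \<and>
     (\<forall>x1. (x1, - \<epsilon>) \<in> \<Omega> \<longrightarrow> B (x1, - \<epsilon>) = fm x1) \<and>
     (\<forall>y\<in>\<Omega>.
        (\<exists>p q. p \<in> strip_boundary \<epsilon> \<and> p \<noteq> q \<and> same_diagonal p q \<and> y \<in> closed_segment p q \<and>
               closed_segment p q \<subseteq> \<Omega> \<and> linear_on_segment B p q) \<or>
        (\<exists>r>0. \<forall>p q. same_diagonal p q \<and> closed_segment p q \<subseteq> \<Omega> \<inter> ball y r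
               \<longrightarrow> linear_on_segment B p q))"

text \<open>\<open>C\<^sup>1\<close> on a (possibly closed) domain: differentiable within the domain at each of its
  points, with a gradient that is continuous on the domain.\<close>

definition C1_on :: "plane set \<Rightarrow> (plane \<Rightarrow> real) \<Rightarrow> bool" where
  "C1_on \<Omega> B \<longleftrightarrow>
     (\<exists>G. (\<forall>x\<in>\<Omega>. (B has_derivative (\<lambda>h. G x \<bullet> h)) (at x within \<Omega>)) \<and> continuous_on \<Omega> G)"

definition left_herringbone_spine ::
  "real \<Rightarrow> (real \<Rightarrow> real) \<Rightarrow> real \<Rightarrow> real \<Rightarrow> bool" where
  "left_herringbone_spine \<epsilon> T a b \<longleftrightarrow>
     a < b \<and> (\<forall>u\<in>{a..b}. - \<epsilon> \<le> T u \<and> T u \<le> \<epsilon>) \<and>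
     (\<exists>T'. (\<forall>u\<in>{a..b}. (T has_real_derivative T' u) (at u within {a..b})) \<and>
           continuous_on {a..b} T' \<and>
           (\<forall>u\<in>{a..b}. \<bar>T' u\<bar> \<le> 1) \<and>
           finite {u\<in>{a..b}. \<bar>T' u\<bar> = 1})"

definition NW_fissure :: "real \<Rightarrow> (real \<Rightarrow> real) \<Rightarrow> real \<Rightarrow> real \<Rightarrow> bool" where
  "NW_fissure \<epsilon> T a b \<longleftrightarrow> left_herringbone_spine \<epsilon> T a b \<and> T a = \<epsilon> \<and> T b = - \<epsilon>"

text \<open>Both ribs of a left herringbone go to the left from the spine point.\<close>

definition upper_rib :: "real \<Rightarrow> (real \<Rightarrow> real) \<Rightarrow> real \<Rightarrow> plane set" where
  "upper_rib \<epsilon> T u = closed_segment (u, T u) (u + T u - \<epsilon>, \<epsilon>)"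

definition lower_rib :: "real \<Rightarrow> (real \<Rightarrow> real) \<Rightarrow> real \<Rightarrow> plane set" where
  "lower_rib \<epsilon> T u = closed_segment (u, T u) (u - T u - \<epsilon>, - \<epsilon>)"

definition foliated_by_ribs ::
  "real \<Rightarrow> (real \<Rightarrow> real) \<Rightarrow> real \<Rightarrow> real \<Rightarrow> plane set \<Rightarrow> bool" where
  "foliated_by_ribs \<epsilon> T a b \<Omega> \<longleftrightarrow>
     \<Omega> = (\<Union>u\<in>{a..b}. upper_rib \<epsilon> T u \<union> lower_rib \<epsilon> T u) \<and>
     (\<forall>x\<in>\<Omega>. \<exists>!u. u \<in> {a..b} \<and> x \<in> upper_rib \<epsilon> T u \<union> lower_rib \<epsilon> T u)"

definition rib_param :: "real \<Rightarrow> (real \<Rightarrow> real) \<Rightarrow> real \<Rightarrow> real \<Rightarrow> plane \<Rightarrow> real" where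
  "rib_param \<epsilon> T a b x = (THE u. u \<in> {a..b} \<and> x \<in> upper_rib \<epsilon> T u \<union> lower_rib \<epsilon> T u)"

text \<open>\<open>A\<close> is the function of the spine parameter given by the explicit formula away from \<open>z\<close>, the
  only zero of \<open>T\<close>; continuity determines its value at \<open>z\<close> (for \<open>z\<close> in \<open>[a, b]\<close>).\<close>

definition spine_value ::
  "real \<Rightarrow> (real \<Rightarrow> real) \<Rightarrow> (real \<Rightarrow> real) \<Rightarrow> (real \<Rightarrow> real) \<Rightarrow> real \<Rightarrow> real \<Rightarrow> real
     \<Rightarrow> (real \<Rightarrow> real) \<Rightarrow> bool" where
  "spine_value \<epsilon> fp fm T a b z A \<longleftrightarrow>
     continuous_on {a..b} A \<and>
     (\<forall>u\<in>{a..b}. u \<noteq> z \<longrightarrow> T u \<noteq> 0 \<and>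
        A u = (\<epsilon>\<^sup>2 - (T u)\<^sup>2) / (2 * \<epsilon> * T u)
                * ((\<epsilon> + T u) * deriv fp (u + T u - \<epsilon>) - (\<epsilon> - T u) * deriv fm (u - T u - \<epsilon>))
              + ((\<epsilon> + T u) * fp (u + T u - \<epsilon>) + (\<epsilon> - T u) * fm (u - T u - \<epsilon>)) / (2 * \<epsilon>))"

text \<open>The first two cases are the degenerate ribs, where a denominator vanishes. If
  \<open>T u = snd x\<close> on nondegenerate ribs, both formulas give \<open>A u\<close>.\<close>

definition herringbone_fun ::
  "real \<Rightarrow> (real \<Rightarrow> real) \<Rightarrow> (real \<Rightarrow> real) \<Rightarrow> (real \<Rightarrow> real) \<Rightarrow> (real \<Rightarrow> real)
     \<Rightarrow> real \<Rightarrow> real \<Rightarrow> plane \<Rightarrow> real" where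
  "herringbone_fun \<epsilon> fp fm T A a b x =
     (let u = rib_param \<epsilon> T a b x in
      if T u = \<epsilon> \<and> snd x = \<epsilon> then fp (fst x)
      else if T u = - \<epsilon> \<and> snd x = - \<epsilon> then fm (fst x)
      else if T u \<le> snd x then
        (\<epsilon> - snd x) / (\<epsilon> - T u) * A u + (snd x - T u) / (\<epsilon> - T u) * fp (u + T u - \<epsilon>)
      else
        (\<epsilon> + snd x) / (\<epsilon> + T u) * A u + (T u - snd x) / (\<epsilon> + T u) * fm (u - T u - \<epsilon>))"

definition left_tangent_fun ::
  "real \<Rightarrow> (real \<Rightarrow> real) \<Rightarrow> (real \<Rightarrow> real) \<Rightarrow> plane \<Rightarrow> real" where
  "left_tangent_fun \<epsilon> fp fm x =
     (\<epsilon> + snd x) / (2 * \<epsilon>) * fp (fst x + snd x - \<epsilon>)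
     + (\<epsilon> - snd x) / (2 * \<epsilon>) * fm (fst x + snd x + \<epsilon>)"

definition right_tangent_fun ::
  "real \<Rightarrow> (real \<Rightarrow> real) \<Rightarrow> (real \<Rightarrow> real) \<Rightarrow> plane \<Rightarrow> real" where
  "right_tangent_fun \<epsilon> fp fm x =
     (\<epsilon> + snd x) / (2 * \<epsilon>) * fp (fst x - snd x + \<epsilon>)
     + (\<epsilon> - snd x) / (2 * \<epsilon>) * fm (fst x - snd x - \<epsilon>)"

definition fissure_root ::
  "real \<Rightarrow> (real \<Rightarrow> real) \<Rightarrow> (real \<Rightarrow> real) \<Rightarrow> real \<Rightarrow> real \<Rightarrow> bool" where
  "fissure_root \<epsilon> fp fm u0 u \<longleftrightarrow>
     u \<in> {u0<..<u0 + 2 * \<epsilon>} \<and>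
     deriv fm (u + \<epsilon>) - deriv fp (u - \<epsilon>) - 2 * \<epsilon> * (deriv ^^ 2) fm (u + \<epsilon>) = 0"

end

(*
  In the coordinates X = x1 + x2 and Y = x1 - x2 the spine is a monotone curve (s, t). Right of it the
  candidate is affine in Y with slope m(X), left of it affine in X with slope n(Y). The given formula
  for A says that m' and n' have a common value k along the spine, k being the mixed derivative of B
  in X and Y; the tangent domains are of the same two kinds, with m and n prolonged beyond the ends of
  the spine. The function is C1 because both gradients agree on the spine, and for fixed Y the
  derivative of B in X varies along the spine by (Y - t) dk, for fixed X that in Y by (X - s) dk; as k
  is monotone, these signs give diagonal concavity.

  The system for s, t, k is singular at both u0 and u_-. With T = eps (2 q - 1), q in [0, 1], as the
  parameter, keeping k as an unknown removes the singularity at u0, and dividing 2 k - f_-'' by q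
  (its order of vanishing at u_-) turns the one at u_- into an averaging operator. What remains is an
  integral equation whose right side has Lipschitz constant O(eps), so Banach's theorem applies.
*)
theory Submission
  imports Defs
begin

section \<open>Real functions on an interval\<close>

text \<open>With q as parameter the interval is fixed although v_+ is unknown: v_+ is merely what q
  = 1 produces, and the integration starts at the right end. There the equation for q k' allows a
  bounded k' only if 2 k = f_-''; inserted into \<open>k_eq\<close>, the relation between k and the
  boundary slopes, this is exactly the equation that defines u_-. The point u_0 is not imposed
  either: at T = 0 both ribs end at the same abscissa, \<open>k_eq\<close> becomes f_+' = f_-', and
  because f_-'' - f_+'' is positive this holds nearby at u_0 alone. The same gap keeps the
  denominator of the spine equation away from zero, while f_-''' > 0 makes the quotient (2 k -
  f_-'') / (4 eps q) positive; that one sign yields both k' < 0 and |T'| < 1. Inverses and slopes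
  are continued to the whole line, so that the three regions are glued along one curve only, the
  continued spine.\<close>

lemma antideriv_exists:
  fixes f :: "real \<Rightarrow> real"
  assumes "continuous_on UNIV f"
  shows "\<exists>F. (\<forall>x. (F has_real_derivative f x) (at x)) \<and> F a = c"
proof -
  have "\<exists>F. \<forall>x. - \<infinity> < ereal x \<longrightarrow> ereal x < \<infinity> \<longrightarrow> (F has_vector_derivative f x) (at x)"
    using assms by (intro einterval_antiderivative) (auto simp: continuous_on_eq_continuous_at)
  then obtain F where "\<And>x. (F has_real_derivative f x) (at x)"
    by (auto simp: has_real_derivative_iff_has_vector_derivative)
  then have "((\<lambda>x. F x - F a + c) has_real_derivative f x) (at x)" for x
    by (auto intro!: derivative_eq_intros)
  then show ?thesis
    by (intro exI[of _ "\<lambda>x. F x - F a + c"]) simp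
qed

text \<open>The inverse is made total by clamping its argument to the range of \<open>f\<close>. It
  is then constant beyond both ends, which lets slopes and the spine graph be defined on the whole
  line.\<close>

lemma strict_antimono_inverse:
  fixes f :: "real \<Rightarrow> real"
  assumes cont: "continuous_on {0..1} f"
    and dec: "\<And>p q. 0 \<le> p \<Longrightarrow> p < q \<Longrightarrow> q \<le> 1 \<Longrightarrow> f q < f p"
  shows "\<exists>Q. continuous_on UNIV Q \<and> (\<forall>x. Q x \<in> {0..1}) \<and>
    (\<forall>q\<in>{0..1}. Q (f q) = q) \<and> (\<forall>x. f (Q x) = max (f 1) (min (f 0) x))"
proof -
  define c where "c x = max (f 1) (min (f 0) x)" for x
  define Q where "Q x = the_inv_into {0..1} f (c x)" for x
  have inj: "inj_on f {0..1}"
  proof (rule linorder_inj_onI)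
    show "f x \<noteq> f y" if "x < y" "x \<in> {0..1}" "y \<in> {0..1}" for x y
      using dec[of x y] that by auto
  qed auto
  have f01: "f 1 < f 0" using dec[of 0 1] by simp
  have sub: "c x \<in> f ` {0..1}" for x
  proof -
    have "\<exists>q\<ge>0. q \<le> 1 \<and> f q = c x"
      by (rule IVT2') (use cont f01 in \<open>auto simp: c_def\<close>)
    then show ?thesis by force
  qed
  have "continuous_on UNIV (the_inv_into {0..1} f \<circ> c)"
  proof (rule continuous_on_compose)
    show "continuous_on UNIV c" unfolding c_def by (intro continuous_intros)
    show "continuous_on (range c) (the_inv_into {0..1} f)"
      by (rule continuous_on_subset[OF continuous_on_inv_into[OF cont compact_Icc inj]])
        (use sub in auto)
  qed
  then have 1: "continuous_on UNIV Q" by (simp add: Q_def o_def)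
  have 2: "Q x \<in> {0..1}" for x
    unfolding Q_def using the_inv_into_into[OF inj sub order_refl] .
  have le: "f 1 \<le> f q \<and> f q \<le> f 0" if "q \<in> {0..1}" for q
    using that dec[of 0 q] dec[of q 1] by (cases "q = 0"; cases "q = 1") (auto intro: less_imp_le)
  have 3: "Q (f q) = q" if "q \<in> {0..1}" for q
    unfolding Q_def using le[OF that] the_inv_into_f_f[OF inj that] by (simp add: c_def)
  have 4: "f (Q x) = max (f 1) (min (f 0) x)" for x
    unfolding Q_def using f_the_inv_into_f[OF inj sub] c_def by simp
  show ?thesis using 1 2 3 4 by blast
qed

text \<open>Stated within \<open>S\<close> and its image because the slope of the spine is also
  needed at its two ends, where only one-sided derivatives exist.\<close>

lemma real_derivative_inverse_within:
  fixes f :: "real \<Rightarrow> real"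
  assumes "(f has_real_derivative d) (at a within S)" "d \<noteq> 0" "a \<in> S"
    and "continuous (at (f a) within f ` S) g"
    and "\<And>x. x \<in> S \<Longrightarrow> g (f x) = x"
  shows "(g has_real_derivative inverse d) (at (f a) within f ` S)"
  unfolding has_field_derivative_def
proof (rule has_derivative_inverse_within)
  show "(f has_derivative (*) d) (at a within S)"
    using assms(1) by (simp add: has_field_derivative_def)
  show "linear ((*) (inverse d))"
    by (rule linear_times)
  show "(*) (inverse d) \<circ> (*) d = id"
    using assms(2) by (auto simp: fun_eq_iff)
qed (use assms in auto)

text \<open>The mean value theorem on either side of \<open>\<tau>\<close> turns the two chord
  slopes into values of \<open>\<phi>'\<close>. One-sided derivatives at the ends suffice, so
  segments may end on the boundary of a region.\<close>

lemma concave_on_imp_chord: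
  fixes \<phi> \<phi>' :: "real \<Rightarrow> real"
  assumes "\<And>x. x \<in> {0..1} \<Longrightarrow> (\<phi> has_real_derivative \<phi>' x) (at x within {0..1})"
    and anti: "\<And>x y. 0 \<le> x \<Longrightarrow> x \<le> y \<Longrightarrow> y \<le> 1 \<Longrightarrow> \<phi>' y \<le> \<phi>' x"
    and \<tau>: "\<tau> \<in> {0..1}"
  shows "(1 - \<tau>) * \<phi> 0 + \<tau> * \<phi> 1 \<le> \<phi> \<tau>"
proof (cases "\<tau> = 0 \<or> \<tau> = 1")
  case False
  with \<tau> have \<tau>': "0 < \<tau>" "\<tau> < 1" by auto
  have cont: "continuous_on {0..1} \<phi>"
    using assms(1) by (rule DERIV_continuous_on)
  have der: "DERIV \<phi> x :> \<phi>' x" if "0 < x" "x < 1" for x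
    using assms(1)[of x] that by (simp add: at_within_Icc_at)
  obtain a where a: "0 < a" "a < \<tau>" "\<phi> \<tau> - \<phi> 0 = (\<tau> - 0) * \<phi>' a"
  proof -
    have "continuous_on {0..\<tau>} \<phi>"
      using cont \<tau>' by (elim continuous_on_subset) auto
    with \<tau>'(1) obtain l z where z: "0 < z" "z < \<tau>" "DERIV \<phi> z :> l" "\<phi> \<tau> - \<phi> 0 = (\<tau> - 0) * l"
      using MVT[of 0 \<tau> \<phi>] der \<tau>' by (metis dual_order.strict_trans real_differentiable_def)
    then show thesis
      using der[of z] \<tau>' by (intro that[of z]) (auto dest: DERIV_unique)
  qed
  obtain b where b: "\<tau> < b" "b < 1" "\<phi> 1 - \<phi> \<tau> = (1 - \<tau>) * \<phi>' b"
  proof -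
    have "continuous_on {\<tau>..1} \<phi>"
      using cont \<tau>' by (elim continuous_on_subset) auto
    with \<tau>'(2) obtain l z where z: "\<tau> < z" "z < 1" "DERIV \<phi> z :> l" "\<phi> 1 - \<phi> \<tau> = (1 - \<tau>) * l"
      using MVT[of \<tau> 1 \<phi>] der \<tau>' by (metis dual_order.strict_trans real_differentiable_def)
    then show thesis
      using der[of z] \<tau>' by (intro that[of z]) (auto dest: DERIV_unique)
  qed
  have "\<phi>' b \<le> \<phi>' a" using anti[of a b] a b \<tau>' by simp
  then have "\<tau> * (1 - \<tau>) * \<phi>' b \<le> \<tau> * (1 - \<tau>) * \<phi>' a"
    using \<tau>' by (intro mult_left_mono) auto
  then have "\<tau> * (\<phi> 1 - \<phi> \<tau>) \<le> (1 - \<tau>) * (\<phi> \<tau> - \<phi> 0)"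
    unfolding a b by (simp add: algebra_simps)
  then show ?thesis by (simp add: algebra_simps)
qed (use \<tau> in auto)

text \<open>Identities along the spine are proved by differentiating in \<open>q\<close> and
  evaluating at \<open>q = 0\<close>. The derivative is asked for in the open interval only, since
  \<open>k\<close> is differentiable just there.\<close>

lemma const_on_unit:
  fixes f :: "real \<Rightarrow> real"
  assumes "continuous_on {0..1} f" "\<And>q. 0 < q \<Longrightarrow> q < 1 \<Longrightarrow> (f has_real_derivative 0) (at q)" "q \<in> {0..1}"
  shows "f q = f 0"
proof (cases "q = 0")
  case False
  show ?thesis
    by (rule DERIV_isconst_end) (use assms False in \<open>auto intro: continuous_on_subset\<close>)
qed simp

section \<open>Spines in characteristic coordinates\<close>

text \<open>The spine point with parameter \<open>q\<close> has height \<open>\<epsilon> (2 q - 1)\<close> and characteristic coordinates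
  \<open>X = s q\<close>, \<open>Y = t q\<close>, so \<open>q\<close> runs from the right end of the spine to the left one; \<open>k q\<close> is the
  mixed derivative of the candidate there. The equations \<open>k'_s\<close> and \<open>k'_t\<close> express that the
  candidate is \<open>C\<^sup>1\<close> across the spine, \<open>t'_less\<close> and \<open>t'_1\<close> that \<open>\<bar>T'\<bar> < 1\<close> except at the left end,
  and \<open>right_ineq\<close> and \<open>left_ineq\<close> are the concavity conditions on the two tangent domains.\<close>

locale fissure_data =
  fixes \<epsilon> \<delta> :: real and fp fm g h g1 h1 s t t' k k' :: "real \<Rightarrow> real"
  assumes eps: "0 < \<epsilon>" and delta: "0 < \<delta>"
    and fp_der: "\<And>x. (fp has_real_derivative g x) (at x)"
    and fm_der: "\<And>x. (fm has_real_derivative h x) (at x)"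
    and g_der: "\<And>x. (g has_real_derivative g1 x) (at x)"
    and h_der: "\<And>x. (h has_real_derivative h1 x) (at x)"
    and s_eq: "\<And>q. s q = t q + 2 * \<epsilon> * (2 * q - 1)"
    and t_der: "\<And>q. q \<in> {0..1} \<Longrightarrow> (t has_real_derivative t' q) (at q within {0..1})"
    and t'_cont: "continuous_on {0..1} t'"
    and t'_1: "t' 1 = - 4 * \<epsilon>"
    and t'_less: "\<And>q. 0 \<le> q \<Longrightarrow> q < 1 \<Longrightarrow> t' q < - 4 * \<epsilon>"
    and k_cont: "continuous_on {0..1} k"
    and k_der: "\<And>q. 0 < q \<Longrightarrow> q < 1 \<Longrightarrow> (k has_real_derivative k' q) (at q)"
    and k'_le: "\<And>q. 0 < q \<Longrightarrow> q < 1 \<Longrightarrow> k' q \<le> 0"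
    and k'_s: "\<And>q. 0 < q \<Longrightarrow> q < 1 \<Longrightarrow>
      4 * \<epsilon> * (1 - q) * k' q = (t' q + 4 * \<epsilon>) * (2 * k q - g1 (s q - \<epsilon>))"
    and k'_t: "\<And>q. 0 < q \<Longrightarrow> q < 1 \<Longrightarrow>
      4 * \<epsilon> * q * k' q = t' q * (2 * k q - h1 (t q - \<epsilon>))"
    and k_eq: "\<And>q. q \<in> {0..1} \<Longrightarrow>
      4 * \<epsilon> * (2 * q - 1) * k q = g (s q - \<epsilon>) - h (t q - \<epsilon>)"
    and right_ineq: "\<And>X. s 0 < X \<Longrightarrow> X < s 0 + \<delta> \<Longrightarrow>
      g1 (X - \<epsilon>) \<le> (h (X + \<epsilon>) - g (X - \<epsilon>)) / (2 * \<epsilon>) \<and>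
      h1 (X + \<epsilon>) \<le> (h (X + \<epsilon>) - g (X - \<epsilon>)) / (2 * \<epsilon>)"
    and left_ineq: "\<And>Y. t 1 - \<delta> < Y \<Longrightarrow> Y < t 1 \<Longrightarrow>
      g1 (Y + \<epsilon>) \<le> (g (Y + \<epsilon>) - h (Y - \<epsilon>)) / (2 * \<epsilon>) \<and>
      h1 (Y - \<epsilon>) \<le> (g (Y + \<epsilon>) - h (Y - \<epsilon>)) / (2 * \<epsilon>)"
begin

lemma t_cont: "continuous_on {0..1} t"
  using t_der by (rule DERIV_continuous_on)

lemma s_der: "q \<in> {0..1} \<Longrightarrow> (s has_real_derivative t' q + 4 * \<epsilon>) (at q within {0..1})"
proof -
  assume q: "q \<in> {0..1}"
  have "((\<lambda>q. t q + 2 * \<epsilon> * (2 * q - 1)) has_real_derivative t' q + 4 * \<epsilon>) (at q within {0..1})"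
    by (auto intro!: derivative_eq_intros t_der q)
  then show ?thesis by (simp add: s_eq[abs_def])
qed

lemma s_cont: "continuous_on {0..1} s"
  using s_der by (rule DERIV_continuous_on)

lemma t_der_at: "0 < q \<Longrightarrow> q < 1 \<Longrightarrow> (t has_real_derivative t' q) (at q)"
  using t_der[of q] by (simp add: at_within_Icc_at)

lemma s_der_at: "0 < q \<Longrightarrow> q < 1 \<Longrightarrow> (s has_real_derivative t' q + 4 * \<epsilon>) (at q)"
  using s_der[of q] by (simp add: at_within_Icc_at)

lemma t_less: "t q < t p" if "0 \<le> p" "p < q" "q \<le> 1"
proof (rule DERIV_neg_imp_decreasing_open[OF that(2)])
  show "\<exists>y. (t has_real_derivative y) (at x) \<and> y < 0" if "p < x" "x < q" for x
    using t_der_at[of x] t'_less[of x] that \<open>0 \<le> p\<close> \<open>q \<le> 1\<close> eps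
    by (intro exI[of _ "t' x"]) auto
  show "continuous_on {p..q} t"
    using that by (intro continuous_on_subset[OF t_cont]) auto
qed

lemma s_less: "s q < s p" if "0 \<le> p" "p < q" "q \<le> 1"
proof (rule DERIV_neg_imp_decreasing_open[OF that(2)])
  show "\<exists>y. (s has_real_derivative y) (at x) \<and> y < 0" if "p < x" "x < q" for x
    using s_der_at[of x] t'_less[of x] that \<open>0 \<le> p\<close> \<open>q \<le> 1\<close> eps
    by (intro exI[of _ "t' x + 4 * \<epsilon>"]) auto
  show "continuous_on {p..q} s"
    using that by (intro continuous_on_subset[OF s_cont]) auto
qed

lemma st_ends: "s 0 = t 0 - 2 * \<epsilon>" "s 1 = t 1 + 2 * \<epsilon>"
  by (simp_all add: s_eq)

definition spine_param :: "real \<Rightarrow> real" where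
  "spine_param q = t q - \<epsilon> + 2 * \<epsilon> * q"

lemma spine_param_der:
  "q \<in> {0..1} \<Longrightarrow> (spine_param has_real_derivative t' q + 2 * \<epsilon>) (at q within {0..1})"
  unfolding spine_param_def by (auto intro!: derivative_eq_intros t_der)

lemma spine_param_cont: "continuous_on {0..1} spine_param"
  using spine_param_der by (rule DERIV_continuous_on)

lemma spine_param_less: "spine_param q < spine_param p" if "0 \<le> p" "p < q" "q \<le> 1"
  using t_less[OF that] s_less[OF that] by (simp add: spine_param_def s_eq algebra_simps)

end

text \<open>The functions \<open>kU\<close> and \<open>kL\<close> are the mixed derivative on the two sides of the spine, prolonged by
  that of the left and of the right tangent function. The inverses \<open>Qs\<close>, \<open>Qt\<close>, \<open>Qu\<close> are constant
  beyond the ends of the spine.\<close>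

locale fissure_foliation = fissure_data +
  fixes Qs Qt Qu kU kL m n :: "real \<Rightarrow> real"
  assumes Qs_cont: "continuous_on UNIV Qs" and Qs_range: "\<And>x. Qs x \<in> {0..1}"
    and Qs_s: "\<And>q. q \<in> {0..1} \<Longrightarrow> Qs (s q) = q"
    and s_Qs: "\<And>x. s (Qs x) = max (s 1) (min (s 0) x)"
    and Qt_cont: "continuous_on UNIV Qt" and Qt_range: "\<And>x. Qt x \<in> {0..1}"
    and Qt_t: "\<And>q. q \<in> {0..1} \<Longrightarrow> Qt (t q) = q"
    and t_Qt: "\<And>x. t (Qt x) = max (t 1) (min (t 0) x)"
    and Qu_cont: "continuous_on UNIV Qu" and Qu_range: "\<And>x. Qu x \<in> {0..1}"
    and Qu_u: "\<And>q. q \<in> {0..1} \<Longrightarrow> Qu (spine_param q) = q"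
    and u_Qu: "\<And>x. spine_param (Qu x) = max (spine_param 1) (min (spine_param 0) x)"
    and kU: "\<And>X. kU X = (if X \<le> s 0 then k (Qs X) else (h (X + \<epsilon>) - g (X - \<epsilon>)) / (4 * \<epsilon>))"
    and kL: "\<And>Y. kL Y = (if t 1 \<le> Y then k (Qt Y) else (g (Y + \<epsilon>) - h (Y - \<epsilon>)) / (4 * \<epsilon>))"
    and kU_cont: "continuous_on UNIV kU" and kL_cont: "continuous_on UNIV kL"
    and m_der: "\<And>X. (m has_real_derivative kU X) (at X)"
    and m_0: "m (s 0) = (fm (s 0 + \<epsilon>) - fp (s 0 - \<epsilon>)) / (4 * \<epsilon>)"
    and n_der: "\<And>Y. (n has_real_derivative kL Y) (at Y)"
    and n_0: "n (t 0) = g (s 0 - \<epsilon>) + 4 * \<epsilon> * k 0 - m (s 0)"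

lemma (in fissure_data) foliation_exists:
  obtains Qs Qt Qu kU kL m n where
    "fissure_foliation \<epsilon> \<delta> fp fm g h g1 h1 s t t' k k' Qs Qt Qu kU kL m n"
proof -
  obtain Qs where Qs: "continuous_on UNIV Qs" "\<forall>x. Qs x \<in> {0..1}"
    "\<forall>q\<in>{0..1}. Qs (s q) = q" "\<forall>x. s (Qs x) = max (s 1) (min (s 0) x)"
    using strict_antimono_inverse[OF s_cont s_less] by blast
  obtain Qt where Qt: "continuous_on UNIV Qt" "\<forall>x. Qt x \<in> {0..1}"
    "\<forall>q\<in>{0..1}. Qt (t q) = q" "\<forall>x. t (Qt x) = max (t 1) (min (t 0) x)"
    using strict_antimono_inverse[OF t_cont t_less] by blast
  obtain Qu where Qu: "continuous_on UNIV Qu" "\<forall>x. Qu x \<in> {0..1}"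
    "\<forall>q\<in>{0..1}. Qu (spine_param q) = q"
    "\<forall>x. spine_param (Qu x) = max (spine_param 1) (min (spine_param 0) x)"
    using strict_antimono_inverse[OF spine_param_cont spine_param_less] by blast
  have gc: "continuous_on A (\<lambda>X. g (X + c))" for A c
    by (rule DERIV_continuous_on[where D = "\<lambda>X. g1 (X + c)"])
      (use g_der in \<open>auto simp flip: DERIV_shift intro: has_field_derivative_at_within\<close>)
  have hc: "continuous_on A (\<lambda>X. h (X + c))" for A c
    by (rule DERIV_continuous_on[where D = "\<lambda>X. h1 (X + c)"])
      (use h_der in \<open>auto simp flip: DERIV_shift intro: has_field_derivative_at_within\<close>)
  define kU where "kU X = (if X \<le> s 0 then k (Qs X) else (h (X + \<epsilon>) - g (X - \<epsilon>)) / (4 * \<epsilon>))" for X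
  define kL where "kL Y = (if t 1 \<le> Y then k (Qt Y) else (g (Y + \<epsilon>) - h (Y - \<epsilon>)) / (4 * \<epsilon>))" for Y
  have 1: "continuous_on UNIV kU"
  proof -
    have "continuous_on ({..s 0} \<union> {s 0..}) kU"
      unfolding kU_def
    proof (rule continuous_on_cases)
      show "continuous_on {..s 0} (\<lambda>X. k (Qs X))"
        using Qs(1,2) by (intro continuous_on_compose2[OF k_cont] continuous_on_subset[OF Qs(1)]) auto
      show "continuous_on {s 0..} (\<lambda>X. (h (X + \<epsilon>) - g (X - \<epsilon>)) / (4 * \<epsilon>))"
        using gc[of _ "-\<epsilon>"] hc[of _ \<epsilon>] eps by (intro continuous_intros) auto
      \<comment> \<open>The branches meet because the spine touches the bottom boundary at
        \<open>q = 0\<close>: with \<open>t 0 = s 0 + 2 * \<epsilon>\<close> the relation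
        \<open>k_eq\<close> becomes the difference quotient of the tangent domain.\<close>
      have "k (Qs (s 0)) = (h (s 0 + \<epsilon>) - g (s 0 - \<epsilon>)) / (4 * \<epsilon>)"
        using k_eq[of 0] bspec[OF Qs(3), of 0] eps by (simp add: st_ends field_simps)
      then show "\<forall>x. x \<in> {..s 0} \<and> \<not> x \<le> s 0 \<or> x \<in> {s 0..} \<and> x \<le> s 0 \<longrightarrow>
        k (Qs x) = (h (x + \<epsilon>) - g (x - \<epsilon>)) / (4 * \<epsilon>)" by auto
    qed auto
    moreover have "{..s 0} \<union> {s 0..} = UNIV" by auto
    ultimately show ?thesis by simp
  qed
  have 2: "continuous_on UNIV kL"
  proof -
    have "continuous_on ({t 1..} \<union> {..t 1}) kL"
      unfolding kL_def
    proof (rule continuous_on_cases)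
      show "continuous_on {t 1..} (\<lambda>X. k (Qt X))"
        using Qt(1,2) by (intro continuous_on_compose2[OF k_cont] continuous_on_subset[OF Qt(1)]) auto
      show "continuous_on {..t 1} (\<lambda>X. (g (X + \<epsilon>) - h (X - \<epsilon>)) / (4 * \<epsilon>))"
        using gc[of _ \<epsilon>] hc[of _ "-\<epsilon>"] eps by (intro continuous_intros) auto
      have "k (Qt (t 1)) = (g (t 1 + \<epsilon>) - h (t 1 - \<epsilon>)) / (4 * \<epsilon>)"
        using k_eq[of 1] bspec[OF Qt(3), of 1] eps by (simp add: st_ends field_simps)
      then show "\<forall>x. x \<in> {t 1..} \<and> \<not> t 1 \<le> x \<or> x \<in> {..t 1} \<and> t 1 \<le> x \<longrightarrow>
        k (Qt x) = (g (x + \<epsilon>) - h (x - \<epsilon>)) / (4 * \<epsilon>)" by auto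
    qed auto
    moreover have "{t 1..} \<union> {..t 1} = UNIV" by auto
    ultimately show ?thesis by simp
  qed
  obtain m where m: "\<forall>X. (m has_real_derivative kU X) (at X)"
    "m (s 0) = (fm (s 0 + \<epsilon>) - fp (s 0 - \<epsilon>)) / (4 * \<epsilon>)"
    using antideriv_exists[OF 1] by blast
  obtain n where n: "\<forall>X. (n has_real_derivative kL X) (at X)"
    "n (t 0) = g (s 0 - \<epsilon>) + 4 * \<epsilon> * k 0 - m (s 0)"
    using antideriv_exists[OF 2] by blast
  show thesis
    by (rule that, unfold_locales)
      (fact Qs[rule_format] Qt[rule_format] Qu[rule_format] kU_def kL_def 1 2 m[rule_format] n[rule_format])+
qed

section \<open>The candidate on the two sides of the spine\<close>

context fissure_foliation
begin

lemma Qs_eq: "s 1 \<le> X \<Longrightarrow> X \<le> s 0 \<Longrightarrow> s (Qs X) = X"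
  by (simp add: s_Qs)

lemma Qt_eq: "t 1 \<le> Y \<Longrightarrow> Y \<le> t 0 \<Longrightarrow> t (Qt Y) = Y"
  by (simp add: t_Qt)

lemma t_le: "0 \<le> p \<Longrightarrow> p \<le> q \<Longrightarrow> q \<le> 1 \<Longrightarrow> t q \<le> t p"
  using t_less[of p q] by (cases "p = q") auto

lemma s_le: "0 \<le> p \<Longrightarrow> p \<le> q \<Longrightarrow> q \<le> 1 \<Longrightarrow> s q \<le> s p"
  using s_less[of p q] by (cases "p = q") auto

lemma Qt_antimono: "Y \<le> Y' \<Longrightarrow> Qt Y' \<le> Qt Y"
  using t_less[of "Qt Y" "Qt Y'"] Qt_range[of Y] Qt_range[of Y'] by (force simp: t_Qt not_less[symmetric])

text \<open>In the coordinates \<open>(X, Y)\<close> the spine is the graph of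
  \<open>\<sigma>\<close>, so comparing \<open>X\<close> with \<open>\<sigma> Y\<close> decides the
  side of the spine; the clamped inverse continues this decision to all \<open>Y\<close>.\<close>

definition \<sigma> :: "real \<Rightarrow> real" where "\<sigma> Y = s (Qt Y)"

lemma \<sigma>_mono: "Y \<le> Y' \<Longrightarrow> \<sigma> Y \<le> \<sigma> Y'"
  unfolding \<sigma>_def using Qt_antimono Qt_range[of Y] Qt_range[of Y'] by (intro s_le) auto

lemma \<sigma>_t: "q \<in> {0..1} \<Longrightarrow> \<sigma> (t q) = s q"
  by (simp add: \<sigma>_def Qt_t)

lemma \<sigma>_cont: "continuous_on UNIV \<sigma>"
  unfolding \<sigma>_def using Qt_range
  by (intro continuous_on_compose2[OF s_cont Qt_cont]) auto

lemma \<sigma>_bounds: "s 1 \<le> \<sigma> Y" "\<sigma> Y \<le> s 0"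
  unfolding \<sigma>_def using Qt_range[of Y] by (auto intro!: s_le)

text \<open>For \<open>Y < t 1\<close> the clamped value
  \<open>\<sigma> Y = s 1 = t 1 + 2 * \<epsilon>\<close> exceeds every \<open>X\<close> of the strip
  on that diagonal, so the whole right tangent domain counts as left of the spine.\<close>

lemma upper_left: "t 1 \<le> Y" if "\<sigma> Y \<le> X" "X - Y \<le> 2 * \<epsilon>"
proof (rule ccontr)
  assume "\<not> t 1 \<le> Y"
  then show False using that \<sigma>_bounds[of Y] st_ends by simp
qed

text \<open>Clamping adds solutions of \<open>X = \<sigma> Y\<close> that are not spine points, but
  they lie outside the strip. Hence the two formulas need to be matched at genuine spine points
  only.\<close>

lemma on_spine: "\<exists>q\<in>{0..1}. X = s q \<and> Y = t q" if "X = \<sigma> Y" "\<bar>X - Y\<bar> \<le> 2 * \<epsilon>"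
proof -
  have "t 1 \<le> Y" using that by (intro upper_left[of _ X]) auto
  moreover have "Y \<le> t 0"
  proof (rule ccontr)
    assume *: "\<not> Y \<le> t 0"
    show False using that * \<sigma>_bounds[of Y] st_ends by simp
  qed
  ultimately show ?thesis
    using that Qt_eq[of Y] Qt_range[of Y] by (auto simp: \<sigma>_def intro!: bexI[of _ "Qt Y"])
qed

text \<open>The case rule behind the foliation, the ruling and the explicit formula. Spine points
  are assigned to the upper ribs, hence the strict inequality in the lower case.\<close>

lemma rib_cases:
  assumes "t 1 \<le> Y" "X \<le> s 0" "\<bar>X - Y\<bar> \<le> 2 * \<epsilon>"
  obtains (upper) q where "q \<in> {0..1}" "X = s q" "Y \<le> t q" "\<sigma> Y \<le> X"
    | (lower) q where "q \<in> {0..1}" "Y = t q" "X < s q"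
proof (cases "\<sigma> Y \<le> X")
  case True
  have X: "X = s (Qs X)" using True assms \<sigma>_bounds[of Y] by (intro Qs_eq[symmetric]) auto
  have "Y \<le> t (Qs X)"
  proof (rule ccontr)
    assume *: "\<not> Y \<le> t (Qs X)"
    have Y: "Y \<le> t 0" using assms st_ends by simp
    have "Qt Y < Qs X"
    proof (rule ccontr)
      assume "\<not> Qt Y < Qs X"
      then have "t (Qt Y) \<le> t (Qs X)" using Qs_range[of X] Qt_range[of Y] by (intro t_le) auto
      then show False using * Qt_eq[OF assms(1) Y] by simp
    qed
    then have "s (Qs X) < s (Qt Y)" using Qs_range[of X] Qt_range[of Y] by (intro s_less) auto
    then show False using True X by (simp add: \<sigma>_def)
  qed
  then show thesis using upper X Qs_range True by blast
next
  case False
  have "Y \<le> t 0" using assms st_ends by simp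
  then have "Y = t (Qt Y)" using Qt_eq assms by simp
  then show thesis using lower[of "Qt Y"] Qt_range False by (simp add: \<sigma>_def)
qed

lemma \<sigma>_le_upper: "q \<in> {0..1} \<Longrightarrow> Y \<le> t q \<Longrightarrow> \<sigma> Y \<le> s q"
  using \<sigma>_mono[of Y "t q"] \<sigma>_t by simp

section \<open>Slopes on the tangent domains and matching conditions along the spine\<close>

lemma m_right: "s 0 \<le> X \<Longrightarrow> m X = (fm (X + \<epsilon>) - fp (X - \<epsilon>)) / (4 * \<epsilon>)"
proof (cases "s 0 = X")
  case False
  assume X: "s 0 \<le> X"
  let ?f = "\<lambda>X. m X - (fm (X + \<epsilon>) - fp (X - \<epsilon>)) / (4 * \<epsilon>)"
  have "((\<lambda>X. fm (X + \<epsilon>)) has_real_derivative h (x + \<epsilon>)) (at x)" for x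
    using fm_der by (simp flip: DERIV_shift)
  moreover have "((\<lambda>X. fp (X - \<epsilon>)) has_real_derivative g (x - \<epsilon>)) (at x)" for x
    using fp_der[of "x - \<epsilon>"] DERIV_shift[of fp _ x "-\<epsilon>"] by simp
  ultimately have "(?f has_real_derivative kU x - (h (x + \<epsilon>) - g (x - \<epsilon>)) / (4 * \<epsilon>)) (at x)" for x
    by (intro DERIV_diff m_der DERIV_cdivide)
  then have d: "(?f has_real_derivative kU x - (h (x + \<epsilon>) - g (x - \<epsilon>)) / (4 * \<epsilon>)) (at x within A)" for x A
    by (rule has_field_derivative_at_within)
  have "?f X = ?f (s 0)"
  proof (rule DERIV_isconst_end[where f = ?f])
    show "continuous_on {s 0..X} ?f" by (rule DERIV_continuous_on[OF d])
    show "(?f has_real_derivative 0) (at x)" if "s 0 < x" for x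
      using d[of x UNIV] that by (simp add: kU)
  qed (use False \<open>s 0 \<le> X\<close> in auto)
  then show ?thesis using m_0 by simp
qed (use m_0 in simp)

lemma m_cont: "continuous_on A m"
  using m_der by (blast intro: DERIV_continuous_on has_field_derivative_at_within)

lemma n_cont: "continuous_on A n"
  using n_der by (blast intro: DERIV_continuous_on has_field_derivative_at_within)

lemma g_cont: "continuous_on A g"
  using g_der by (blast intro: DERIV_continuous_on has_field_derivative_at_within)

lemma h_cont: "continuous_on A h"
  using h_der by (blast intro: DERIV_continuous_on has_field_derivative_at_within)

lemma fp_cont: "continuous_on A fp"
  using fp_der by (blast intro: DERIV_continuous_on has_field_derivative_at_within)

lemma fm_cont: "continuous_on A fm"
  using fm_der by (blast intro: DERIV_continuous_on has_field_derivative_at_within)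

lemma comp_s_der:
  assumes "\<And>x. (f has_real_derivative f' x) (at x)" "0 < q" "q < 1"
  shows "((\<lambda>q. f (s q + c)) has_real_derivative f' (s q + c) * (t' q + 4 * \<epsilon>)) (at q)"
  by (rule DERIV_chain2[OF assms(1)]) (use s_der_at[OF assms(2,3)] in \<open>auto intro!: derivative_eq_intros\<close>)

lemma comp_t_der:
  assumes "\<And>x. (f has_real_derivative f' x) (at x)" "0 < q" "q < 1"
  shows "((\<lambda>q. f (t q + c)) has_real_derivative f' (t q + c) * t' q) (at q)"
  by (rule DERIV_chain2[OF assms(1)]) (use t_der_at[OF assms(2,3)] in \<open>auto intro!: derivative_eq_intros\<close>)

lemma kU_s: "q \<in> {0..1} \<Longrightarrow> kU (s q) = k q"
  using s_le[of 0 q] Qs_s by (simp add: kU)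

lemma kL_t: "q \<in> {0..1} \<Longrightarrow> kL (t q) = k q"
  using t_le[of q 1] Qt_t by (simp add: kL)

text \<open>These are the C1 conditions across the spine, one for each component of the gradient. In
  the first the difference of the two sides has derivative zero by \<open>k'_s\<close> and vanishes
  at \<open>q = 0\<close> by the choice of \<open>n_0\<close>; the second follows from it through
  \<open>k_eq\<close>.\<close>

lemma slopes_sum:
  assumes "q \<in> {0..1}"
  shows "m (s q) + n (t q) = g (s q - \<epsilon>) + 4 * \<epsilon> * (1 - q) * k q"
    and "m (s q) + n (t q) = h (t q - \<epsilon>) + 4 * \<epsilon> * q * k q"
proof -
  let ?f = "\<lambda>q. m (s q) + n (t q) - (g (s q - \<epsilon>) + 4 * \<epsilon> * (1 - q) * k q)"
  have "?f q = ?f 0"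
  proof (rule const_on_unit[where f = ?f, OF _ _ assms])
    show "continuous_on {0..1} ?f"
      by (intro continuous_intros k_cont continuous_on_compose2[OF m_cont s_cont]
        continuous_on_compose2[OF n_cont t_cont] continuous_on_compose2[OF g_cont[of UNIV]] s_cont) auto
    fix q :: real assume q: "0 < q" "q < 1"
    have 1: "((\<lambda>q. m (s q)) has_real_derivative k q * (t' q + 4 * \<epsilon>)) (at q)"
      using comp_s_der[OF m_der q, of 0] q by (simp add: kU_s)
    have 2: "((\<lambda>q. n (t q)) has_real_derivative k q * t' q) (at q)"
      using comp_t_der[OF n_der q, of 0] q by (simp add: kL_t)
    have 3: "((\<lambda>q. g (s q - \<epsilon>)) has_real_derivative g1 (s q - \<epsilon>) * (t' q + 4 * \<epsilon>)) (at q)"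
      using comp_s_der[OF g_der q, of "-\<epsilon>"] by simp
    have 4: "((\<lambda>q. 4 * \<epsilon> * (1 - q) * k q) has_real_derivative
        4 * \<epsilon> * (1 - q) * k' q - 4 * \<epsilon> * k q) (at q)"
      by (auto intro!: derivative_eq_intros k_der q)
    have "k q * (t' q + 4 * \<epsilon>) + k q * t' q - (g1 (s q - \<epsilon>) * (t' q + 4 * \<epsilon>) +
      (4 * \<epsilon> * (1 - q) * k' q - 4 * \<epsilon> * k q)) = 0"
      unfolding k'_s[OF q] by (simp add: algebra_simps)
    then show "(?f has_real_derivative 0) (at q)"
      using DERIV_diff[OF DERIV_add[OF 1 2] DERIV_add[OF 3 4]] by simp
  qed
  then show *: "m (s q) + n (t q) = g (s q - \<epsilon>) + 4 * \<epsilon> * (1 - q) * k q"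
    using n_0 by simp
  show "m (s q) + n (t q) = h (t q - \<epsilon>) + 4 * \<epsilon> * q * k q"
    unfolding * using k_eq[OF assms] by (simp add: algebra_simps)
qed

text \<open>Continuity of the candidate across the spine. Substituting \<open>slopes_sum\<close> for
  the boundary slopes makes the derivative of the difference cancel, and at \<open>q = 0\<close> the
  equation is the initial value \<open>m_0\<close>.\<close>

lemma spine_values:
  assumes "q \<in> {0..1}"
  shows "fp (s q - \<epsilon>) + 4 * \<epsilon> * (1 - q) * m (s q) = fm (t q - \<epsilon>) + 4 * \<epsilon> * q * n (t q)"
proof -
  let ?f = "\<lambda>q. fp (s q - \<epsilon>) + 4 * \<epsilon> * (1 - q) * m (s q) - (fm (t q - \<epsilon>) + 4 * \<epsilon> * q * n (t q))"
  have "?f q = ?f 0"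
  proof (rule const_on_unit[where f = ?f, OF _ _ assms])
    show "continuous_on {0..1} ?f"
      by (intro continuous_intros continuous_on_compose2[OF m_cont s_cont]
        continuous_on_compose2[OF n_cont t_cont] continuous_on_compose2[OF fp_cont[of UNIV]]
        continuous_on_compose2[OF fm_cont[of UNIV]] s_cont t_cont) auto
    fix q :: real assume q: "0 < q" "q < 1"
    have 1: "((\<lambda>q. m (s q)) has_real_derivative k q * (t' q + 4 * \<epsilon>)) (at q)"
      using comp_s_der[OF m_der q, of 0] q by (simp add: kU_s)
    have 2: "((\<lambda>q. n (t q)) has_real_derivative k q * t' q) (at q)"
      using comp_t_der[OF n_der q, of 0] q by (simp add: kL_t)
    have 3: "((\<lambda>q. fp (s q - \<epsilon>)) has_real_derivative g (s q - \<epsilon>) * (t' q + 4 * \<epsilon>)) (at q)"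
      using comp_s_der[OF fp_der q, of "-\<epsilon>"] by simp
    have 4: "((\<lambda>q. fm (t q - \<epsilon>)) has_real_derivative h (t q - \<epsilon>) * t' q) (at q)"
      using comp_t_der[OF fm_der q, of "-\<epsilon>"] by simp
    have gh: "g (s q - \<epsilon>) = m (s q) + n (t q) - 4 * \<epsilon> * (1 - q) * k q"
        "h (t q - \<epsilon>) = m (s q) + n (t q) - 4 * \<epsilon> * q * k q"
      using slopes_sum[of q] q by auto
    show "(?f has_real_derivative 0) (at q)"
      by (rule derivative_eq_intros 1 2 3 4 refl)+ (simp add: gh algebra_simps)
  qed
  then show ?thesis
    using m_0 eps st_ends by (simp add: field_simps)
qed

lemma n_left: "Y \<le> t 1 \<Longrightarrow> n Y = (fp (Y + \<epsilon>) - fm (Y - \<epsilon>)) / (4 * \<epsilon>)"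
proof -
  assume Y: "Y \<le> t 1"
  \<comment> \<open>No value of \<open>n\<close> was prescribed at the left end;
    \<open>spine_values\<close> at \<open>q = 1\<close> forces the chord slope of the right tangent
    domain.\<close>
  have 0: "n (t 1) = (fp (t 1 + \<epsilon>) - fm (t 1 - \<epsilon>)) / (4 * \<epsilon>)"
    using spine_values[of 1] eps st_ends by (simp add: field_simps)
  show ?thesis
  proof (cases "t 1 = Y")
    case False
    let ?f = "\<lambda>Y. n Y - (fp (Y + \<epsilon>) - fm (Y - \<epsilon>)) / (4 * \<epsilon>)"
    have "((\<lambda>X. fp (X + \<epsilon>)) has_real_derivative g (x + \<epsilon>)) (at x)" for x
      using fp_der by (simp flip: DERIV_shift)
    moreover have "((\<lambda>X. fm (X - \<epsilon>)) has_real_derivative h (x - \<epsilon>)) (at x)" for x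
      using fm_der[of "x - \<epsilon>"] DERIV_shift[of fm _ x "-\<epsilon>"] by simp
    ultimately have "(?f has_real_derivative kL x - (g (x + \<epsilon>) - h (x - \<epsilon>)) / (4 * \<epsilon>)) (at x)" for x
      by (intro DERIV_diff n_der DERIV_cdivide)
    then have d: "(?f has_real_derivative kL x - (g (x + \<epsilon>) - h (x - \<epsilon>)) / (4 * \<epsilon>)) (at x within A)" for x A
      by (rule has_field_derivative_at_within)
    have "?f (t 1) = ?f Y"
    proof (rule DERIV_isconst_end[where f = ?f])
      show "continuous_on {Y..t 1} ?f" by (rule DERIV_continuous_on[OF d])
      show "(?f has_real_derivative 0) (at x)" if "x < t 1" for x
        using d[of x UNIV] that by (simp add: kL)
    qed (use False Y in auto)
    then show ?thesis using 0 by simp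
  qed (use 0 in simp)
qed

section \<open>The glued candidate and its characteristic derivatives\<close>

definition BU :: "real \<Rightarrow> real \<Rightarrow> real" where
  "BU X Y = fp (X - \<epsilon>) + m X * (Y - X + 2 * \<epsilon>)"

definition BL :: "real \<Rightarrow> real \<Rightarrow> real" where
  "BL X Y = fm (Y - \<epsilon>) + n Y * (X - Y + 2 * \<epsilon>)"

definition F :: "plane \<Rightarrow> real" where
  "F x = (let X = fst x + snd x; Y = fst x - snd x in if \<sigma> Y \<le> X then BU X Y else BL X Y)"

text \<open>\<open>GX\<close> and \<open>GY\<close> are the partial derivatives of \<open>F\<close>
  in the characteristic coordinates. On each side one of them is just the slope of the ribs, the
  other differentiates the coefficients of the affine formula.\<close>

definition GX :: "real \<Rightarrow> real \<Rightarrow> real" where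
  "GX X Y = (if \<sigma> Y \<le> X then g (X - \<epsilon>) - m X + kU X * (Y - X + 2 * \<epsilon>) else n Y)"

definition GY :: "real \<Rightarrow> real \<Rightarrow> real" where
  "GY X Y = (if \<sigma> Y \<le> X then m X else h (Y - \<epsilon>) - n Y + kL Y * (X - Y + 2 * \<epsilon>))"

lemma spine_match:
  assumes "q \<in> {0..1}"
  shows "BU (s q) (t q) = BL (s q) (t q)"
    and "g (s q - \<epsilon>) - m (s q) + kU (s q) * (t q - s q + 2 * \<epsilon>) = n (t q)"
    and "h (t q - \<epsilon>) - n (t q) + kL (t q) * (s q - t q + 2 * \<epsilon>) = m (s q)"
proof -
  have *: "t q - s q + 2 * \<epsilon> = 4 * \<epsilon> * (1 - q)" "s q - t q + 2 * \<epsilon> = 4 * \<epsilon> * q"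
    by (simp_all add: s_eq algebra_simps)
  show "BU (s q) (t q) = BL (s q) (t q)"
    using spine_values[OF assms] unfolding BU_def BL_def * by (simp add: algebra_simps)
  show "g (s q - \<epsilon>) - m (s q) + kU (s q) * (t q - s q + 2 * \<epsilon>) = n (t q)"
    using slopes_sum(1)[OF assms] unfolding * kU_s[OF assms] by (simp add: algebra_simps)
  show "h (t q - \<epsilon>) - n (t q) + kL (t q) * (s q - t q + 2 * \<epsilon>) = m (s q)"
    using slopes_sum(2)[OF assms] unfolding * kL_t[OF assms] by (simp add: algebra_simps)
qed

end

section \<open>Diagonal concavity from a gradient\<close>

lemma same_diagonal_segment:
  assumes "closed_segment p q \<subseteq> \<Omega>" "x \<in> closed_segment p q" "y \<in> closed_segment p q" "same_diagonal p q"
  shows "closed_segment x y \<subseteq> \<Omega>" "same_diagonal x y"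
proof -
  show "closed_segment x y \<subseteq> \<Omega>"
    using assms(1-3) by (meson convex_closed_segment closed_segment_subset order_trans)
  obtain u v where u: "x = (1 - u) *\<^sub>R p + u *\<^sub>R q" and v: "y = (1 - v) *\<^sub>R p + v *\<^sub>R q"
    using assms(2,3) by (auto simp: in_segment)
  from assms(4) show "same_diagonal x y"
    unfolding same_diagonal_def
  proof (elim disj_forward)
    assume e: "fst p + snd p = fst q + snd q"
    have "fst z + snd z = fst p + snd p" if "z = (1 - w) *\<^sub>R p + w *\<^sub>R q" for z w
    proof -
      have "fst z + snd z = (1 - w) * (fst p + snd p) + w * (fst q + snd q)"
        by (simp add: that algebra_simps)
      then show ?thesis using e by (simp add: algebra_simps)
    qed
    then show "fst x + snd x = fst y + snd y" using u v by metis
  next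
    assume e: "fst p - snd p = fst q - snd q"
    have "fst z - snd z = fst p - snd p" if "z = (1 - w) *\<^sub>R p + w *\<^sub>R q" for z w
    proof -
      have "fst z - snd z = (1 - w) * (fst p - snd p) + w * (fst q - snd q)"
        by (simp add: that algebra_simps)
      then show ?thesis using e by (simp add: algebra_simps)
    qed
    then show "fst x - snd x = fst y - snd y" using u v by metis
  qed
qed

lemma diagonally_concave_onI:
  assumes "\<And>p q \<tau>. same_diagonal p q \<Longrightarrow> closed_segment p q \<subseteq> \<Omega> \<Longrightarrow> \<tau> \<in> {0..1} \<Longrightarrow>
    (1 - \<tau>) * B p + \<tau> * B q \<le> B ((1 - \<tau>) *\<^sub>R p + \<tau> *\<^sub>R q)"
  shows "diagonally_concave_on \<Omega> B"
  unfolding diagonally_concave_on_def concave_on_iff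
proof (intro allI impI conjI ballI convex_closed_segment)
  fix p q x y :: plane and u v :: real
  assume *: "same_diagonal p q \<and> closed_segment p q \<subseteq> \<Omega>"
    and xy: "x \<in> closed_segment p q" "y \<in> closed_segment p q"
    and uv: "0 \<le> u" "0 \<le> v" "u + v = 1"
  then have "(1 - v) * B x + v * B y \<le> B ((1 - v) *\<^sub>R x + v *\<^sub>R y)"
    using same_diagonal_segment[of p q \<Omega> x y] by (intro assms) auto
  moreover have "u = 1 - v" using uv by simp
  ultimately show "u * B x + v * B y \<le> B (u *\<^sub>R x + v *\<^sub>R y)" by simp
qed

text \<open>Along a diagonal one of the characteristic coordinates is constant, so a single gradient
  component determines the derivative of \<open>B\<close>, and its monotonicity gives the chord
  inequality. A segment may be traversed either way, which accounts for the two sign cases for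
  \<open>fst d\<close>.\<close>

lemma diagonally_concave_on_gradient:
  fixes B :: "plane \<Rightarrow> real"
  assumes der: "\<And>x. x \<in> \<Omega> \<Longrightarrow> (B has_derivative
      (\<lambda>v. BX x * (fst v + snd v) + BY x * (fst v - snd v))) (at x within \<Omega>)"
    and X: "\<And>x y. x \<in> \<Omega> \<Longrightarrow> y \<in> \<Omega> \<Longrightarrow> fst x - snd x = fst y - snd y \<Longrightarrow> fst x \<le> fst y \<Longrightarrow> BX y \<le> BX x"
    and Y: "\<And>x y. x \<in> \<Omega> \<Longrightarrow> y \<in> \<Omega> \<Longrightarrow> fst x + snd x = fst y + snd y \<Longrightarrow> fst x \<le> fst y \<Longrightarrow> BY y \<le> BY x"
  shows "diagonally_concave_on \<Omega> B"
proof (rule diagonally_concave_onI)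
  fix p q :: plane and \<tau> :: real
  assume pq: "same_diagonal p q" "closed_segment p q \<subseteq> \<Omega>" and \<tau>: "\<tau> \<in> {0..1}"
  define l where "l \<tau> = (1 - \<tau>) *\<^sub>R p + \<tau> *\<^sub>R q" for \<tau> :: real
  define d where "d = q - p"
  define D where "D \<tau> = BX (l \<tau>) * (fst d + snd d) + BY (l \<tau>) * (fst d - snd d)" for \<tau>
  have l: "l x \<in> \<Omega>" if "x \<in> {0..1}" for x
  proof -
    have "l x \<in> closed_segment p q" using that by (auto simp: l_def in_segment)
    then show ?thesis using pq(2) by blast
  qed
  have fst_l: "fst (l x) = fst p + x * fst d" and snd_l: "snd (l x) = snd p + x * snd d" for x
    unfolding l_def d_def by (simp_all add: algebra_simps)
  have "(1 - \<tau>) * B (l 0) + \<tau> * B (l 1) \<le> B (l \<tau>)"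
  proof (rule concave_on_imp_chord[where \<phi>' = D, OF _ _ \<tau>])
    fix x :: real assume x: "x \<in> {0..1}"
    have "(l has_derivative (\<lambda>h. h *\<^sub>R d)) (at x within {0..1})"
      unfolding l_def d_def by (auto intro!: derivative_eq_intros simp: algebra_simps)
    from has_derivative_in_compose2[OF der _ x this] l
    have "((\<lambda>x. B (l x)) has_derivative (\<lambda>h. BX (l x) * (fst (h *\<^sub>R d) + snd (h *\<^sub>R d)) +
        BY (l x) * (fst (h *\<^sub>R d) - snd (h *\<^sub>R d)))) (at x within {0..1})"
      by blast
    moreover have "(\<lambda>h. BX (l x) * (fst (h *\<^sub>R d) + snd (h *\<^sub>R d)) +
        BY (l x) * (fst (h *\<^sub>R d) - snd (h *\<^sub>R d))) = (*) (D x)"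
      by (auto simp: D_def fun_eq_iff algebra_simps)
    ultimately show "((\<lambda>x. B (l x)) has_real_derivative D x) (at x within {0..1})"
      by (simp add: has_field_derivative_def)
  next
    fix x y :: real assume xy: "0 \<le> x" "x \<le> y" "y \<le> 1"
    have lx: "l x \<in> \<Omega>" "l y \<in> \<Omega>" using l xy by auto
    consider "fst d + snd d = 0" | "fst d - snd d = 0"
      using pq(1) by (auto simp: same_diagonal_def d_def)
    then show "D y \<le> D x"
    proof cases
      case 1
      have e: "fst (l x) + snd (l x) = fst (l y) + snd (l y)"
      proof -
        have "fst (l z) + snd (l z) = fst p + snd p + z * (fst d + snd d)" for z
          by (simp add: fst_l snd_l algebra_simps)
        then show ?thesis using 1 by simp
      qed
      show ?thesis
      proof (cases "0 \<le> fst d")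
        case True
        then have "BY (l y) \<le> BY (l x)" using xy by (intro Y lx e) (simp add: fst_l mult_right_mono)
        then show ?thesis using 1 True by (simp add: D_def mult_right_mono)
      next
        case False
        then have "BY (l x) \<le> BY (l y)" using xy
          by (intro Y lx e[symmetric]) (simp add: fst_l mult_right_mono_neg)
        then show ?thesis using 1 False by (simp add: D_def mult_right_mono_neg)
      qed
    next
      case 2
      have e: "fst (l x) - snd (l x) = fst (l y) - snd (l y)"
      proof -
        have "fst (l z) - snd (l z) = fst p - snd p + z * (fst d - snd d)" for z
          by (simp add: fst_l snd_l algebra_simps)
        then show ?thesis using 2 by simp
      qed
      show ?thesis
      proof (cases "0 \<le> fst d")
        case True
        then have "BX (l y) \<le> BX (l x)" using xy by (intro X lx e) (simp add: fst_l mult_right_mono)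
        then show ?thesis using 2 True by (simp add: D_def mult_right_mono)
      next
        case False
        then have "BX (l x) \<le> BX (l y)" using xy
          by (intro X lx e[symmetric]) (simp add: fst_l mult_right_mono_neg)
        then show ?thesis using 2 False by (simp add: D_def mult_right_mono_neg)
      qed
    qed
  qed
  then show "(1 - \<tau>) * B p + \<tau> * B q \<le> B ((1 - \<tau>) *\<^sub>R p + \<tau> *\<^sub>R q)"
    by (simp add: l_def)
qed

section \<open>Smoothness\<close>

context fissure_foliation
begin

lemma F_upper: "\<sigma> (fst x - snd x) \<le> fst x + snd x \<Longrightarrow> F x = BU (fst x + snd x) (fst x - snd x)"
  by (simp add: F_def)

lemma F_lower:
  assumes "x \<in> strip \<epsilon>" "fst x + snd x \<le> \<sigma> (fst x - snd x)"
  shows "F x = BL (fst x + snd x) (fst x - snd x)"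
proof (cases "fst x + snd x = \<sigma> (fst x - snd x)")
  case True
  have "\<bar>(fst x + snd x) - (fst x - snd x)\<bar> \<le> 2 * \<epsilon>"
    using assms(1) by (auto simp: strip_def)
  then obtain q where "q \<in> {0..1}" "fst x + snd x = s q" "fst x - snd x = t q"
    using on_spine[OF True] by blast
  then show ?thesis using F_upper[of x] True spine_match(1)[of q] by simp
qed (use assms in \<open>simp add: F_def\<close>)

text \<open>Immediate right of the spine. A top point left of it must satisfy
  \<open>Y \<le> t 1\<close>, because the spine never rises above the top boundary; there
  \<open>n_left\<close> supplies the value.\<close>

lemma F_top: "(x, \<epsilon>) \<in> strip \<epsilon> \<Longrightarrow> F (x, \<epsilon>) = fp x"
proof (cases "\<sigma> (x - \<epsilon>) \<le> x + \<epsilon>")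
  case False
  have "x - \<epsilon> \<le> t 1"
  proof (rule ccontr)
    assume *: "\<not> x - \<epsilon> \<le> t 1"
    show False
    proof (cases "x - \<epsilon> \<le> t 0")
      case True
      then have "t (Qt (x - \<epsilon>)) = x - \<epsilon>" using * by (intro Qt_eq) auto
      then have "\<sigma> (x - \<epsilon>) = x - \<epsilon> + 2 * \<epsilon> * (2 * Qt (x - \<epsilon>) - 1)"
        by (simp add: \<sigma>_def s_eq)
      moreover have "2 * \<epsilon> * (2 * Qt (x - \<epsilon>) - 1) \<le> 2 * \<epsilon> * 1"
        using Qt_range[of "x - \<epsilon>"] eps by (intro mult_left_mono) auto
      ultimately show ?thesis using False by simp
    next
      case F: False
      then show ?thesis using False \<sigma>_bounds[of "x - \<epsilon>"] st_ends eps by simp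
    qed
  qed
  then show ?thesis using False n_left[of "x - \<epsilon>"] eps by (simp add: F_def BL_def field_simps)
qed (simp add: F_def BU_def)

lemma F_bottom: "(x, - \<epsilon>) \<in> strip \<epsilon> \<Longrightarrow> F (x, - \<epsilon>) = fm x"
proof (cases "\<sigma> (x + \<epsilon>) \<le> x - \<epsilon>")
  case True
  have 1: "t 1 \<le> x + \<epsilon>" using True eps by (intro upper_left[of _ "x - \<epsilon>"]) auto
  \<comment> \<open>A bottom point has \<open>X = Y - 2 * \<epsilon>\<close>, the least value the
    spine can take over \<open>Y\<close>. So \<open>\<sigma> Y \<le> X\<close> is possible only
    where the spine itself reaches the bottom, at \<open>q = 0\<close>, or beyond that end.\<close>
  have "s 0 \<le> x - \<epsilon>"
  proof (rule ccontr)
    assume *: "\<not> s 0 \<le> x - \<epsilon>"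
    then have 2: "t (Qt (x + \<epsilon>)) = x + \<epsilon>" using 1 st_ends by (intro Qt_eq) auto
    then have "\<sigma> (x + \<epsilon>) = x + \<epsilon> + 2 * \<epsilon> * (2 * Qt (x + \<epsilon>) - 1)"
      by (simp add: \<sigma>_def s_eq)
    moreover have "2 * \<epsilon> * (2 * Qt (x + \<epsilon>) - 1) \<ge> 2 * \<epsilon> * (- 1)"
      using Qt_range[of "x + \<epsilon>"] eps by (intro mult_left_mono) auto
    ultimately have "2 * \<epsilon> * (2 * Qt (x + \<epsilon>) - 1) = 2 * \<epsilon> * (- 1)"
      using True by linarith
    then have "2 * Qt (x + \<epsilon>) - 1 = - 1" using eps by (subst (asm) mult_left_cancel) auto
    then have "Qt (x + \<epsilon>) = 0" by simp
    then show False using 2 * st_ends by simp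
  qed
  then show ?thesis using True m_right[of "x - \<epsilon>"] eps by (simp add: F_def BU_def field_simps)
qed (simp add: F_def BL_def)

lemma has_derivative_real_comp:
  fixes l :: "plane \<Rightarrow> real"
  assumes "\<And>x. (f has_real_derivative f' x) (at x)" "(l has_derivative l') (at x within S)"
  shows "((\<lambda>x. f (l x)) has_derivative (\<lambda>v. f' (l x) * l' v)) (at x within S)"
  using has_derivative_compose[OF assms(2) assms(1)[unfolded has_field_derivative_def]] .

lemma BU_der:
  "((\<lambda>x. BU (fst x + snd x) (fst x - snd x)) has_derivative
    (\<lambda>v. (g (fst x + snd x - \<epsilon>) - m (fst x + snd x) +
            kU (fst x + snd x) * ((fst x - snd x) - (fst x + snd x) + 2 * \<epsilon>)) * (fst v + snd v) +
         m (fst x + snd x) * (fst v - snd v))) (at x within S)"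
proof -
  have "((\<lambda>x::plane. fst x + snd x - \<epsilon>) has_derivative (\<lambda>v. fst v + snd v)) (at x within S)"
    by (auto intro!: derivative_eq_intros)
  note 1 = has_derivative_real_comp[OF fp_der this]
  have "((\<lambda>x::plane. fst x + snd x) has_derivative (\<lambda>v. fst v + snd v)) (at x within S)"
    by (auto intro!: derivative_eq_intros)
  note 2 = has_derivative_real_comp[OF m_der this]
  show ?thesis
    unfolding BU_def
    by (rule derivative_eq_intros 1 2 refl)+ (auto simp: fun_eq_iff algebra_simps)
qed

lemma BL_der:
  "((\<lambda>x. BL (fst x + snd x) (fst x - snd x)) has_derivative
    (\<lambda>v. n (fst x - snd x) * (fst v + snd v) +
      (h (fst x - snd x - \<epsilon>) - n (fst x - snd x) +
            kL (fst x - snd x) * ((fst x + snd x) - (fst x - snd x) + 2 * \<epsilon>)) * (fst v - snd v)))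
      (at x within S)"
proof -
  have "((\<lambda>x::plane. fst x - snd x - \<epsilon>) has_derivative (\<lambda>v. fst v - snd v)) (at x within S)"
    by (auto intro!: derivative_eq_intros)
  note 1 = has_derivative_real_comp[OF fm_der this]
  have "((\<lambda>x::plane. fst x - snd x) has_derivative (\<lambda>v. fst v - snd v)) (at x within S)"
    by (auto intro!: derivative_eq_intros)
  note 2 = has_derivative_real_comp[OF n_der this]
  show ?thesis
    unfolding BL_def
    by (rule derivative_eq_intros 1 2 refl)+ (auto simp: fun_eq_iff algebra_simps)
qed

lemma grad_lower:
  assumes "\<bar>X - Y\<bar> \<le> 2 * \<epsilon>" "X \<le> \<sigma> Y"
  shows "GX X Y = n Y" "GY X Y = h (Y - \<epsilon>) - n Y + kL Y * (X - Y + 2 * \<epsilon>)"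
proof -
  have "GX X Y = n Y \<and> GY X Y = h (Y - \<epsilon>) - n Y + kL Y * (X - Y + 2 * \<epsilon>)"
  proof (cases "X = \<sigma> Y")
    case True
    then obtain q where q: "q \<in> {0..1}" "X = s q" "Y = t q"
      using on_spine assms by blast
    show ?thesis
      using spine_match(2,3)[OF q(1)] True by (simp add: GX_def GY_def flip: q(2,3))
  qed (use assms in \<open>simp add: GX_def GY_def\<close>)
  then show "GX X Y = n Y" "GY X Y = h (Y - \<epsilon>) - n Y + kL Y * (X - Y + 2 * \<epsilon>)" by auto
qed

definition upper_side :: "plane set" where
  "upper_side = {x. \<bar>snd x\<bar> \<le> \<epsilon> \<and> \<sigma> (fst x - snd x) \<le> fst x + snd x}"

definition lower_side :: "plane set" where
  "lower_side = {x. \<bar>snd x\<bar> \<le> \<epsilon> \<and> fst x + snd x \<le> \<sigma> (fst x - snd x)}"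

lemma strip_split: "strip \<epsilon> = upper_side \<union> lower_side"
  by (auto simp: strip_def upper_side_def lower_side_def)

lemma \<sigma>_diff_cont: "continuous_on UNIV (\<lambda>x::plane. \<sigma> (fst x - snd x))"
  by (intro continuous_on_compose2[OF \<sigma>_cont] continuous_intros) auto

lemma closed_sides: "closed upper_side" "closed lower_side"
  unfolding upper_side_def lower_side_def
  by (intro closed_Collect_conj closed_Collect_le continuous_intros \<sigma>_diff_cont)+

text \<open>Both sides of the spine are closed, and on their intersection the values and gradients
  of the two formulas agree, so the rule for piecewise derivatives applies. Working in the whole
  strip makes every region a mere restriction.\<close>

lemma F_der:
  assumes "x \<in> strip \<epsilon>"
  shows "(F has_derivative (\<lambda>v. GX (fst x + snd x) (fst x - snd x) * (fst v + snd v) +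
    GY (fst x + snd x) (fst x - snd x) * (fst v - snd v))) (at x within strip \<epsilon>)"
proof -
  let ?U = "\<lambda>x. BU (fst x + snd x) (fst x - snd x)" and ?L = "\<lambda>x. BL (fst x + snd x) (fst x - snd x)"
  let ?U' = "\<lambda>x v. (g (fst x + snd x - \<epsilon>) - m (fst x + snd x) +
            kU (fst x + snd x) * ((fst x - snd x) - (fst x + snd x) + 2 * \<epsilon>)) * (fst v + snd v) +
         m (fst x + snd x) * (fst v - snd v)"
  let ?L' = "\<lambda>x v. n (fst x - snd x) * (fst v + snd v) +
      (h (fst x - snd x - \<epsilon>) - n (fst x - snd x) +
            kL (fst x - snd x) * ((fst x + snd x) - (fst x - snd x) + 2 * \<epsilon>)) * (fst v - snd v)"
  let ?F' = "\<lambda>x v. GX (fst x + snd x) (fst x - snd x) * (fst v + snd v) +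
    GY (fst x + snd x) (fst x - snd x) * (fst v - snd v)"
  define u l u' l' f' where "u = ?U" and "l = ?L" and "u' = ?U'" and "l' = ?L'" and "f' = ?F'"
  have U: "F y = u y \<and> f' y = u' y" if "y \<in> upper_side" for y
    using that by (simp add: u_def u'_def f'_def upper_side_def F_def GX_def GY_def)
  have L: "F y = l y \<and> f' y = l' y" if "y \<in> lower_side" for y
  proof -
    have y: "y \<in> strip \<epsilon>" "fst y + snd y \<le> \<sigma> (fst y - snd y)"
      using that by (auto simp: lower_side_def strip_def)
    then have "\<bar>(fst y + snd y) - (fst y - snd y)\<bar> \<le> 2 * \<epsilon>" by (auto simp: strip_def)
    then show ?thesis using F_lower[OF y] grad_lower[OF _ y(2)] by (simp add: l_def l'_def f'_def)
  qed
  have cl: "closure upper_side = upper_side" "closure lower_side = lower_side"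
    using closed_sides by simp_all
  have "((\<lambda>x. if x \<in> upper_side then u x else l x) has_derivative
      (if x \<in> upper_side then u' x else l' x)) (at x within (upper_side \<union> lower_side))"
  proof (rule has_derivative_If_within_closures, goal_cases)
    case 1 show ?case unfolding u_def u'_def by (rule BU_der)
  next
    case 2 show ?case unfolding l_def l'_def by (rule BL_der)
  next
    case 3 then show ?case using U[of x] L[of x] by (simp add: cl)
  next
    case 4 then show ?case using U[of x] L[of x] by (simp add: cl)
  next
    case 5 show ?case using assms strip_split by simp
  qed
  moreover have "(if x \<in> upper_side then u' x else l' x) = f' x"
    using U[of x] L[of x] assms by (auto simp: strip_split)
  ultimately have "((\<lambda>x. if x \<in> upper_side then u x else l x) has_derivative f' x) (at x within strip \<epsilon>)"
    by (simp add: strip_split)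
  then have "(F has_derivative f' x) (at x within strip \<epsilon>)"
    by (rule has_derivative_transform[OF assms, rotated]) (use U L in \<open>auto simp: strip_split\<close>)
  then show ?thesis by (simp add: f'_def)
qed

lemma F_C1: "C1_on (strip \<epsilon>) F"
  unfolding C1_on_def
proof (intro exI conjI ballI)
  let ?X = "\<lambda>x. GX (fst x + snd x) (fst x - snd x)" and ?Y = "\<lambda>x. GY (fst x + snd x) (fst x - snd x)"
  show "(F has_derivative (\<lambda>v. (?X x + ?Y x, ?X x - ?Y x) \<bullet> v)) (at x within strip \<epsilon>)"
    if "x \<in> strip \<epsilon>" for x
    using F_der[OF that] by (simp add: inner_prod_def algebra_simps)
  have c: "continuous_on A (\<lambda>x::plane. f (fst x + snd x + c))" "continuous_on A (\<lambda>x::plane. f (fst x - snd x + c))"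
    if "continuous_on UNIV f" for f :: "real \<Rightarrow> real" and c A
    by (intro continuous_on_compose2[OF that] continuous_intros; simp)+
  note cs = c(1)[OF g_cont, of _ "-\<epsilon>", simplified] c(2)[OF h_cont, of _ "-\<epsilon>", simplified]
    c(1)[OF m_cont, of _ 0, simplified] c(2)[OF n_cont, of _ 0, simplified]
    c(1)[OF kU_cont, of _ 0, simplified] c(2)[OF kL_cont, of _ 0, simplified]
  have X: "continuous_on (strip \<epsilon>) ?X"
  proof -
    have "continuous_on upper_side ?X"
      by (rule continuous_on_eq[of _ "\<lambda>x. g (fst x + snd x - \<epsilon>) - m (fst x + snd x) +
            kU (fst x + snd x) * ((fst x - snd x) - (fst x + snd x) + 2 * \<epsilon>)"])
        (auto intro!: continuous_intros cs simp: GX_def upper_side_def)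
    moreover have "continuous_on lower_side ?X"
      by (rule continuous_on_eq[of _ "\<lambda>x. n (fst x - snd x)"])
        (auto intro!: continuous_intros cs grad_lower(1)[symmetric] simp: lower_side_def)
    ultimately show ?thesis
      unfolding strip_split by (intro continuous_on_closed_Un closed_sides)
  qed
  have Y: "continuous_on (strip \<epsilon>) ?Y"
  proof -
    have "continuous_on upper_side ?Y"
      by (rule continuous_on_eq[of _ "\<lambda>x. m (fst x + snd x)"])
        (auto intro!: continuous_intros cs simp: GY_def upper_side_def)
    moreover have "continuous_on lower_side ?Y"
      by (rule continuous_on_eq[of _ "\<lambda>x. h (fst x - snd x - \<epsilon>) - n (fst x - snd x) +
            kL (fst x - snd x) * ((fst x + snd x) - (fst x - snd x) + 2 * \<epsilon>)"])
        (auto intro!: continuous_intros cs simp: lower_side_def grad_lower(2))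
    ultimately show ?thesis
      unfolding strip_split by (intro continuous_on_closed_Un closed_sides)
  qed
  show "continuous_on (strip \<epsilon>) (\<lambda>x. (?X x + ?Y x, ?X x - ?Y x))"
    by (intro continuous_intros X Y)
qed

end

section \<open>Monotonicity of the gradient\<close>

context fissure_foliation
begin

lemma kU_right: "s 0 \<le> X \<Longrightarrow> kU X = (h (X + \<epsilon>) - g (X - \<epsilon>)) / (4 * \<epsilon>)"
proof -
  assume X: "s 0 \<le> X"
  have "k 0 = (h (s 0 + \<epsilon>) - g (s 0 - \<epsilon>)) / (4 * \<epsilon>)"
    using k_eq[of 0] eps by (simp add: st_ends field_simps)
  then show ?thesis using X Qs_s[of 0] by (cases "X = s 0") (simp_all add: kU)
qed

lemma kL_left: "Y \<le> t 1 \<Longrightarrow> kL Y = (g (Y + \<epsilon>) - h (Y - \<epsilon>)) / (4 * \<epsilon>)"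
proof -
  assume Y: "Y \<le> t 1"
  have "k 1 = (g (t 1 + \<epsilon>) - h (t 1 - \<epsilon>)) / (4 * \<epsilon>)"
    using k_eq[of 1] eps by (simp add: st_ends field_simps)
  then show ?thesis using Y Qt_t[of 1] by (cases "Y = t 1") (simp_all add: kL)
qed

text \<open>The formula of one side without the case distinction: its monotonicity is a matter of
  calculus, and the gluing enters only afterwards. The same holds for
  \<open>lower_GY\<close>.\<close>

definition upper_GX :: "real \<Rightarrow> real \<Rightarrow> real" where
  "upper_GX X Y = g (X - \<epsilon>) - m X + kU X * (Y - X + 2 * \<epsilon>)"

definition lower_GY :: "real \<Rightarrow> real \<Rightarrow> real" where
  "lower_GY X Y = h (Y - \<epsilon>) - n Y + kL Y * (X - Y + 2 * \<epsilon>)"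

lemma upper_GX_cont: "continuous_on A (\<lambda>X. upper_GX X Y)"
  unfolding upper_GX_def
  by (intro continuous_intros m_cont continuous_on_subset[OF kU_cont] continuous_on_compose2[OF g_cont[of UNIV]]) auto

lemma lower_GY_cont: "continuous_on A (\<lambda>Y. lower_GY X Y)"
  unfolding lower_GY_def
  by (intro continuous_intros n_cont continuous_on_subset[OF kL_cont] continuous_on_compose2[OF h_cont[of UNIV]]) auto

text \<open>All terms of the derivative in \<open>q\<close> cancel by \<open>k'_s\<close> except
  \<open>k' q * (Y - t q)\<close>, a product of two nonpositive factors. Since \<open>s\<close>
  decreases in \<open>q\<close>, increase in \<open>q\<close> means decrease in
  \<open>X\<close>.\<close>

lemma upper_GX_spine:
  assumes "0 \<le> q1" "q1 \<le> q2" "q2 \<le> 1" "Y \<le> t q2"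
  shows "upper_GX (s q1) Y \<le> upper_GX (s q2) Y"
proof (rule DERIV_nonneg_imp_increasing_open[of _ _ "\<lambda>q. upper_GX (s q) Y"])
  show "continuous_on {q1..q2} (\<lambda>q. upper_GX (s q) Y)"
    using assms by (intro continuous_on_compose2[OF upper_GX_cont[of UNIV]] continuous_on_subset[OF s_cont]) auto
  fix q assume "q1 < q" "q < q2"
  then have q: "0 < q" "q < 1" "q \<in> {0..1}" using assms by auto
  have "Y \<le> t q" using t_le[of q q2] assms \<open>q < q2\<close> q by auto
  have "((\<lambda>q. m (s q)) has_real_derivative k q * (t' q + 4 * \<epsilon>)) (at q)"
    using comp_s_der[OF m_der q(1,2), of 0] q by (simp add: kU_s)
  moreover have "((\<lambda>q. g (s q - \<epsilon>)) has_real_derivative g1 (s q - \<epsilon>) * (t' q + 4 * \<epsilon>)) (at q)"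
    using comp_s_der[OF g_der q(1,2), of "-\<epsilon>"] by simp
  ultimately have "((\<lambda>q. g (s q - \<epsilon>) - m (s q) + k q * (Y - s q + 2 * \<epsilon>)) has_real_derivative
      (g1 (s q - \<epsilon>) * (t' q + 4 * \<epsilon>) - k q * (t' q + 4 * \<epsilon>) +
        (k' q * (Y - s q + 2 * \<epsilon>) + (0 - (t' q + 4 * \<epsilon>) + 0) * k q))) (at q)"
    by (intro DERIV_add DERIV_diff DERIV_mult k_der s_der_at q DERIV_const)
  also have "(g1 (s q - \<epsilon>) * (t' q + 4 * \<epsilon>) - k q * (t' q + 4 * \<epsilon>) +
        (k' q * (Y - s q + 2 * \<epsilon>) + (0 - (t' q + 4 * \<epsilon>) + 0) * k q)) =
      - ((t' q + 4 * \<epsilon>) * (2 * k q - g1 (s q - \<epsilon>))) + k' q * (Y - s q + 2 * \<epsilon>)"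
    by (simp add: algebra_simps)
  also have "\<dots> = k' q * (Y - t q)"
    unfolding k'_s[OF q(1,2), symmetric] by (simp add: s_eq algebra_simps)
  finally have "((\<lambda>q. upper_GX (s q) Y) has_real_derivative k' q * (Y - t q)) (at q)"
    by (rule has_field_derivative_transform_within_open[of _ _ _ "{0<..<1}"])
      (use q in \<open>auto simp: upper_GX_def kU_s\<close>)
  moreover have "0 \<le> k' q * (Y - t q)"
    using k'_le[OF q(1,2)] \<open>Y \<le> t q\<close> by (intro mult_nonpos_nonpos) auto
  ultimately show "\<exists>y. ((\<lambda>q. upper_GX (s q) Y) has_real_derivative y) (at q) \<and> 0 \<le> y" by blast
qed (use assms in auto)

lemma lower_GY_spine:
  assumes "0 \<le> q1" "q1 \<le> q2" "q2 \<le> 1" "X \<le> s q2"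
  shows "lower_GY X (t q1) \<le> lower_GY X (t q2)"
proof (rule DERIV_nonneg_imp_increasing_open[of _ _ "\<lambda>q. lower_GY X (t q)"])
  show "continuous_on {q1..q2} (\<lambda>q. lower_GY X (t q))"
    using assms by (intro continuous_on_compose2[OF lower_GY_cont[of UNIV]] continuous_on_subset[OF t_cont]) auto
  fix q assume "q1 < q" "q < q2"
  then have q: "0 < q" "q < 1" "q \<in> {0..1}" using assms by auto
  have "X \<le> s q" using s_le[of q q2] assms \<open>q < q2\<close> q by auto
  have "((\<lambda>q. n (t q)) has_real_derivative k q * t' q) (at q)"
    using comp_t_der[OF n_der q(1,2), of 0] q by (simp add: kL_t)
  moreover have "((\<lambda>q. h (t q - \<epsilon>)) has_real_derivative h1 (t q - \<epsilon>) * t' q) (at q)"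
    using comp_t_der[OF h_der q(1,2), of "-\<epsilon>"] by simp
  ultimately have "((\<lambda>q. h (t q - \<epsilon>) - n (t q) + k q * (X - t q + 2 * \<epsilon>)) has_real_derivative
      (h1 (t q - \<epsilon>) * t' q - k q * t' q +
        (k' q * (X - t q + 2 * \<epsilon>) + (0 - t' q + 0) * k q))) (at q)"
    by (intro DERIV_add DERIV_diff DERIV_mult k_der t_der_at q DERIV_const)
  also have "(h1 (t q - \<epsilon>) * t' q - k q * t' q +
        (k' q * (X - t q + 2 * \<epsilon>) + (0 - t' q + 0) * k q)) =
      - (t' q * (2 * k q - h1 (t q - \<epsilon>))) + k' q * (X - t q + 2 * \<epsilon>)"
    by (simp add: algebra_simps)
  also have "\<dots> = k' q * (X - s q)"
    unfolding k'_t[OF q(1,2), symmetric] by (simp add: s_eq algebra_simps)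
  finally have "((\<lambda>q. lower_GY X (t q)) has_real_derivative k' q * (X - s q)) (at q)"
    by (rule has_field_derivative_transform_within_open[of _ _ _ "{0<..<1}"])
      (use q in \<open>auto simp: lower_GY_def kL_t\<close>)
  moreover have "0 \<le> k' q * (X - s q)"
    using k'_le[OF q(1,2)] \<open>X \<le> s q\<close> by (intro mult_nonpos_nonpos) auto
  ultimately show "\<exists>y. ((\<lambda>q. lower_GY X (t q)) has_real_derivative y) (at q) \<and> 0 \<le> y" by blast
qed (use assms in auto)

text \<open>\<open>\<mu>\<close> is the relative position of \<open>Y\<close> on the transversal
  segment, 0 at the top and 1 at the bottom. The derivative is the convex combination of
  \<open>g1 - 2 * \<kappa>\<close> and \<open>h1 - 2 * \<kappa>\<close> with weights
  \<open>1 - \<mu>\<close> and \<open>\<mu>\<close>; \<open>right_ineq\<close> says that both are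
  nonpositive.\<close>

lemma upper_GX_right:
  assumes "s 0 \<le> X1" "X1 \<le> X2" "X2 \<le> s 0 + \<delta>" "X2 - Y \<le> 2 * \<epsilon>" "Y - X1 \<le> 2 * \<epsilon>"
  shows "upper_GX X2 Y \<le> upper_GX X1 Y"
proof (rule DERIV_nonpos_imp_decreasing_open[of _ _ "\<lambda>X. upper_GX X Y"])
  show "continuous_on {X1..X2} (\<lambda>X. upper_GX X Y)" by (rule upper_GX_cont)
  fix X assume X: "X1 < X" "X < X2"
  define \<kappa> where "\<kappa> = (h (X + \<epsilon>) - g (X - \<epsilon>)) / (4 * \<epsilon>)"
  define \<mu> where "\<mu> = (Y - X + 2 * \<epsilon>) / (4 * \<epsilon>)"
  have k: "kU X = \<kappa>" using kU_right X assms by (simp add: \<kappa>_def)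
  have g: "((\<lambda>X. g (X - \<epsilon>)) has_real_derivative g1 (X - \<epsilon>)) (at X)"
    using g_der[of "X - \<epsilon>"] DERIV_shift[of g _ X "-\<epsilon>"] by simp
  have h: "((\<lambda>X. h (X + \<epsilon>)) has_real_derivative h1 (X + \<epsilon>)) (at X)"
    using h_der[of "X + \<epsilon>"] DERIV_shift[of h _ X "\<epsilon>"] by simp
  have "((\<lambda>X. g (X - \<epsilon>) - m X + (h (X + \<epsilon>) - g (X - \<epsilon>)) / (4 * \<epsilon>) * (Y - X + 2 * \<epsilon>)) has_real_derivative
      (g1 (X - \<epsilon>) - kU X + ((h1 (X + \<epsilon>) - g1 (X - \<epsilon>)) / (4 * \<epsilon>) * (Y - X + 2 * \<epsilon>) +
       (0 - 1 + 0) * ((h (X + \<epsilon>) - g (X - \<epsilon>)) / (4 * \<epsilon>))))) (at X)"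
    by (intro DERIV_add DERIV_diff DERIV_mult DERIV_cdivide g h m_der DERIV_const DERIV_ident)
  also have "(g1 (X - \<epsilon>) - kU X + ((h1 (X + \<epsilon>) - g1 (X - \<epsilon>)) / (4 * \<epsilon>) * (Y - X + 2 * \<epsilon>) +
       (0 - 1 + 0) * ((h (X + \<epsilon>) - g (X - \<epsilon>)) / (4 * \<epsilon>)))) =
      g1 (X - \<epsilon>) - 2 * \<kappa> + (h1 (X + \<epsilon>) - g1 (X - \<epsilon>)) * \<mu>"
    using eps unfolding k by (simp add: \<kappa>_def \<mu>_def field_simps)
  finally have "((\<lambda>X. upper_GX X Y) has_real_derivative
      (g1 (X - \<epsilon>) - 2 * \<kappa> + (h1 (X + \<epsilon>) - g1 (X - \<epsilon>)) * \<mu>)) (at X)"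
    by (rule has_field_derivative_transform_within_open[of _ _ _ "{s 0<..}"])
      (use X assms kU_right in \<open>auto simp: upper_GX_def\<close>)
  moreover have "g1 (X - \<epsilon>) - 2 * \<kappa> + (h1 (X + \<epsilon>) - g1 (X - \<epsilon>)) * \<mu> \<le> 0"
  proof -
    have "(h (X + \<epsilon>) - g (X - \<epsilon>)) / (2 * \<epsilon>) = 2 * \<kappa>"
      using eps by (simp add: \<kappa>_def field_simps)
    then have "g1 (X - \<epsilon>) \<le> 2 * \<kappa>" "h1 (X + \<epsilon>) \<le> 2 * \<kappa>"
      using right_ineq[of X] X assms by auto
    moreover have "0 \<le> \<mu>" "\<mu> \<le> 1" using X assms eps by (auto simp: \<mu>_def)
    ultimately have "(1 - \<mu>) * (g1 (X - \<epsilon>) - 2 * \<kappa>) + \<mu> * (h1 (X + \<epsilon>) - 2 * \<kappa>) \<le> 0"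
      by (intro add_nonpos_nonpos mult_nonneg_nonpos) auto
    then show ?thesis by (simp add: algebra_simps)
  qed
  ultimately show "\<exists>y. ((\<lambda>X. upper_GX X Y) has_real_derivative y) (at X) \<and> y \<le> 0" by blast
qed (use assms in auto)

lemma lower_GY_left:
  assumes "t 1 - \<delta> \<le> Y1" "Y1 \<le> Y2" "Y2 \<le> t 1" "Y2 - X \<le> 2 * \<epsilon>" "X - Y1 \<le> 2 * \<epsilon>"
  shows "lower_GY X Y2 \<le> lower_GY X Y1"
proof (rule DERIV_nonpos_imp_decreasing_open[of _ _ "\<lambda>Y. lower_GY X Y"])
  show "continuous_on {Y1..Y2} (\<lambda>Y. lower_GY X Y)" by (rule lower_GY_cont)
  fix Y assume Y: "Y1 < Y" "Y < Y2"
  define \<kappa> where "\<kappa> = (g (Y + \<epsilon>) - h (Y - \<epsilon>)) / (4 * \<epsilon>)"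
  define \<mu> where "\<mu> = (X - Y + 2 * \<epsilon>) / (4 * \<epsilon>)"
  have k: "kL Y = \<kappa>" using kL_left Y assms by (simp add: \<kappa>_def)
  have g: "((\<lambda>X. g (X + \<epsilon>)) has_real_derivative g1 (Y + \<epsilon>)) (at Y)"
    using g_der[of "Y + \<epsilon>"] DERIV_shift[of g _ Y "\<epsilon>"] by simp
  have h: "((\<lambda>X. h (X - \<epsilon>)) has_real_derivative h1 (Y - \<epsilon>)) (at Y)"
    using h_der[of "Y - \<epsilon>"] DERIV_shift[of h _ Y "-\<epsilon>"] by simp
  have "((\<lambda>Y. h (Y - \<epsilon>) - n Y + (g (Y + \<epsilon>) - h (Y - \<epsilon>)) / (4 * \<epsilon>) * (X - Y + 2 * \<epsilon>)) has_real_derivative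
      (h1 (Y - \<epsilon>) - kL Y + ((g1 (Y + \<epsilon>) - h1 (Y - \<epsilon>)) / (4 * \<epsilon>) * (X - Y + 2 * \<epsilon>) +
       (0 - 1 + 0) * ((g (Y + \<epsilon>) - h (Y - \<epsilon>)) / (4 * \<epsilon>))))) (at Y)"
    by (intro DERIV_add DERIV_diff DERIV_mult DERIV_cdivide g h n_der DERIV_const DERIV_ident)
  also have "(h1 (Y - \<epsilon>) - kL Y + ((g1 (Y + \<epsilon>) - h1 (Y - \<epsilon>)) / (4 * \<epsilon>) * (X - Y + 2 * \<epsilon>) +
       (0 - 1 + 0) * ((g (Y + \<epsilon>) - h (Y - \<epsilon>)) / (4 * \<epsilon>)))) =
      h1 (Y - \<epsilon>) - 2 * \<kappa> + (g1 (Y + \<epsilon>) - h1 (Y - \<epsilon>)) * \<mu>"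
    using eps unfolding k by (simp add: \<kappa>_def \<mu>_def field_simps)
  finally have "((\<lambda>Y. lower_GY X Y) has_real_derivative
      (h1 (Y - \<epsilon>) - 2 * \<kappa> + (g1 (Y + \<epsilon>) - h1 (Y - \<epsilon>)) * \<mu>)) (at Y)"
    by (rule has_field_derivative_transform_within_open[of _ _ _ "{..<t 1}"])
      (use Y assms kL_left in \<open>auto simp: lower_GY_def\<close>)
  moreover have "h1 (Y - \<epsilon>) - 2 * \<kappa> + (g1 (Y + \<epsilon>) - h1 (Y - \<epsilon>)) * \<mu> \<le> 0"
  proof -
    have "(g (Y + \<epsilon>) - h (Y - \<epsilon>)) / (2 * \<epsilon>) = 2 * \<kappa>"
      using eps by (simp add: \<kappa>_def field_simps)
    then have "g1 (Y + \<epsilon>) \<le> 2 * \<kappa>" "h1 (Y - \<epsilon>) \<le> 2 * \<kappa>"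
      using left_ineq[of Y] Y assms by auto
    moreover have "0 \<le> \<mu>" "\<mu> \<le> 1" using Y assms eps by (auto simp: \<mu>_def)
    ultimately have "\<mu> * (g1 (Y + \<epsilon>) - 2 * \<kappa>) + (1 - \<mu>) * (h1 (Y - \<epsilon>) - 2 * \<kappa>) \<le> 0"
      by (intro add_nonpos_nonpos mult_nonneg_nonpos) auto
    then show ?thesis by (simp add: algebra_simps)
  qed
  ultimately show "\<exists>y. ((\<lambda>Y. lower_GY X Y) has_real_derivative y) (at Y) \<and> y \<le> 0" by blast
qed (use assms in auto)

lemma upper_GX_antimono:
  assumes "\<sigma> Y \<le> X1" "X1 \<le> X2" "X2 \<le> s 0 + \<delta>" "\<bar>X1 - Y\<bar> \<le> 2 * \<epsilon>" "\<bar>X2 - Y\<bar> \<le> 2 * \<epsilon>"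
  shows "upper_GX X2 Y \<le> upper_GX X1 Y"
proof -
  have left: "upper_GX x Y \<le> upper_GX X1 Y" if x: "X1 \<le> x" "x \<le> s 0" for x
  proof -
    have "s 1 \<le> X1" using \<sigma>_bounds[of Y] assms by simp
    have "t 1 \<le> Y" using assms by (intro upper_left[of _ X1]) auto
    then obtain q2 where q2: "q2 \<in> {0..1}" "X1 = s q2" "Y \<le> t q2"
      by (rule rib_cases[of Y X1]) (use assms x \<sigma>_t in auto)
    define q1 where "q1 = Qs x"
    have q1: "x = s q1" "q1 \<in> {0..1}" using Qs_eq x \<open>s 1 \<le> X1\<close> Qs_range by (auto simp: q1_def)
    have "q1 \<le> q2" using s_less[of q2 q1] q1 q2 x by (force simp: not_less[symmetric])
    then show ?thesis unfolding q1(1) q2(2) using q1 q2 by (intro upper_GX_spine) auto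
  qed
  consider "X2 \<le> s 0" | "s 0 \<le> X1" | "X1 \<le> s 0" "s 0 \<le> X2" by linarith
  then show ?thesis
  proof cases
    case 1 then show ?thesis using left[of X2] assms by simp
  next
    case 2 then show ?thesis using assms by (intro upper_GX_right) auto
  next
    case 3
    then have "upper_GX X2 Y \<le> upper_GX (s 0) Y" using assms by (intro upper_GX_right) auto
    also have "\<dots> \<le> upper_GX X1 Y" using left[of "s 0"] 3 by simp
    finally show ?thesis .
  qed
qed

lemma lower_GY_antimono:
  assumes "X \<le> \<sigma> Y1" "Y1 \<le> Y2" "t 1 - \<delta> \<le> Y1" "\<bar>X - Y1\<bar> \<le> 2 * \<epsilon>" "\<bar>X - Y2\<bar> \<le> 2 * \<epsilon>"
  shows "lower_GY X Y2 \<le> lower_GY X Y1"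
proof -
  have Y2: "Y2 \<le> t 0" using \<sigma>_bounds(2)[of Y1] assms st_ends by simp
  have right: "lower_GY X Y2 \<le> lower_GY X y" if y: "Y1 \<le> y" "y \<le> Y2" "t 1 \<le> y" for y
  proof -
    define q1 q2 where "q1 = Qt Y2" and "q2 = Qt y"
    have q: "Y2 = t q1" "y = t q2" "q1 \<in> {0..1}" "q2 \<in> {0..1}" "q1 \<le> q2"
      using y Y2 Qt_eq Qt_range Qt_antimono[of y Y2] by (auto simp: q1_def q2_def)
    have "X \<le> s q2" using assms(1) \<sigma>_mono[OF y(1)] q(2,4) \<sigma>_t[of q2] by simp
    then show ?thesis unfolding q(1,2) using q by (intro lower_GY_spine) auto
  qed
  consider "Y2 \<le> t 1" | "t 1 \<le> Y1" | "Y1 \<le> t 1" "t 1 \<le> Y2" by linarith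
  then show ?thesis
  proof cases
    case 1 then show ?thesis using assms by (intro lower_GY_left) auto
  next
    case 2 then show ?thesis using right[of Y1] assms by simp
  next
    case 3
    have "lower_GY X Y2 \<le> lower_GY X (t 1)" using right[of "t 1"] 3 by simp
    also have "\<dots> \<le> lower_GY X Y1" using 3 assms by (intro lower_GY_left) auto
    finally show ?thesis .
  qed
qed

text \<open>Left of the spine \<open>GX\<close> does not depend on \<open>X\<close>, and it is
  continuous across the spine, so only the part right of the spine contributes.\<close>

lemma GX_antimono:
  assumes "X1 \<le> X2" "X2 \<le> s 0 + \<delta>" "\<bar>X1 - Y\<bar> \<le> 2 * \<epsilon>" "\<bar>X2 - Y\<bar> \<le> 2 * \<epsilon>"
  shows "GX X2 Y \<le> GX X1 Y"
proof -
  consider "\<sigma> Y \<le> X1" | "X1 < \<sigma> Y" "X2 < \<sigma> Y" | "X1 < \<sigma> Y" "\<sigma> Y \<le> X2" by linarith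
  then show ?thesis
  proof cases
    case 1 then show ?thesis using upper_GX_antimono[of Y X1 X2] assms by (simp add: GX_def upper_GX_def)
  next
    case 2 then show ?thesis by (simp add: GX_def)
  next
    case 3
    have "GX X2 Y \<le> GX (\<sigma> Y) Y"
      using 3 upper_GX_antimono[of Y "\<sigma> Y" X2] assms by (simp add: GX_def upper_GX_def)
    also have "\<dots> = GX X1 Y" using 3 assms by (simp add: grad_lower(1))
    finally show ?thesis .
  qed
qed

lemma GY_antimono:
  assumes "Y1 \<le> Y2" "t 1 - \<delta> \<le> Y1" "\<bar>X - Y1\<bar> \<le> 2 * \<epsilon>" "\<bar>X - Y2\<bar> \<le> 2 * \<epsilon>"
  shows "GY X Y2 \<le> GY X Y1"
proof -
  have L: "GY X Y = lower_GY X Y" if "X \<le> \<sigma> Y" "\<bar>X - Y\<bar> \<le> 2 * \<epsilon>" for Y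
    using grad_lower(2)[OF that(2,1)] by (simp add: lower_GY_def)
  consider "X \<le> \<sigma> Y1" | "\<sigma> Y1 \<le> X" "\<sigma> Y2 \<le> X" | "\<sigma> Y1 \<le> X" "X \<le> \<sigma> Y2" by linarith
  then show ?thesis
  proof cases
    case 1
    then show ?thesis using lower_GY_antimono[OF 1] assms \<sigma>_mono[OF assms(1)] by (simp add: L)
  next
    case 2 then show ?thesis by (simp add: GY_def)
  next
    case 3
    \<comment> \<open>The point where the line of constant \<open>X\<close> meets the spine;
      \<open>\<sigma>\<close> is continuous but may be constant on intervals, so it is found by the
      intermediate value theorem rather than by inversion.\<close>
    obtain Y where Y: "Y1 \<le> Y" "Y \<le> Y2" "\<sigma> Y = X"
      using IVT'[of \<sigma> Y1 X Y2] 3 assms(1) continuous_on_subset[OF \<sigma>_cont] by blast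
    have "GY X Y2 \<le> GY X Y"
      using lower_GY_antimono[of X Y Y2] assms Y 3 by (simp add: L)
    also have "\<dots> = GY X Y1" using Y 3 by (simp add: GY_def)
    finally show ?thesis .
  qed
qed

lemma F_diagonally_concave: "diagonally_concave_on (Omega_NW \<epsilon> (t 1 - \<delta>) (s 0 + \<delta>)) F"
proof (rule diagonally_concave_on_gradient)
  let ?\<Omega> = "Omega_NW \<epsilon> (t 1 - \<delta>) (s 0 + \<delta>)"
  have sub: "?\<Omega> \<subseteq> strip \<epsilon>" by (auto simp: Omega_NW_def)
  show "(F has_derivative (\<lambda>v. GX (fst x + snd x) (fst x - snd x) * (fst v + snd v) +
    GY (fst x + snd x) (fst x - snd x) * (fst v - snd v))) (at x within ?\<Omega>)" if "x \<in> ?\<Omega>" for x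
    using that sub by (intro has_derivative_subset[OF F_der sub]) auto
  fix x y assume xy: "x \<in> ?\<Omega>" "y \<in> ?\<Omega>" "fst x \<le> fst y"
  show "GX (fst y + snd y) (fst y - snd y) \<le> GX (fst x + snd x) (fst x - snd x)"
    if e: "fst x - snd x = fst y - snd y"
    unfolding e[symmetric] using xy e
    by (intro GX_antimono) (auto simp: Omega_NW_def strip_def abs_le_iff)
  show "GY (fst y + snd y) (fst y - snd y) \<le> GY (fst x + snd x) (fst x - snd x)"
    if e: "fst x + snd x = fst y + snd y"
    unfolding e[symmetric] using xy e
    by (intro GY_antimono) (auto simp: Omega_NW_def strip_def abs_le_iff)
qed

end

section \<open>Ribs and ruled sets\<close>

lemma mem_rising_segment:
  fixes x :: plane
  assumes "v \<le> e"
  shows "x \<in> closed_segment (u, v) (u + v - e, e) \<longleftrightarrow> fst x + snd x = u + v \<and> v \<le> snd x \<and> snd x \<le> e"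
proof
  assume "x \<in> closed_segment (u, v) (u + v - e, e)"
  then obtain w where w: "0 \<le> w" "w \<le> 1" "x = (1 - w) *\<^sub>R (u, v) + w *\<^sub>R (u + v - e, e)"
    by (auto simp: in_segment)
  have "snd x = v + w * (e - v)" "fst x = u - w * (e - v)"
    using w(3) by (simp_all add: algebra_simps)
  moreover have "0 \<le> w * (e - v)" "w * (e - v) \<le> 1 * (e - v)"
    using w assms by (intro mult_nonneg_nonneg mult_right_mono; simp)+
  ultimately show "fst x + snd x = u + v \<and> v \<le> snd x \<and> snd x \<le> e" by auto
next
  assume *: "fst x + snd x = u + v \<and> v \<le> snd x \<and> snd x \<le> e"
  show "x \<in> closed_segment (u, v) (u + v - e, e)"
  proof (cases "v = e")
    case True
    then show ?thesis using * by (auto simp: prod_eq_iff)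
  next
    case False
    define w where "w = (snd x - v) / (e - v)"
    have w: "w * (e - v) = snd x - v" using False by (simp add: w_def)
    have "0 \<le> w" "w \<le> 1" using * assms False by (auto simp: w_def)
    moreover have "x = (1 - w) *\<^sub>R (u, v) + w *\<^sub>R (u + v - e, e)"
      using * w by (auto simp: prod_eq_iff algebra_simps)
    ultimately show ?thesis unfolding in_segment by blast
  qed
qed

lemma mem_falling_segment:
  fixes x :: plane
  assumes "- e \<le> v"
  shows "x \<in> closed_segment (u, v) (u - v - e, - e) \<longleftrightarrow> fst x - snd x = u - v \<and> - e \<le> snd x \<and> snd x \<le> v"
proof
  assume "x \<in> closed_segment (u, v) (u - v - e, - e)"
  then obtain w where w: "0 \<le> w" "w \<le> 1" "x = (1 - w) *\<^sub>R (u, v) + w *\<^sub>R (u - v - e, - e)"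
    by (auto simp: in_segment)
  have "snd x = v - w * (e + v)" "fst x = u - w * (e + v)"
    using w(3) by (simp_all add: algebra_simps)
  moreover have "0 \<le> w * (e + v)" "w * (e + v) \<le> 1 * (e + v)"
    using w assms by (intro mult_nonneg_nonneg mult_right_mono; simp)+
  ultimately show "fst x - snd x = u - v \<and> - e \<le> snd x \<and> snd x \<le> v" by auto
next
  assume *: "fst x - snd x = u - v \<and> - e \<le> snd x \<and> snd x \<le> v"
  show "x \<in> closed_segment (u, v) (u - v - e, - e)"
  proof (cases "v = - e")
    case True
    then show ?thesis using * by (auto simp: prod_eq_iff)
  next
    case False
    define w where "w = (v - snd x) / (e + v)"
    have w: "w * (e + v) = v - snd x" using False by (simp add: w_def)
    have "0 \<le> w" "w \<le> 1" using * assms False by (auto simp: w_def)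
    moreover have "x = (1 - w) *\<^sub>R (u, v) + w *\<^sub>R (u - v - e, - e)"
      using * w by (auto simp: prod_eq_iff algebra_simps)
    ultimately show ?thesis unfolding in_segment by blast
  qed
qed

lemma concave_on_eq:
  assumes "concave_on S f" "\<And>x. x \<in> S \<Longrightarrow> g x = f x"
  shows "concave_on S g"
  unfolding concave_on_iff
proof (intro conjI ballI allI impI)
  show S: "convex S" using assms(1) by (simp add: concave_on_iff)
  fix x y and u v :: real assume *: "x \<in> S" "y \<in> S" "0 \<le> u" "0 \<le> v" "u + v = 1"
  have "u *\<^sub>R x + v *\<^sub>R y \<in> S" using convexD[OF S] * by blast
  then show "u * g x + v * g y \<le> g (u *\<^sub>R x + v *\<^sub>R y)"
    using assms * by (simp add: concave_on_iff)
qed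

text \<open>The first alternative in the last clause of \<open>bellman_candidate\<close>. It is the
  one established here: through every point of the regions there is a linearity segment ending on
  the boundary.\<close>

definition ruled_at :: "real \<Rightarrow> plane set \<Rightarrow> (plane \<Rightarrow> real) \<Rightarrow> plane \<Rightarrow> bool" where
  "ruled_at \<epsilon> \<Omega> B y \<longleftrightarrow> (\<exists>p q. p \<in> strip_boundary \<epsilon> \<and> p \<noteq> q \<and> same_diagonal p q \<and>
     y \<in> closed_segment p q \<and> closed_segment p q \<subseteq> \<Omega> \<and> linear_on_segment B p q)"

lemma ruled_at_mono: "ruled_at \<epsilon> \<Omega> B y \<Longrightarrow> \<Omega> \<subseteq> \<Omega>' \<Longrightarrow> ruled_at \<epsilon> \<Omega>' B y"
  unfolding ruled_at_def by (meson order_trans)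

context fissure_foliation
begin

lemma BU_affine: "BU X ((1 - w) * Y + w * Y') = (1 - w) * BU X Y + w * BU X Y'"
  by (simp add: BU_def algebra_simps)

lemma BL_affine: "BL ((1 - w) * X + w * X') Y = (1 - w) * BL X Y + w * BL X' Y"
  by (simp add: BL_def algebra_simps)

lemma ruled_atI:
  assumes "p \<in> strip_boundary \<epsilon>" "p \<noteq> q" "y \<in> closed_segment p q" "closed_segment p q \<subseteq> \<Omega>"
    and "\<Omega> \<subseteq> strip \<epsilon>"
    and "fst p + snd p = fst q + snd q \<and> (\<forall>z\<in>closed_segment p q. \<sigma> (fst z - snd z) \<le> fst z + snd z) \<or>
      fst p - snd p = fst q - snd q \<and> (\<forall>z\<in>closed_segment p q. fst z + snd z \<le> \<sigma> (fst z - snd z))"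
  shows "ruled_at \<epsilon> \<Omega> F y"
proof -
  have "linear_on_segment F p q"
    unfolding linear_on_segment_def
  proof
    fix w :: real assume w: "w \<in> {0..1}"
    define z where "z = (1 - w) *\<^sub>R p + w *\<^sub>R q"
    have z: "z \<in> closed_segment p q" using w by (auto simp: z_def in_segment)
    have X: "fst z + snd z = (1 - w) * (fst p + snd p) + w * (fst q + snd q)"
      and Y: "fst z - snd z = (1 - w) * (fst p - snd p) + w * (fst q - snd q)"
      by (simp_all add: z_def algebra_simps)
    show "F ((1 - w) *\<^sub>R p + w *\<^sub>R q) = (1 - w) * F p + w * F q"
      using assms(6)
    proof (elim disjE conjE)
      assume e: "fst p + snd p = fst q + snd q"
        and "\<forall>z\<in>closed_segment p q. \<sigma> (fst z - snd z) \<le> fst z + snd z"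
      then have F: "F x = BU (fst x + snd x) (fst x - snd x)" if "x \<in> closed_segment p q" for x
        using that by (simp add: F_upper)
      have X': "fst z + snd z = fst q + snd q" using X e by (simp add: algebra_simps)
      show ?thesis
        using F[OF z] F[of p] F[of q] unfolding z_def[symmetric] X' Y e by (simp add: BU_affine)
    next
      assume e: "fst p - snd p = fst q - snd q"
        and "\<forall>z\<in>closed_segment p q. fst z + snd z \<le> \<sigma> (fst z - snd z)"
      then have F: "F x = BL (fst x + snd x) (fst x - snd x)" if "x \<in> closed_segment p q" for x
        using that assms(4,5) by (intro F_lower) auto
      have Y': "fst z - snd z = fst q - snd q" using Y e by (simp add: algebra_simps)
      show ?thesis
        using F[OF z] F[of p] F[of q] unfolding z_def[symmetric] X Y' e by (simp add: BL_affine)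
    qed
  qed
  then show ?thesis
    using assms unfolding ruled_at_def same_diagonal_def by blast
qed

lemma ruled_at_rising:
  assumes "- \<epsilon> \<le> v" "v < \<epsilon>" "fst y + snd y = u + v" "v \<le> snd y" "snd y \<le> \<epsilon>"
    and seg: "\<And>z. fst z + snd z = u + v \<Longrightarrow> v \<le> snd z \<Longrightarrow> snd z \<le> \<epsilon> \<Longrightarrow> z \<in> \<Omega> \<and> \<sigma> (fst z - snd z) \<le> u + v"
    and "\<Omega> \<subseteq> strip \<epsilon>"
  shows "ruled_at \<epsilon> \<Omega> F y"
proof (rule ruled_atI[where p = "(u + v - \<epsilon>, \<epsilon>)" and q = "(u, v)"])
  have cs: "z \<in> closed_segment (u + v - \<epsilon>, \<epsilon>) (u, v) \<longleftrightarrow> fst z + snd z = u + v \<and> v \<le> snd z \<and> snd z \<le> \<epsilon>" for z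
    using mem_rising_segment[of v \<epsilon> z u] assms(2) by (simp add: closed_segment_commute)
  show "y \<in> closed_segment (u + v - \<epsilon>, \<epsilon>) (u, v)" using cs assms by blast
  show "closed_segment (u + v - \<epsilon>, \<epsilon>) (u, v) \<subseteq> \<Omega>" using cs seg by blast
  show "fst (u + v - \<epsilon>, \<epsilon>) + snd (u + v - \<epsilon>, \<epsilon>) = fst (u, v) + snd (u, v) \<and>
      (\<forall>z\<in>closed_segment (u + v - \<epsilon>, \<epsilon>) (u, v). \<sigma> (fst z - snd z) \<le> fst z + snd z) \<or>
      fst (u + v - \<epsilon>, \<epsilon>) - snd (u + v - \<epsilon>, \<epsilon>) = fst (u, v) - snd (u, v) \<and>
      (\<forall>z\<in>closed_segment (u + v - \<epsilon>, \<epsilon>) (u, v). fst z + snd z \<le> \<sigma> (fst z - snd z))"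
    using cs seg by auto
qed (use assms in \<open>auto simp: strip_boundary_def\<close>)

lemma ruled_at_falling:
  assumes "- \<epsilon> < v" "v \<le> \<epsilon>" "fst y - snd y = u - v" "- \<epsilon> \<le> snd y" "snd y \<le> v"
    and seg: "\<And>z. fst z - snd z = u - v \<Longrightarrow> - \<epsilon> \<le> snd z \<Longrightarrow> snd z \<le> v \<Longrightarrow> z \<in> \<Omega> \<and> fst z + snd z \<le> \<sigma> (u - v)"
    and "\<Omega> \<subseteq> strip \<epsilon>"
  shows "ruled_at \<epsilon> \<Omega> F y"
proof (rule ruled_atI[where p = "(u - v - \<epsilon>, - \<epsilon>)" and q = "(u, v)"])
  have cs: "z \<in> closed_segment (u - v - \<epsilon>, - \<epsilon>) (u, v) \<longleftrightarrow> fst z - snd z = u - v \<and> - \<epsilon> \<le> snd z \<and> snd z \<le> v" for z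
    using mem_falling_segment[of \<epsilon> v z u] assms(1) by (simp add: closed_segment_commute)
  show "y \<in> closed_segment (u - v - \<epsilon>, - \<epsilon>) (u, v)" using cs assms by blast
  show "closed_segment (u - v - \<epsilon>, - \<epsilon>) (u, v) \<subseteq> \<Omega>" using cs seg by blast
  show "fst (u - v - \<epsilon>, - \<epsilon>) + snd (u - v - \<epsilon>, - \<epsilon>) = fst (u, v) + snd (u, v) \<and>
      (\<forall>z\<in>closed_segment (u - v - \<epsilon>, - \<epsilon>) (u, v). \<sigma> (fst z - snd z) \<le> fst z + snd z) \<or>
      fst (u - v - \<epsilon>, - \<epsilon>) - snd (u - v - \<epsilon>, - \<epsilon>) = fst (u, v) - snd (u, v) \<and>
      (\<forall>z\<in>closed_segment (u - v - \<epsilon>, - \<epsilon>) (u, v). fst z + snd z \<le> \<sigma> (fst z - snd z))"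
    using cs seg by auto
qed (use assms in \<open>auto simp: strip_boundary_def\<close>)

lemma mem_NW: "x \<in> Omega_NW \<epsilon> v u \<longleftrightarrow> - \<epsilon> \<le> snd x \<and> snd x \<le> \<epsilon> \<and> v \<le> fst x - snd x \<and> fst x + snd x \<le> u"
  by (auto simp: Omega_NW_def strip_def)

lemma height_bounds: "q \<in> {0..1} \<Longrightarrow> - \<epsilon> \<le> \<epsilon> * (2 * q - 1) \<and> \<epsilon> * (2 * q - 1) \<le> \<epsilon>"
  using eps mult_left_mono[of "-1" "2 * q - 1" \<epsilon>] mult_left_mono[of "2 * q - 1" 1 \<epsilon>] by auto

lemma spine_param_sum: "spine_param q + \<epsilon> * (2 * q - 1) = s q"
  by (simp add: spine_param_def s_eq algebra_simps)

lemma spine_param_diff: "spine_param q - \<epsilon> * (2 * q - 1) = t q"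
  by (simp add: spine_param_def algebra_simps)

lemma st_height: "s q - t q = 2 * (\<epsilon> * (2 * q - 1))"
  by (simp add: s_eq)

lemma st_bounds: "q \<in> {0..1} \<Longrightarrow> t 1 \<le> t q \<and> t q \<le> t 0 \<and> s 1 \<le> s q \<and> s q \<le> s 0"
  using t_le[of q 1] t_le[of 0 q] s_le[of q 1] s_le[of 0 q] by auto

text \<open>The ribs themselves are the linearity segments. An upper rib degenerates only at
  \<open>q = 1\<close>, where its point is also the top end of a full-length lower rib; at
  \<open>q = 0\<close> a point of the strict lower case would lie below the strip.\<close>

lemma NW_ruled:
  assumes "y \<in> Omega_NW \<epsilon> (t 1) (s 0)"
  shows "ruled_at \<epsilon> (Omega_NW \<epsilon> (t 1) (s 0)) F y"
proof -
  have sub: "Omega_NW \<epsilon> (t 1) (s 0) \<subseteq> strip \<epsilon>" by (auto simp: Omega_NW_def)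
  have y: "- \<epsilon> \<le> snd y" "snd y \<le> \<epsilon>" "t 1 \<le> fst y - snd y" "fst y + snd y \<le> s 0"
    using assms by (auto simp: mem_NW)
  have upper: ?thesis if q: "q \<in> {0..1}" "q < 1" "fst y + snd y = s q" "fst y - snd y \<le> t q" for q
  proof (rule ruled_at_rising[where u = "spine_param q" and v = "\<epsilon> * (2 * q - 1)"])
    fix z :: plane
    assume z: "fst z + snd z = spine_param q + \<epsilon> * (2 * q - 1)" "\<epsilon> * (2 * q - 1) \<le> snd z" "snd z \<le> \<epsilon>"
    have X: "fst z + snd z = s q" using z(1) spine_param_sum by simp
    have "fst z - snd z \<le> t q" using X z(2) st_height[of q] by simp
    moreover have "t 1 \<le> fst z - snd z" using st_bounds[OF q(1)] X z(3) st_ends by simp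
    ultimately show "z \<in> Omega_NW \<epsilon> (t 1) (s 0) \<and> \<sigma> (fst z - snd z) \<le> spine_param q + \<epsilon> * (2 * q - 1)"
      using X z st_bounds[OF q(1)] height_bounds[OF q(1)] \<sigma>_le_upper[OF q(1)]
      by (auto simp: mem_NW spine_param_sum)
  next
    have "\<epsilon> * (2 * q - 1) < \<epsilon> * 1" using q(2) eps by (intro mult_strict_left_mono) auto
    then show "\<epsilon> * (2 * q - 1) < \<epsilon>" by simp
    show "\<epsilon> * (2 * q - 1) \<le> snd y" using q(3,4) st_height[of q] by simp
  qed (use q y height_bounds[OF q(1)] spine_param_sum sub in auto)
  have lower: ?thesis if q: "q \<in> {0..1}" "0 < q" "fst y - snd y = t q" "fst y + snd y \<le> s q" for q
  proof (rule ruled_at_falling[where u = "spine_param q" and v = "\<epsilon> * (2 * q - 1)"])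
    fix z :: plane
    assume z: "fst z - snd z = spine_param q - \<epsilon> * (2 * q - 1)" "- \<epsilon> \<le> snd z" "snd z \<le> \<epsilon> * (2 * q - 1)"
    have Y: "fst z - snd z = t q" using z(1) spine_param_diff by simp
    have "fst z + snd z \<le> s q" using Y z(3) st_height[of q] by simp
    then show "z \<in> Omega_NW \<epsilon> (t 1) (s 0) \<and> fst z + snd z \<le> \<sigma> (spine_param q - \<epsilon> * (2 * q - 1))"
      using Y z st_bounds[OF q(1)] height_bounds[OF q(1)] \<sigma>_t[OF q(1)]
      by (auto simp: mem_NW spine_param_diff)
  next
    have "\<epsilon> * (-1) < \<epsilon> * (2 * q - 1)" using q(2) eps by (intro mult_strict_left_mono) auto
    then show "- \<epsilon> < \<epsilon> * (2 * q - 1)" by simp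
    show "snd y \<le> \<epsilon> * (2 * q - 1)" using q(3,4) st_height[of q] by simp
  qed (use q y height_bounds[OF q(1)] spine_param_diff sub in auto)
  from y(3,4) show ?thesis
  proof (rule rib_cases)
    show "\<bar>fst y + snd y - (fst y - snd y)\<bar> \<le> 2 * \<epsilon>" using y by simp
    show ?thesis if "q \<in> {0..1}" "fst y + snd y = s q" "fst y - snd y \<le> t q" for q
    proof (cases "q < 1")
      case False
      then have "q = 1" using that by simp
      then show ?thesis using lower[of 1] that y by simp
    qed (use upper that in blast)
    show ?thesis if "q \<in> {0..1}" "fst y - snd y = t q" "fst y + snd y < s q" for q
    proof (cases "0 < q")
      case False
      then have "q = 0" using that by simp
      then show ?thesis using that y st_ends by simp
    qed (use lower that in auto)
  qed
qed

lemma union_ruled: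
  assumes "y \<in> Omega_NW \<epsilon> (t 1 - \<delta>) (s 0 + \<delta>)"
  shows "ruled_at \<epsilon> (Omega_NW \<epsilon> (t 1 - \<delta>) (s 0 + \<delta>)) F y"
proof -
  have sub: "Omega_NW \<epsilon> (t 1 - \<delta>) (s 0 + \<delta>) \<subseteq> strip \<epsilon>" by (auto simp: Omega_NW_def)
  have s10: "s 1 \<le> s 0" using s_le[of 0 1] by simp
  have y: "- \<epsilon> \<le> snd y" "snd y \<le> \<epsilon>" "t 1 - \<delta> \<le> fst y - snd y" "fst y + snd y \<le> s 0 + \<delta>"
    using assms by (auto simp: mem_NW)
  consider "s 0 \<le> fst y + snd y" | "fst y - snd y \<le> t 1" | "y \<in> Omega_NW \<epsilon> (t 1) (s 0)"
    using y by (cases "s 0 \<le> fst y + snd y"; cases "fst y - snd y \<le> t 1") (simp_all add: mem_NW)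
  then show ?thesis
  proof cases
    case 1
    show ?thesis
    proof (rule ruled_at_rising[where u = "fst y + snd y + \<epsilon>" and v = "-\<epsilon>"])
      fix z :: plane
      assume z: "fst z + snd z = fst y + snd y + \<epsilon> + - \<epsilon>" "-\<epsilon> \<le> snd z" "snd z \<le> \<epsilon>"
      then show "z \<in> Omega_NW \<epsilon> (t 1 - \<delta>) (s 0 + \<delta>) \<and> \<sigma> (fst z - snd z) \<le> fst y + snd y + \<epsilon> + - \<epsilon>"
        using y 1 \<sigma>_bounds[of "fst z - snd z"] s10 st_ends delta by (auto simp: mem_NW)
    qed (use y eps sub in auto)
  next
    case 2
    show ?thesis
    proof (rule ruled_at_falling[where u = "fst y - snd y + \<epsilon>" and v = "\<epsilon>"])
      fix z :: plane
      assume z: "fst z - snd z = fst y - snd y + \<epsilon> - \<epsilon>" "-\<epsilon> \<le> snd z" "snd z \<le> \<epsilon>"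
      then show "z \<in> Omega_NW \<epsilon> (t 1 - \<delta>) (s 0 + \<delta>) \<and> fst z + snd z \<le> \<sigma> (fst y - snd y + \<epsilon> - \<epsilon>)"
        using y 2 \<sigma>_bounds[of "fst y - snd y"] s10 st_ends delta by (auto simp: mem_NW)
    qed (use y eps sub in auto)
  next
    case 3
    then show ?thesis
      by (intro ruled_at_mono[OF NW_ruled]) (use delta in \<open>auto simp: mem_NW\<close>)
  qed
qed

lemma candidateI:
  assumes sub: "\<Omega> \<subseteq> Omega_NW \<epsilon> (t 1 - \<delta>) (s 0 + \<delta>)"
    and ruled: "\<And>y. y \<in> \<Omega> \<Longrightarrow> ruled_at \<epsilon> \<Omega> F y"
    and B: "\<And>x. x \<in> \<Omega> \<Longrightarrow> B x = F x"
  shows "bellman_candidate \<epsilon> fp fm \<Omega> B"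
proof -
  have strip: "\<Omega> \<subseteq> strip \<epsilon>" using sub by (auto simp: Omega_NW_def)
  have "diagonally_concave_on \<Omega> B"
    unfolding diagonally_concave_on_def
  proof (intro allI impI)
    fix p q assume *: "same_diagonal p q \<and> closed_segment p q \<subseteq> \<Omega>"
    then have "concave_on (closed_segment p q) F"
      using F_diagonally_concave sub unfolding diagonally_concave_on_def by blast
    then show "concave_on (closed_segment p q) B"
      by (rule concave_on_eq) (use * B in blast)
  qed
  moreover have "B (x, \<epsilon>) = fp x" if "(x, \<epsilon>) \<in> \<Omega>" for x
    using that B F_top strip by auto
  moreover have "B (x, - \<epsilon>) = fm x" if "(x, - \<epsilon>) \<in> \<Omega>" for x
    using that B F_bottom strip by auto
  moreover have "\<exists>p q. p \<in> strip_boundary \<epsilon> \<and> p \<noteq> q \<and> same_diagonal p q \<and>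
     y \<in> closed_segment p q \<and> closed_segment p q \<subseteq> \<Omega> \<and> linear_on_segment B p q" if y: "y \<in> \<Omega>" for y
  proof -
    obtain p q where pq: "p \<in> strip_boundary \<epsilon>" "p \<noteq> q" "same_diagonal p q"
     "y \<in> closed_segment p q" "closed_segment p q \<subseteq> \<Omega>" "linear_on_segment F p q"
      using ruled[OF y] unfolding ruled_at_def by blast
    have "B z = F z" if "z \<in> closed_segment p q" for z using that pq(5) B by blast
    moreover have "(1 - w) *\<^sub>R p + w *\<^sub>R q \<in> closed_segment p q" if "w \<in> {0..1}" for w
      using that by (auto simp: in_segment)
    ultimately have "linear_on_segment B p q"
      using pq(6) by (simp add: linear_on_segment_def)
    then show ?thesis using pq by blast
  qed
  ultimately show ?thesis using strip unfolding bellman_candidate_def by (intro conjI allI impI ballI disjI1) simp_all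
qed

end

section \<open>The fissure and its candidate\<close>

context fissure_foliation
begin

section \<open>The spine as the graph of a function of the abscissa\<close>

definition T :: "real \<Rightarrow> real" where "T u = \<epsilon> * (2 * Qu u - 1)"

text \<open>The value of \<open>BU\<close> at the spine point, as
  \<open>2 * (\<epsilon> - T u)\<close> is the value of \<open>Y - X + 2 * \<epsilon>\<close> there.
  Expressed through \<open>m\<close> it has no pole at \<open>T = 0\<close>, so it is at once the
  continuous extension that \<open>spine_value\<close> demands.\<close>

definition A :: "real \<Rightarrow> real" where
  "A u = fp (u + T u - \<epsilon>) + 2 * (\<epsilon> - T u) * m (u + T u)"

lemma T_spine: "q \<in> {0..1} \<Longrightarrow> T (spine_param q) = \<epsilon> * (2 * q - 1)"
  by (simp add: T_def Qu_u)

lemma spine_param_ends: "spine_param 1 = t 1 + \<epsilon>" "spine_param 0 = s 0 + \<epsilon>"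
  by (simp_all add: spine_param_def st_ends)

lemma spine_param_le: "q \<in> {0..1} \<Longrightarrow> t 1 + \<epsilon> \<le> spine_param q \<and> spine_param q \<le> s 0 + \<epsilon>"
  using spine_param_less[of 0 q] spine_param_less[of q 1]
  by (cases "q = 0"; cases "q = 1") (auto simp: spine_param_ends intro: less_imp_le)

lemma spine_param_Qu: "u \<in> {t 1 + \<epsilon>..s 0 + \<epsilon>} \<Longrightarrow> spine_param (Qu u) = u"
  by (simp add: u_Qu spine_param_ends)

lemma spine_param_image: "spine_param ` {0..1} = {t 1 + \<epsilon>..s 0 + \<epsilon>}"
proof
  show "spine_param ` {0..1} \<subseteq> {t 1 + \<epsilon>..s 0 + \<epsilon>}" using spine_param_le by auto
  show "{t 1 + \<epsilon>..s 0 + \<epsilon>} \<subseteq> spine_param ` {0..1}"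
  proof
    fix u assume "u \<in> {t 1 + \<epsilon>..s 0 + \<epsilon>}"
    then show "u \<in> spine_param ` {0..1}"
      using spine_param_Qu Qu_range[of u] by (intro image_eqI[of _ _ "Qu u"]) simp_all
  qed
qed

lemma spine_interval_nonempty: "t 1 + \<epsilon> < s 0 + \<epsilon>"
  using spine_param_less[of 0 1] by (simp add: spine_param_ends)

text \<open>The quotient of \<open>2 * \<epsilon>\<close>, the speed of the height in
  \<open>q\<close>, by the speed of \<open>spine_param\<close>. Thus
  \<open>\<bar>T'\<bar> \<le> 1\<close> amounts to \<open>t' \<le> - 4 * \<epsilon>\<close>, with
  equality only at \<open>q = 1\<close>.\<close>

definition T' :: "real \<Rightarrow> real" where "T' u = 2 * \<epsilon> / (t' (Qu u) + 2 * \<epsilon>)"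

lemma t'_le: "q \<in> {0..1} \<Longrightarrow> t' q \<le> - 4 * \<epsilon>"
  using t'_less[of q] t'_1 by (cases "q = 1") auto

lemma T_der:
  assumes "u \<in> {t 1 + \<epsilon>..s 0 + \<epsilon>}"
  shows "(T has_real_derivative T' u) (at u within {t 1 + \<epsilon>..s 0 + \<epsilon>})"
proof -
  let ?q = "Qu u"
  have "t' ?q + 2 * \<epsilon> \<noteq> 0" using t'_le[OF Qu_range[of u]] eps by simp
  then have "(Qu has_real_derivative inverse (t' ?q + 2 * \<epsilon>))
      (at (spine_param ?q) within spine_param ` {0..1})"
    using Qu_range Qu_u continuous_on_subset[OF Qu_cont] spine_param_der
    by (intro real_derivative_inverse_within) (auto simp: continuous_on_eq_continuous_within)
  then have "(Qu has_real_derivative inverse (t' ?q + 2 * \<epsilon>)) (at u within {t 1 + \<epsilon>..s 0 + \<epsilon>})"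
    by (simp add: spine_param_Qu[OF assms] spine_param_image)
  then show ?thesis
    unfolding T_def by (auto intro!: derivative_eq_intros simp: T'_def field_simps)
qed

lemma T_range: "- \<epsilon> \<le> T u \<and> T u \<le> \<epsilon>"
  unfolding T_def by (rule height_bounds[OF Qu_range])

lemma fissure: "NW_fissure \<epsilon> T (t 1 + \<epsilon>) (s 0 + \<epsilon>)"
proof -
  let ?I = "{t 1 + \<epsilon>..s 0 + \<epsilon>}"
  have neg: "t' (Qu u) + 2 * \<epsilon> \<le> - 2 * \<epsilon>" for u using t'_le[OF Qu_range[of u]] by simp
  have "continuous_on ?I (\<lambda>u. t' (Qu u))"
    using Qu_range by (intro continuous_on_compose2[OF t'_cont] continuous_on_subset[OF Qu_cont]) auto
  moreover have nz: "t' (Qu u) + 2 * \<epsilon> \<noteq> 0" for u using neg[of u] eps by simp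
  ultimately have "continuous_on ?I T'"
    unfolding T'_def by (intro continuous_intros) auto
  moreover have abs: "\<bar>T' u\<bar> = 2 * \<epsilon> / \<bar>t' (Qu u) + 2 * \<epsilon>\<bar>" for u
    using eps by (simp add: T'_def abs_mult)
  have "\<bar>T' u\<bar> \<le> 1" for u
    unfolding abs using neg[of u] eps by (subst divide_le_eq_1) auto
  moreover have "finite {u \<in> ?I. \<bar>T' u\<bar> = 1}"
  proof (rule finite_subset)
    show "{u \<in> ?I. \<bar>T' u\<bar> = 1} \<subseteq> {spine_param 1}"
    proof
      fix u assume u: "u \<in> {u \<in> ?I. \<bar>T' u\<bar> = 1}"
      then have "2 * \<epsilon> = \<bar>t' (Qu u) + 2 * \<epsilon>\<bar>" using nz[of u] by (simp add: abs)
      then have "t' (Qu u) = - 4 * \<epsilon>" using neg[of u] eps by simp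
      then have "Qu u = 1" using t'_less[of "Qu u"] Qu_range[of u] by force
      then show "u \<in> {spine_param 1}" using u spine_param_Qu[of u] by auto
    qed
  qed simp
  ultimately have "left_herringbone_spine \<epsilon> T (t 1 + \<epsilon>) (s 0 + \<epsilon>)"
    unfolding left_herringbone_spine_def using T_der T_range spine_interval_nonempty by blast
  then show ?thesis
    unfolding NW_fissure_def using T_spine[of 1] T_spine[of 0] by (simp add: spine_param_ends)
qed

section \<open>Foliation of the fissure region by the ribs\<close>

definition on_rib :: "real \<Rightarrow> plane \<Rightarrow> bool" where
  "on_rib q x \<longleftrightarrow>
    fst x + snd x = s q \<and> fst x - snd x \<le> t q \<and> snd x \<le> \<epsilon> \<or>
    fst x - snd x = t q \<and> fst x + snd x \<le> s q \<and> - \<epsilon> \<le> snd x"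

lemma mem_ribs:
  assumes "q \<in> {0..1}"
  shows "x \<in> upper_rib \<epsilon> T (spine_param q) \<union> lower_rib \<epsilon> T (spine_param q) \<longleftrightarrow> on_rib q x"
proof -
  have b: "\<epsilon> * (2 * q - 1) \<le> \<epsilon>" "- \<epsilon> \<le> \<epsilon> * (2 * q - 1)" using height_bounds[OF assms] by auto
  have "x \<in> upper_rib \<epsilon> T (spine_param q) \<longleftrightarrow>
    fst x + snd x = s q \<and> \<epsilon> * (2 * q - 1) \<le> snd x \<and> snd x \<le> \<epsilon>"
    using mem_rising_segment[OF b(1), of x "spine_param q"]
    by (simp add: upper_rib_def T_spine[OF assms] spine_param_sum)
  moreover have "x \<in> lower_rib \<epsilon> T (spine_param q) \<longleftrightarrow>
    fst x - snd x = t q \<and> - \<epsilon> \<le> snd x \<and> snd x \<le> \<epsilon> * (2 * q - 1)"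
    using mem_falling_segment[OF b(2), of x "spine_param q"]
    by (simp add: lower_rib_def T_spine[OF assms] spine_param_diff)
  ultimately show ?thesis
    unfolding on_rib_def using st_height[of q] by auto
qed

text \<open>Ribs of the same kind are separated by strict monotonicity of \<open>s\<close> or
  \<open>t\<close>. If an upper rib of \<open>p\<close> meets a lower rib of \<open>q\<close>, then
  \<open>s p \<le> s q\<close> and \<open>t q \<le> t p\<close>, which order \<open>p\<close> and
  \<open>q\<close> in opposite ways.\<close>

lemma on_rib_unique:
  assumes "q1 \<in> {0..1}" "q2 \<in> {0..1}" "on_rib q1 x" "on_rib q2 x"
  shows "q1 = q2"
proof -
  have S: "p \<le> q" if "s q \<le> s p" "p \<in> {0..1}" "q \<in> {0..1}" for p q
    using s_less[of q p] that by (force simp: not_less[symmetric])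
  have T: "p \<le> q" if "t q \<le> t p" "p \<in> {0..1}" "q \<in> {0..1}" for p q
    using t_less[of q p] that by (force simp: not_less[symmetric])
  show ?thesis
    using assms(3,4) S[OF _ assms(1,2)] S[OF _ assms(2,1)] T[OF _ assms(1,2)] T[OF _ assms(2,1)]
    unfolding on_rib_def by force
qed

lemma on_rib_exists:
  assumes "x \<in> Omega_NW \<epsilon> (t 1) (s 0)"
  shows "\<exists>q\<in>{0..1}. on_rib q x"
proof -
  have x: "- \<epsilon> \<le> snd x" "snd x \<le> \<epsilon>" "t 1 \<le> fst x - snd x" "fst x + snd x \<le> s 0"
    using assms by (auto simp: mem_NW)
  have "\<bar>fst x + snd x - (fst x - snd x)\<bar> \<le> 2 * \<epsilon>" using x by simp
  with x(3,4) show ?thesis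
    by (rule rib_cases) (use x in \<open>auto simp: on_rib_def\<close>)
qed

lemma on_rib_NW:
  assumes "q \<in> {0..1}" "on_rib q x"
  shows "x \<in> Omega_NW \<epsilon> (t 1) (s 0)"
proof -
  have "\<epsilon> * (2 * q - 1) \<le> \<epsilon>" "- \<epsilon> \<le> \<epsilon> * (2 * q - 1)" using height_bounds[OF assms(1)] by auto
  then show ?thesis
    using assms(2) st_height[of q] st_bounds[OF assms(1)] st_ends
    unfolding on_rib_def mem_NW by (elim disjE conjE; intro conjI; linarith)
qed

lemma foliated: "foliated_by_ribs \<epsilon> T (t 1 + \<epsilon>) (s 0 + \<epsilon>) (Omega_NW \<epsilon> (t 1) (s 0))"
  unfolding foliated_by_ribs_def spine_param_image[symmetric]
proof (intro conjI ballI)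
  show "Omega_NW \<epsilon> (t 1) (s 0) =
      (\<Union>u\<in>spine_param ` {0..1}. upper_rib \<epsilon> T u \<union> lower_rib \<epsilon> T u)"
  proof (intro equalityI subsetI)
    fix x assume "x \<in> Omega_NW \<epsilon> (t 1) (s 0)"
    then obtain q where "q \<in> {0..1}" "on_rib q x" using on_rib_exists by blast
    then show "x \<in> (\<Union>u\<in>spine_param ` {0..1}. upper_rib \<epsilon> T u \<union> lower_rib \<epsilon> T u)"
      by (intro UN_I[of "spine_param q"]) (simp_all only: mem_ribs imageI)
  next
    fix x assume "x \<in> (\<Union>u\<in>spine_param ` {0..1}. upper_rib \<epsilon> T u \<union> lower_rib \<epsilon> T u)"
    then obtain q where q: "q \<in> {0..1}" "x \<in> upper_rib \<epsilon> T (spine_param q) \<union> lower_rib \<epsilon> T (spine_param q)"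
      by blast
    show "x \<in> Omega_NW \<epsilon> (t 1) (s 0)"
      using on_rib_NW[OF q(1)] q(2) unfolding mem_ribs[OF q(1)] .
  qed
  fix x assume "x \<in> Omega_NW \<epsilon> (t 1) (s 0)"
  then obtain q where q: "q \<in> {0..1}" "on_rib q x" using on_rib_exists by blast
  show "\<exists>!u. u \<in> spine_param ` {0..1} \<and> x \<in> upper_rib \<epsilon> T u \<union> lower_rib \<epsilon> T u"
  proof (rule ex1I[of _ "spine_param q"])
    show "u = spine_param q"
      if u: "u \<in> spine_param ` {0..1} \<and> x \<in> upper_rib \<epsilon> T u \<union> lower_rib \<epsilon> T u" for u
    proof -
      obtain p where p: "p \<in> {0..1}" "u = spine_param p" using u by auto
      then have "on_rib p x" using u mem_ribs[OF p(1)] by simp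
      then show ?thesis using on_rib_unique[OF p(1) q(1) _ q(2)] p by simp
    qed
    show "spine_param q \<in> spine_param ` {0..1} \<and> x \<in> upper_rib \<epsilon> T (spine_param q) \<union> lower_rib \<epsilon> T (spine_param q)"
      unfolding mem_ribs[OF q(1)] using q by simp
  qed
qed

lemma rib_param_eq:
  assumes "q \<in> {0..1}" "on_rib q x"
  shows "rib_param \<epsilon> T (t 1 + \<epsilon>) (s 0 + \<epsilon>) x = spine_param q"
  unfolding rib_param_def
proof (rule the1_equality)
  show "\<exists>!u. u \<in> {t 1 + \<epsilon>..s 0 + \<epsilon>} \<and> x \<in> upper_rib \<epsilon> T u \<union> lower_rib \<epsilon> T u"
    by (rule bspec[OF conjunct2[OF foliated[unfolded foliated_by_ribs_def]] on_rib_NW[OF assms]])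
  show "spine_param q \<in> {t 1 + \<epsilon>..s 0 + \<epsilon>} \<and>
      x \<in> upper_rib \<epsilon> T (spine_param q) \<union> lower_rib \<epsilon> T (spine_param q)"
    unfolding mem_ribs[OF assms(1)] using assms(2) spine_param_le[OF assms(1)] by simp
qed

section \<open>Agreement with the explicit formulas\<close>

lemma A_spine:
  assumes "q \<in> {0..1}"
  shows "A (spine_param q) = fp (s q - \<epsilon>) + 4 * \<epsilon> * (1 - q) * m (s q)"
    and "A (spine_param q) = fm (t q - \<epsilon>) + 4 * \<epsilon> * q * n (t q)"
proof -
  show "A (spine_param q) = fp (s q - \<epsilon>) + 4 * \<epsilon> * (1 - q) * m (s q)"
    unfolding A_def T_spine[OF assms] spine_param_sum by (simp add: algebra_simps)
  then show "A (spine_param q) = fm (t q - \<epsilon>) + 4 * \<epsilon> * q * n (t q)"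
    using spine_values[OF assms] by simp
qed

text \<open>The unknowns are eliminated by averaging with weights \<open>q\<close> and
  \<open>1 - q\<close>. Applied with opposite signs to the two lines of \<open>slopes_sum\<close>
  they cancel \<open>k\<close>; applied to the two expressions for \<open>A\<close> they leave only
  \<open>m + n\<close>. The division by \<open>2 * q - 1\<close> is where \<open>T = 0\<close> has
  to be excluded.\<close>

lemma spine_value: "spine_value \<epsilon> fp fm T (t 1 + \<epsilon>) (s 0 + \<epsilon>) (spine_param (1/2)) A"
  unfolding spine_value_def
proof (intro conjI ballI impI)
  have "continuous_on {t 1 + \<epsilon>..s 0 + \<epsilon>} T" using T_der by (rule DERIV_continuous_on)
  then show "continuous_on {t 1 + \<epsilon>..s 0 + \<epsilon>} A"
    unfolding A_def
    by (intro continuous_intros continuous_on_compose2[OF fp_cont[of UNIV]] continuous_on_compose2[OF m_cont[of UNIV]]) auto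
  fix u assume u: "u \<in> {t 1 + \<epsilon>..s 0 + \<epsilon>}" and ne: "u \<noteq> spine_param (1/2)"
  define q where "q = Qu u"
  have q: "q \<in> {0..1}" "u = spine_param q" using spine_param_Qu[OF u] Qu_range[of u] by (auto simp: q_def)
  have "q \<noteq> 1 / 2" using ne q(2) by blast
  then have q2: "2 * q - 1 \<noteq> 0" by simp
  have Tq: "T u = \<epsilon> * (2 * q - 1)" using T_spine q by simp
  then show "T u \<noteq> 0" using q2 eps by simp
  have gp: "deriv fp x = g x" and hm: "deriv fm x = h x" for x
    using fp_der fm_der by (auto intro: DERIV_imp_deriv)
  let ?M = "m (s q)" and ?N = "n (t q)"
  have S: "2 * (2 * q - 1) * (?M + ?N) = 2 * (q * g (s q - \<epsilon>) - (1 - q) * h (t q - \<epsilon>))"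
  proof -
    have "(2 * q - 1) * (?M + ?N) = q * (?M + ?N) - (1 - q) * (?M + ?N)"
      by (simp add: algebra_simps)
    also have "\<dots> = q * (g (s q - \<epsilon>) + 4 * \<epsilon> * (1 - q) * k q) - (1 - q) * (h (t q - \<epsilon>) + 4 * \<epsilon> * q * k q)"
      using slopes_sum[OF q(1)] by simp
    finally show ?thesis by (simp add: algebra_simps)
  qed
  have "2 * \<epsilon> * A u = 2 * \<epsilon> * q * (fp (s q - \<epsilon>) + 4 * \<epsilon> * (1 - q) * ?M) +
      2 * \<epsilon> * (1 - q) * (fm (t q - \<epsilon>) + 4 * \<epsilon> * q * ?N)"
  proof -
    have "2 * \<epsilon> * A u = 2 * \<epsilon> * q * A u + 2 * \<epsilon> * (1 - q) * A u"
      by (simp add: algebra_simps)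
    also have "2 * \<epsilon> * q * A u = 2 * \<epsilon> * q * (fp (s q - \<epsilon>) + 4 * \<epsilon> * (1 - q) * ?M)"
      unfolding q(2) A_spine(1)[OF q(1)] ..
    also have "2 * \<epsilon> * (1 - q) * A u = 2 * \<epsilon> * (1 - q) * (fm (t q - \<epsilon>) + 4 * \<epsilon> * q * ?N)"
      unfolding q(2) A_spine(2)[OF q(1)] ..
    finally show ?thesis .
  qed
  also have "\<dots> = 2 * \<epsilon> * q * fp (s q - \<epsilon>) + 2 * \<epsilon> * (1 - q) * fm (t q - \<epsilon>) +
      8 * \<epsilon>\<^sup>2 * q * (1 - q) * (?M + ?N)"
    by (simp add: algebra_simps power2_eq_square)
  also have "\<dots> = 2 * \<epsilon> * (q * fp (s q - \<epsilon>) + (1 - q) * fm (t q - \<epsilon>) + 4 * \<epsilon> * q * (1 - q) * (?M + ?N))"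
    by (simp add: algebra_simps power2_eq_square)
  finally have "A u = q * fp (s q - \<epsilon>) + (1 - q) * fm (t q - \<epsilon>) + 4 * \<epsilon> * q * (1 - q) * (?M + ?N)"
    using eps by (subst (asm) mult_left_cancel) auto
  also have "?M + ?N = (q * g (s q - \<epsilon>) - (1 - q) * h (t q - \<epsilon>)) / (2 * q - 1)"
    using S q2 by (simp add: field_simps)
  finally have main: "A u = q * fp (s q - \<epsilon>) + (1 - q) * fm (t q - \<epsilon>) +
      4 * \<epsilon> * q * (1 - q) * ((q * g (s q - \<epsilon>) - (1 - q) * h (t q - \<epsilon>)) / (2 * q - 1))" .
  have e1: "\<epsilon> + T u = 2 * \<epsilon> * q" "\<epsilon> - T u = 2 * \<epsilon> * (1 - q)"
    by (simp_all add: Tq algebra_simps)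
  have e2: "\<epsilon>\<^sup>2 - (T u)\<^sup>2 = (2 * \<epsilon> * q) * (2 * \<epsilon> * (1 - q))"
    unfolding e1[symmetric] by (simp add: power2_eq_square algebra_simps)
  have e3: "u + T u = s q" "u - T u = t q"
    using spine_param_sum[of q] spine_param_diff[of q] by (simp_all add: q(2) T_spine[OF q(1)])
  show "A u = (\<epsilon>\<^sup>2 - (T u)\<^sup>2) / (2 * \<epsilon> * T u)
                * ((\<epsilon> + T u) * deriv fp (u + T u - \<epsilon>) - (\<epsilon> - T u) * deriv fm (u - T u - \<epsilon>))
              + ((\<epsilon> + T u) * fp (u + T u - \<epsilon>) + (\<epsilon> - T u) * fm (u - T u - \<epsilon>)) / (2 * \<epsilon>)"
    unfolding main e2 e3 gp hm unfolding e1 unfolding Tq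
    using eps q2 by (simp add: divide_simps) (simp add: algebra_simps)
qed

lemma herringbone_eq:
  assumes "x \<in> Omega_NW \<epsilon> (t 1) (s 0)"
  shows "herringbone_fun \<epsilon> fp fm T A (t 1 + \<epsilon>) (s 0 + \<epsilon>) x = F x"
proof -
  have x: "- \<epsilon> \<le> snd x" "snd x \<le> \<epsilon>" "t 1 \<le> fst x - snd x" "fst x + snd x \<le> s 0"
    using assms by (auto simp: mem_NW)
  have strip: "x \<in> strip \<epsilon>" using x by (simp add: strip_def)
  have b: "\<bar>fst x + snd x - (fst x - snd x)\<bar> \<le> 2 * \<epsilon>" using x by simp
  from x(3,4) b show ?thesis
  proof (cases rule: rib_cases)
    case (upper q)
    have rib: "rib_param \<epsilon> T (t 1 + \<epsilon>) (s 0 + \<epsilon>) x = spine_param q"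
      using upper x by (intro rib_param_eq) (auto simp: on_rib_def)
    have T: "T (spine_param q) = \<epsilon> * (2 * q - 1)" using T_spine upper by simp
    have le: "\<epsilon> * (2 * q - 1) \<le> snd x" using upper st_height[of q] by simp
    have F: "F x = fp (s q - \<epsilon>) + m (s q) * (2 * (\<epsilon> - snd x))"
    proof -
      have "fst x - snd x - s q + 2 * \<epsilon> = 2 * (\<epsilon> - snd x)" using upper(2) by simp
      then show ?thesis using F_upper[OF upper(4)] by (simp only: upper(2) BU_def)
    qed
    \<comment> \<open>The first case contains the degenerate upper rib together with the top ends of
      all others. The second is the bottom corner \<open>q = 0\<close>, where the definition returns
      \<open>fm\<close>, although the upper rib there has full length.\<close>
    consider "snd x = \<epsilon>" | "snd x = - \<epsilon>" "\<epsilon> * (2 * q - 1) = - \<epsilon>" | "snd x < \<epsilon>" "\<epsilon> * (2 * q - 1) \<noteq> - \<epsilon> \<or> snd x \<noteq> - \<epsilon>"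
      using x by linarith
    then show ?thesis
    proof cases
      case 1
      have "F x = fp (s q - \<epsilon>)" using F 1 by simp
      moreover have "fst x = s q - \<epsilon>" using 1 upper(2) by simp
      moreover have "\<epsilon> * (2 * q - 1) \<noteq> \<epsilon> \<Longrightarrow> \<epsilon> - \<epsilon> * (2 * q - 1) \<noteq> 0" by simp
      ultimately show ?thesis
        using 1 eps le unfolding herringbone_fun_def rib Let_def T spine_param_sum by simp
    next
      case 2
      have "fst x - \<epsilon> = s q" "fst x = t q - \<epsilon>"
        using 2 upper(2) st_height[of q] by simp_all
      then have "F x = fm (fst x)" using F_bottom[of "fst x"] strip 2(1) by (metis prod.collapse)
      then show ?thesis
        using 2 eps unfolding herringbone_fun_def rib Let_def T by simp
    next
      case 3
      have "q \<noteq> 1" using 3 le by auto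
      then have ne: "\<epsilon> - \<epsilon> * (2 * q - 1) \<noteq> 0" using eps by simp
      have "herringbone_fun \<epsilon> fp fm T A (t 1 + \<epsilon>) (s 0 + \<epsilon>) x =
        (\<epsilon> - snd x) / (\<epsilon> - \<epsilon> * (2 * q - 1)) * A (spine_param q) +
        (snd x - \<epsilon> * (2 * q - 1)) / (\<epsilon> - \<epsilon> * (2 * q - 1)) * fp (s q - \<epsilon>)"
        using 3 le \<open>q \<noteq> 1\<close> eps unfolding herringbone_fun_def rib Let_def T spine_param_sum by auto
      also have "A (spine_param q) = fp (s q - \<epsilon>) + 2 * (\<epsilon> - \<epsilon> * (2 * q - 1)) * m (s q)"
        using A_spine(1)[OF upper(1)] by (simp add: algebra_simps)
      also have "(\<epsilon> - snd x) / (\<epsilon> - \<epsilon> * (2 * q - 1)) * (fp (s q - \<epsilon>) + 2 * (\<epsilon> - \<epsilon> * (2 * q - 1)) * m (s q)) +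
        (snd x - \<epsilon> * (2 * q - 1)) / (\<epsilon> - \<epsilon> * (2 * q - 1)) * fp (s q - \<epsilon>) = F x"
      proof -
        have "(e - y) / (e - v) * (p + 2 * (e - v) * c) + (y - v) / (e - v) * p = p + c * (2 * (e - y))"
          if "e - v \<noteq> 0" for e y v p c :: real
          using that by (simp add: divide_simps) (simp add: algebra_simps)
        from this[OF ne] show ?thesis unfolding F .
      qed
      finally show ?thesis .
    qed
  next
    case (lower q)
    have rib: "rib_param \<epsilon> T (t 1 + \<epsilon>) (s 0 + \<epsilon>) x = spine_param q"
      using lower x by (intro rib_param_eq) (auto simp: on_rib_def)
    have T: "T (spine_param q) = \<epsilon> * (2 * q - 1)" using T_spine lower by simp
    have less: "snd x < \<epsilon> * (2 * q - 1)" using lower st_height[of q] by simp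
    have F: "F x = fm (t q - \<epsilon>) + n (t q) * (2 * (\<epsilon> + snd x))"
    proof -
      have "fst x + snd x - t q + 2 * \<epsilon> = 2 * (\<epsilon> + snd x)" using lower(2) by simp
      moreover have "fst x + snd x \<le> \<sigma> (fst x - snd x)" using lower(2,3) \<sigma>_t[OF lower(1)] by simp
      ultimately show ?thesis using F_lower[OF strip] by (simp only: lower(2) BL_def)
    qed
    have ne: "\<epsilon> + \<epsilon> * (2 * q - 1) \<noteq> 0" using less x by simp
    have "herringbone_fun \<epsilon> fp fm T A (t 1 + \<epsilon>) (s 0 + \<epsilon>) x =
      (\<epsilon> + snd x) / (\<epsilon> + \<epsilon> * (2 * q - 1)) * A (spine_param q) +
      (\<epsilon> * (2 * q - 1) - snd x) / (\<epsilon> + \<epsilon> * (2 * q - 1)) * fm (t q - \<epsilon>)"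
      using less x unfolding herringbone_fun_def rib Let_def T spine_param_diff by auto
    also have "A (spine_param q) = fm (t q - \<epsilon>) + 2 * (\<epsilon> + \<epsilon> * (2 * q - 1)) * n (t q)"
      using A_spine(2)[OF lower(1)] by (simp add: algebra_simps)
    also have "(\<epsilon> + snd x) / (\<epsilon> + \<epsilon> * (2 * q - 1)) * (fm (t q - \<epsilon>) + 2 * (\<epsilon> + \<epsilon> * (2 * q - 1)) * n (t q)) +
      (\<epsilon> * (2 * q - 1) - snd x) / (\<epsilon> + \<epsilon> * (2 * q - 1)) * fm (t q - \<epsilon>) = F x"
    proof -
      have "(e + y) / (e + v) * (p + 2 * (e + v) * c) + (v - y) / (e + v) * p = p + c * (2 * (e + y))"
        if "e + v \<noteq> 0" for e y v p c :: real
        using that by (simp add: divide_simps) (simp add: algebra_simps)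
      from this[OF ne] show ?thesis unfolding F .
    qed
    finally show ?thesis .
  qed
qed

lemma F_left_tangent:
  assumes "x \<in> strip \<epsilon>" "s 0 \<le> fst x + snd x"
  shows "F x = left_tangent_fun \<epsilon> fp fm x"
proof -
  have "\<sigma> (fst x - snd x) \<le> fst x + snd x" using \<sigma>_bounds[of "fst x - snd x"] assms by simp
  note F = F_upper[OF this]
  have Y: "fst x - snd x - (fst x + snd x) + 2 * \<epsilon> = 2 * (\<epsilon> - snd x)" by simp
  have "P + (M - P) / (4 * \<epsilon>) * (2 * (\<epsilon> - y)) = (\<epsilon> + y) / (2 * \<epsilon>) * P + (\<epsilon> - y) / (2 * \<epsilon>) * M" for P M y
    using eps by (simp add: divide_simps) (simp add: algebra_simps)
  then show ?thesis
    unfolding F left_tangent_fun_def BU_def m_right[OF assms(2)] Y .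
qed

lemma F_right_tangent:
  assumes "x \<in> strip \<epsilon>" "fst x - snd x \<le> t 1"
  shows "F x = right_tangent_fun \<epsilon> fp fm x"
proof -
  have "fst x + snd x \<le> \<sigma> (fst x - snd x)"
    using \<sigma>_bounds[of "fst x - snd x"] assms st_ends by (simp add: strip_def)
  note F = F_lower[OF assms(1) this]
  have X: "fst x + snd x - (fst x - snd x) + 2 * \<epsilon> = 2 * (\<epsilon> + snd x)" by simp
  have "M + (P - M) / (4 * \<epsilon>) * (2 * (\<epsilon> + y)) = (\<epsilon> + y) / (2 * \<epsilon>) * P + (\<epsilon> - y) / (2 * \<epsilon>) * M" for P M y
    using eps by (simp add: divide_simps) (simp add: algebra_simps)
  then show ?thesis
    unfolding F right_tangent_fun_def BL_def n_left[OF assms(2)] X .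
qed

text \<open>The union has again the shape \<open>Omega_NW\<close>, with both ends moved by
  \<open>\<delta>\<close>; this is why concavity and ruling are proved for that shape and then serve
  both candidates.\<close>

lemma Omega_union:
  "Omega_L \<epsilon> (s 0) (s 0 + \<delta>) \<union> Omega_NW \<epsilon> (t 1) (s 0) \<union> Omega_R \<epsilon> (t 1 - \<delta>) (t 1) =
    Omega_NW \<epsilon> (t 1 - \<delta>) (s 0 + \<delta>)"
proof -
  have s10: "s 1 \<le> s 0" using s_le[of 0 1] by simp
  show ?thesis
  proof (intro equalityI subsetI)
    show "x \<in> Omega_NW \<epsilon> (t 1 - \<delta>) (s 0 + \<delta>)"
      if "x \<in> Omega_L \<epsilon> (s 0) (s 0 + \<delta>) \<union> Omega_NW \<epsilon> (t 1) (s 0) \<union> Omega_R \<epsilon> (t 1 - \<delta>) (t 1)" for x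
      using that s10 st_ends delta
      unfolding Omega_L_def Omega_R_def Omega_NW_def strip_def by auto
    show "x \<in> Omega_L \<epsilon> (s 0) (s 0 + \<delta>) \<union> Omega_NW \<epsilon> (t 1) (s 0) \<union> Omega_R \<epsilon> (t 1 - \<delta>) (t 1)"
      if "x \<in> Omega_NW \<epsilon> (t 1 - \<delta>) (s 0 + \<delta>)" for x
      using that unfolding Omega_L_def Omega_R_def Omega_NW_def by auto
  qed
qed

lemma C1_on_subset: "C1_on S f \<Longrightarrow> S' \<subseteq> S \<Longrightarrow> C1_on S' f"
  unfolding C1_on_def
proof (elim exE conjE)
  fix G
  assume S: "S' \<subseteq> S" and G: "\<forall>x\<in>S. (f has_derivative (\<lambda>h. G x \<bullet> h)) (at x within S)" "continuous_on S G"
  have "(f has_derivative (\<lambda>h. G x \<bullet> h)) (at x within S')" if "x \<in> S'" for x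
    using G(1) that S by (intro has_derivative_subset[OF _ S]) auto
  then show "\<exists>G. (\<forall>x\<in>S'. (f has_derivative (\<lambda>h. G x \<bullet> h)) (at x within S')) \<and> continuous_on S' G"
    using continuous_on_subset[OF G(2) S] by blast
qed

lemma fissure_conclusion:
  "NW_fissure \<epsilon> T (t 1 + \<epsilon>) (s 0 + \<epsilon>)"
  "foliated_by_ribs \<epsilon> T (t 1 + \<epsilon>) (s 0 + \<epsilon>) (Omega_NW \<epsilon> (t 1) (s 0))"
  "spine_value \<epsilon> fp fm T (t 1 + \<epsilon>) (s 0 + \<epsilon>) (t (1/2)) A"
  "T (t (1/2)) = 0"
  "bellman_candidate \<epsilon> fp fm (Omega_NW \<epsilon> (t 1) (s 0)) (herringbone_fun \<epsilon> fp fm T A (t 1 + \<epsilon>) (s 0 + \<epsilon>))"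
  "\<forall>x\<in>Omega_L \<epsilon> (s 0) (s 0 + \<delta>). F x = left_tangent_fun \<epsilon> fp fm x"
  "\<forall>x\<in>Omega_R \<epsilon> (t 1 - \<delta>) (t 1). F x = right_tangent_fun \<epsilon> fp fm x"
  "\<forall>x\<in>Omega_NW \<epsilon> (t 1) (s 0). F x = herringbone_fun \<epsilon> fp fm T A (t 1 + \<epsilon>) (s 0 + \<epsilon>) x"
  "C1_on (Omega_L \<epsilon> (s 0) (s 0 + \<delta>) \<union> Omega_NW \<epsilon> (t 1) (s 0) \<union> Omega_R \<epsilon> (t 1 - \<delta>) (t 1)) F"
  "bellman_candidate \<epsilon> fp fm
    (Omega_L \<epsilon> (s 0) (s 0 + \<delta>) \<union> Omega_NW \<epsilon> (t 1) (s 0) \<union> Omega_R \<epsilon> (t 1 - \<delta>) (t 1)) F"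
proof -
  have mid: "spine_param (1/2) = t (1/2)" by (simp add: spine_param_def)
  have sub: "Omega_NW \<epsilon> (t 1) (s 0) \<subseteq> Omega_NW \<epsilon> (t 1 - \<delta>) (s 0 + \<delta>)"
    using delta by (auto simp: mem_NW)
  show "NW_fissure \<epsilon> T (t 1 + \<epsilon>) (s 0 + \<epsilon>)" by (rule fissure)
  show "foliated_by_ribs \<epsilon> T (t 1 + \<epsilon>) (s 0 + \<epsilon>) (Omega_NW \<epsilon> (t 1) (s 0))" by (rule foliated)
  show "spine_value \<epsilon> fp fm T (t 1 + \<epsilon>) (s 0 + \<epsilon>) (t (1/2)) A"
    using spine_value by (simp only: mid)
  show "T (t (1/2)) = 0" using T_spine[of "1/2"] by (simp add: mid)
  show "bellman_candidate \<epsilon> fp fm (Omega_NW \<epsilon> (t 1) (s 0)) (herringbone_fun \<epsilon> fp fm T A (t 1 + \<epsilon>) (s 0 + \<epsilon>))"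
    by (rule candidateI[OF sub NW_ruled herringbone_eq])
  show "\<forall>x\<in>Omega_L \<epsilon> (s 0) (s 0 + \<delta>). F x = left_tangent_fun \<epsilon> fp fm x"
    by (auto simp: Omega_L_def intro: F_left_tangent)
  show "\<forall>x\<in>Omega_R \<epsilon> (t 1 - \<delta>) (t 1). F x = right_tangent_fun \<epsilon> fp fm x"
    by (auto simp: Omega_R_def intro: F_right_tangent)
  show "\<forall>x\<in>Omega_NW \<epsilon> (t 1) (s 0). F x = herringbone_fun \<epsilon> fp fm T A (t 1 + \<epsilon>) (s 0 + \<epsilon>) x"
    using herringbone_eq by simp
  show "C1_on (Omega_L \<epsilon> (s 0) (s 0 + \<delta>) \<union> Omega_NW \<epsilon> (t 1) (s 0) \<union> Omega_R \<epsilon> (t 1 - \<delta>) (t 1)) F"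
    unfolding Omega_union by (rule C1_on_subset[OF F_C1]) (auto simp: Omega_NW_def)
  show "bellman_candidate \<epsilon> fp fm
    (Omega_L \<epsilon> (s 0) (s 0 + \<delta>) \<union> Omega_NW \<epsilon> (t 1) (s 0) \<union> Omega_R \<epsilon> (t 1 - \<delta>) (t 1)) F"
    unfolding Omega_union by (rule candidateI[OF order_refl union_ruled refl])
qed

end

section \<open>An integral fixed point\<close>

lemma unit_integral_bound:
  fixes f :: "real \<Rightarrow> real"
  assumes "continuous_on {0..1} f" "\<And>x. x \<in> {0..1} \<Longrightarrow> \<bar>f x\<bar> \<le> B"
  shows "\<bar>integral {0..1} f\<bar> \<le> B"
  using integral_bound[of 0 1 f B] assms by simp

text \<open>Proved by composing the antiderivative with the stretching instead of substituting, so
  that \<open>q = 0\<close> needs no separate treatment.\<close>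

lemma integral_stretch_unit:
  fixes f :: "real \<Rightarrow> real"
  assumes "continuous_on {0..1} f" "q \<in> {0..1}"
  shows "integral {0..1} (\<lambda>\<tau>. q * f (q * \<tau>)) = integral {0..q} f"
proof -
  define J where "J x = integral {0..x} f" for x
  have der: "(J has_real_derivative f x) (at x within {0..1})" if "x \<in> {0..1}" for x
    unfolding J_def has_real_derivative_iff_has_vector_derivative
    by (rule integral_has_vector_derivative[OF assms(1) that])
  have "((\<lambda>\<tau>. q * f (q * \<tau>)) has_integral J (q * 1) - J (q * 0)) {0..1}"
  proof (rule fundamental_theorem_of_calculus)
    fix \<tau> :: real assume \<tau>: "\<tau> \<in> {0..1}"
    have sub: "(\<lambda>\<tau>. q * \<tau>) ` {0..1} \<subseteq> {0..1}"
      using assms(2) by (auto simp: mult_le_one)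
    have "((J \<circ> (\<lambda>\<tau>. q * \<tau>)) has_real_derivative f (q * \<tau>) * q) (at \<tau> within {0..1})"
    proof (rule DERIV_image_chain)
      show "((*) q has_real_derivative q) (at \<tau> within {0..1})"
        by (auto intro!: derivative_eq_intros)
      show "(J has_real_derivative f (q * \<tau>)) (at (q * \<tau>) within (*) q ` {0..1})"
        by (rule DERIV_subset[OF der sub]) (use sub \<tau> in blast)
    qed
    then show "((\<lambda>\<tau>. J (q * \<tau>)) has_vector_derivative q * f (q * \<tau>)) (at \<tau> within {0..1})"
      by (simp add: has_real_derivative_iff_has_vector_derivative o_def mult.commute)
  qed simp
  from integral_unique[OF this] have "integral {0..1} (\<lambda>\<tau>. q * f (q * \<tau>)) = J q - J 0"
    by (simp only: mult_1_right mult_zero_right)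
  moreover have "J 0 = 0" by (simp add: J_def)
  ultimately show ?thesis by (simp only: J_def diff_zero)
qed

text \<open>Rescaling \<open>p = q * \<tau>\<close> moves the integrals over \<open>{0..q}\<close>
  to a fixed interval, and the weight \<open>q powr -3\<close> of the averaging becomes the kernel
  \<open>\<tau>\<^sup>2\<close>, regular at \<open>q = 0\<close>. Clamping the parameter by
  \<open>c\<close> places the problem in the complete space of bounded continuous functions on the
  line. Each component contributes 1/4 to the contraction factor 1/2.\<close>

lemma integral_fixpoint:
  fixes V W :: "real \<Rightarrow> real \<times> real \<Rightarrow> real"
  assumes contV: "continuous_on UNIV (\<lambda>(p, z). V p z)" and contW: "continuous_on UNIV (\<lambda>(p, z). W p z)"
    and bV: "\<And>p z. \<bar>V p z\<bar> \<le> C" and bW: "\<And>p z. \<bar>W p z\<bar> \<le> C"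
    and lV: "\<And>p z z'. \<bar>V p z - V p z'\<bar> \<le> dist z z' / 4"
    and lW: "\<And>p z z'. \<bar>W p z - W p z'\<bar> \<le> dist z z' / 4"
  obtains z where "continuous_on UNIV z"
    "\<And>q. q \<in> {0..1} \<Longrightarrow> fst (z q) = q * integral {0..1} (\<lambda>\<tau>. V (q * \<tau>) (z (q * \<tau>)))"
    "\<And>q. q \<in> {0..1} \<Longrightarrow> snd (z q) = integral {0..1} (\<lambda>\<tau>. \<tau>\<^sup>2 * W (q * \<tau>) (z (q * \<tau>)))"
proof -
  define c where "c p = max 0 (min 1 p)" for p :: real
  have c_cont: "continuous_on A (\<lambda>x. c (f x))" if "continuous_on A f" for A :: "'b::topological_space set" and f
    unfolding c_def by (intro continuous_intros that)
  have c01: "0 \<le> c p" "c p \<le> 1" for p by (auto simp: c_def)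
  define G1 where "G1 z p = c p * integral {0..1} (\<lambda>\<tau>. V (c p * \<tau>) (z (c p * \<tau>)))" for z p
  define G2 where "G2 z p = integral {0..1} (\<lambda>\<tau>. \<tau>\<^sup>2 * W (c p * \<tau>) (z (c p * \<tau>)))" for z p
  define G where "G z p = (G1 z p, G2 z p)" for z p
  have comp: "continuous_on A (\<lambda>x. V (f x) (z (f x)))" "continuous_on A (\<lambda>x. W (f x) (z (f x)))"
    if "continuous_on UNIV z" "continuous_on A f" for z f and A :: "'b::topological_space set"
  proof -
    have "continuous_on A (\<lambda>x. (f x, z (f x)))"
      by (intro continuous_intros that continuous_on_compose2[OF that(1) that(2)]) auto
    from continuous_on_compose2[OF contV this] continuous_on_compose2[OF contW this]
    show "continuous_on A (\<lambda>x. V (f x) (z (f x)))" "continuous_on A (\<lambda>x. W (f x) (z (f x)))" by auto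
  qed
  have intV: "continuous_on {0..1} (\<lambda>\<tau>. V (c p * \<tau>) (z (c p * \<tau>)))"
    and intW: "continuous_on {0..1} (\<lambda>\<tau>. \<tau>\<^sup>2 * W (c p * \<tau>) (z (c p * \<tau>)))"
    if "continuous_on UNIV z" for z p
    by (intro continuous_intros comp that)+
  have sq: "\<bar>\<tau>\<^sup>2 * y\<bar> \<le> B" if "\<tau> \<in> {0..1}" "\<bar>y\<bar> \<le> B" for \<tau> y B :: real
  proof -
    have "\<tau>\<^sup>2 * \<bar>y\<bar> \<le> 1 * \<bar>y\<bar>" using that by (intro mult_right_mono) (auto simp: power_le_one)
    then show ?thesis using that by (simp add: abs_mult)
  qed
  have G_cont: "continuous_on UNIV (G z)" if "continuous_on UNIV z" for z
  proof -
    have "continuous_on (UNIV \<times> cbox 0 1) (\<lambda>x::real \<times> real. c (fst x) * snd x)"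
      by (intro continuous_intros c_cont)
    note VW = comp[OF that this]
    have "continuous_on UNIV (\<lambda>p. integral (cbox 0 1) (\<lambda>\<tau>. V (c p * \<tau>) (z (c p * \<tau>))))"
      using VW by (intro integral_continuous_on_param) (auto simp: case_prod_unfold intro!: continuous_intros)
    moreover have "continuous_on UNIV (\<lambda>p. integral (cbox 0 1) (\<lambda>\<tau>. \<tau>\<^sup>2 * W (c p * \<tau>) (z (c p * \<tau>))))"
      using VW by (intro integral_continuous_on_param) (auto simp: case_prod_unfold intro!: continuous_intros)
    ultimately show ?thesis
      unfolding G_def G1_def G2_def by (intro continuous_intros c_cont) simp_all
  qed
  have G1_bound: "\<bar>G1 z p\<bar> \<le> C" if "continuous_on UNIV z" for z p
  proof -
    have "\<bar>integral {0..1} (\<lambda>\<tau>. V (c p * \<tau>) (z (c p * \<tau>)))\<bar> \<le> C"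
      by (rule unit_integral_bound[OF intV[OF that] bV])
    moreover have "0 \<le> C" using bV[of 0 0] by linarith
    ultimately have "\<bar>c p\<bar> * \<bar>integral {0..1} (\<lambda>\<tau>. V (c p * \<tau>) (z (c p * \<tau>)))\<bar> \<le> 1 * C"
      using c01 by (intro mult_mono) auto
    then show ?thesis by (simp add: G1_def abs_mult)
  qed
  have G2_bound: "\<bar>G2 z p\<bar> \<le> C" if "continuous_on UNIV z" for z p
    unfolding G2_def by (rule unit_integral_bound[OF intW[OF that]]) (intro sq bW)
  have G_bcont: "G z \<in> bcontfun" if "continuous_on UNIV z" for z
  proof -
    have "norm (G z p) \<le> C + C" for p
      using norm_Pair_le[of "G1 z p" "G2 z p"] G1_bound[OF that, of p] G2_bound[OF that, of p]
      by (simp add: G_def)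
    then show ?thesis using G_cont[OF that] by (auto simp: bcontfun_def bounded_iff)
  qed
  define \<Phi> :: "(real \<Rightarrow>\<^sub>C (real \<times> real)) \<Rightarrow> (real \<Rightarrow>\<^sub>C (real \<times> real))"
    where "\<Phi> z = Bcontfun (G (apply_bcontfun z))" for z
  have \<Phi>: "apply_bcontfun (\<Phi> z) = G (apply_bcontfun z)" for z
    unfolding \<Phi>_def by (rule Bcontfun_inverse) (intro G_bcont continuous_on_apply_bcontfun)
  have "dist (\<Phi> z) (\<Phi> z') \<le> (1/2) * dist z z'" for z z'
  proof (rule dist_bound)
    fix p
    have zc: "continuous_on UNIV (apply_bcontfun z)" "continuous_on UNIV (apply_bcontfun z')" by auto
    let ?I1 = "\<lambda>z. integral {0..1} (\<lambda>\<tau>. V (c p * \<tau>) (apply_bcontfun z (c p * \<tau>)))"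
    have le: "dist (apply_bcontfun z x) (apply_bcontfun z' x) / 4 \<le> dist z z' / 4" for x
      using dist_bounded[of z x z'] by simp
    have "?I1 z - ?I1 z' = integral {0..1} (\<lambda>\<tau>. V (c p * \<tau>) (apply_bcontfun z (c p * \<tau>)) - V (c p * \<tau>) (apply_bcontfun z' (c p * \<tau>)))"
      by (intro Henstock_Kurzweil_Integration.integral_diff[symmetric] integrable_continuous_real intV zc)
    also have "\<bar>\<dots>\<bar> \<le> dist z z' / 4"
      by (rule unit_integral_bound) (intro continuous_on_diff intV zc, rule order_trans[OF lV le])
    finally have "\<bar>c p\<bar> * \<bar>?I1 z - ?I1 z'\<bar> \<le> 1 * (dist z z' / 4)"
      using c01 by (intro mult_mono) auto
    then have 1: "\<bar>G1 z p - G1 z' p\<bar> \<le> dist z z' / 4"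
      by (simp add: G1_def abs_mult flip: right_diff_distrib)
    have "G2 z p - G2 z' p = integral {0..1} (\<lambda>\<tau>. \<tau>\<^sup>2 * W (c p * \<tau>) (apply_bcontfun z (c p * \<tau>)) - \<tau>\<^sup>2 * W (c p * \<tau>) (apply_bcontfun z' (c p * \<tau>)))"
      unfolding G2_def
      by (intro Henstock_Kurzweil_Integration.integral_diff[symmetric] integrable_continuous_real intW zc)
    also have "\<bar>\<dots>\<bar> \<le> dist z z' / 4"
    proof (rule unit_integral_bound)
      show "\<bar>\<tau>\<^sup>2 * W (c p * \<tau>) (apply_bcontfun z (c p * \<tau>)) - \<tau>\<^sup>2 * W (c p * \<tau>) (apply_bcontfun z' (c p * \<tau>))\<bar> \<le> dist z z' / 4"
        if "\<tau> \<in> {0..1}" for \<tau>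
        unfolding right_diff_distrib[symmetric] by (rule sq[OF that order_trans[OF lW le]])
    qed (intro continuous_on_diff intW zc)
    finally have 2: "\<bar>G2 z p - G2 z' p\<bar> \<le> dist z z' / 4" .
    have "dist (G z p) (G z' p) \<le> \<bar>G1 z p - G1 z' p\<bar> + \<bar>G2 z p - G2 z' p\<bar>"
      using norm_Pair_le[of "G1 z p - G1 z' p" "G2 z p - G2 z' p"] by (simp add: G_def dist_norm)
    then show "dist (apply_bcontfun (\<Phi> z) p) (apply_bcontfun (\<Phi> z') p) \<le> (1/2) * dist z z'"
      unfolding \<Phi> using 1 2 by linarith
  qed
  then have "\<exists>!z. \<Phi> z = z" by (intro banach_fix_type[of "1/2"]) auto
  then obtain z where z: "\<Phi> z = z" by blast
  have "apply_bcontfun z = G (apply_bcontfun z)" using \<Phi>[of z] z by simp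
  then have eq: "apply_bcontfun z q = (G1 z q, G2 z q)" for q by (simp add: G_def fun_eq_iff)
  show thesis
  proof (rule that[of "apply_bcontfun z"])
    fix q :: real assume "q \<in> {0..1}"
    then have "c q = q" by (simp add: c_def)
    then show "fst (apply_bcontfun z q) = q * integral {0..1} (\<lambda>\<tau>. V (q * \<tau>) (apply_bcontfun z (q * \<tau>)))"
      "snd (apply_bcontfun z q) = integral {0..1} (\<lambda>\<tau>. \<tau>\<^sup>2 * W (q * \<tau>) (apply_bcontfun z (q * \<tau>)))"
      unfolding eq[of q] G1_def G2_def by simp_all
  qed simp
qed

section \<open>The spine equation\<close>

text \<open>Here \<open>a = 4 \<epsilon>\<close> and \<open>xe = u\<^sub>- + \<epsilon>\<close>. The ribs from the spine point \<open>q\<close> end at the abscissas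
  \<open>Y \<xi>\<close> (top) and \<open>X q \<xi>\<close> (bottom), and the second unknown is \<open>\<rho> = (2 k - h1 (X q \<xi>)) / (a q)\<close>. In these
  unknowns the spine satisfies \<open>\<xi>' = V\<close> and \<open>(q\<^sup>3 \<rho>)' = q\<^sup>2 W\<close>; the bracket in \<open>small3\<close> times \<open>a\<close> is a
  Lipschitz constant of \<open>V\<close> and \<open>W\<close>.\<close>

locale spine_equation =
  fixes a xe u0 r M d c :: real and g1 h1 h2 :: "real \<Rightarrow> real"
  assumes pos: "0 < a" "0 < M" "0 < d" "0 < c"
    and xe: "u0 \<le> xe" "xe \<le> u0 + r" and ar: "2 * a \<le> r"
    and cont: "continuous_on UNIV g1" "continuous_on UNIV h1" "continuous_on UNIV h2"
    and g1_lip: "\<And>x y. x \<in> {u0-r..u0+r} \<Longrightarrow> y \<in> {u0-r..u0+r} \<Longrightarrow> \<bar>g1 x - g1 y\<bar> \<le> M * \<bar>x - y\<bar>"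
    and h1_lip: "\<And>x y. x \<in> {u0-r..u0+r} \<Longrightarrow> y \<in> {u0-r..u0+r} \<Longrightarrow> \<bar>h1 x - h1 y\<bar> \<le> M * \<bar>x - y\<bar>"
    and h2_lip: "\<And>x y. x \<in> {u0-r..u0+r} \<Longrightarrow> y \<in> {u0-r..u0+r} \<Longrightarrow> \<bar>h2 x - h2 y\<bar> \<le> M * \<bar>x - y\<bar>"
    and h2_bounds: "\<And>x. x \<in> {u0-r..u0+r} \<Longrightarrow> c \<le> h2 x \<and> h2 x \<le> M"
    and gap: "\<And>x y. x \<in> {u0-r..u0+r} \<Longrightarrow> y \<in> {u0-r..u0+r} \<Longrightarrow> d \<le> h1 x - g1 y"
    and small1: "2 * a * M \<le> d" and small2: "8 * a * M\<^sup>2 \<le> c * d"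
    and small3: "8 * a * (2 * M + 4 * M / d + (8 * M / d + 4 / d) * (1 + M)) \<le> 1"
begin

text \<open>\<open>\<xi>\<close> is the drop of \<open>s\<close> from its right end in units of
  \<open>a\<close>; hence \<open>s\<close> has derivative \<open>- a * V\<close> and
  \<open>t\<close> has derivative \<open>- a * (1 + V)\<close>.\<close>

definition X :: "real \<Rightarrow> real \<Rightarrow> real" where "X q \<xi> = xe - a * q - a * \<xi>"

definition Y :: "real \<Rightarrow> real" where "Y \<xi> = xe - a / 2 - a * \<xi>"

text \<open>By \<open>k'_t\<close> the derivative of \<open>k\<close> is
  \<open>- a * \<rho> * (1 + V)\<close>. Inserted into \<open>k'_s\<close> this gives an equation
  linear in \<open>V\<close>, whose coefficient, after
  \<open>2 * k = a * q * \<rho> + h1 (X q \<xi>)\<close>, is \<open>den\<close>. At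
  \<open>q = 1/2\<close>, where \<open>T = 0\<close>, it is just the gap between \<open>h1\<close>
  and \<open>g1\<close>.\<close>

definition den :: "real \<Rightarrow> real \<Rightarrow> real \<Rightarrow> real" where
  "den q \<xi> \<rho> = h1 (X q \<xi>) - g1 (Y \<xi>) - a * (1 - 2 * q) * \<rho>"

definition V :: "real \<Rightarrow> real \<Rightarrow> real \<Rightarrow> real" where
  "V q \<xi> \<rho> = a * (1 - q) * \<rho> / den q \<xi> \<rho>"

text \<open>Differentiating \<open>2 * k = a * q * \<rho> + h1 (X q \<xi>)\<close> shows that
  \<open>q * \<rho>\<close> has derivative \<open>(h2 - 2 * \<rho>) * (1 + V)\<close>. Passing to
  \<open>q ^ 3 * \<rho>\<close> adds \<open>2 * \<rho>\<close>, which removes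
  \<open>- 2 * \<rho>\<close> from the part without \<open>V\<close>; only a term of order
  \<open>a\<close> still contains \<open>\<rho>\<close>.\<close>

definition W :: "real \<Rightarrow> real \<Rightarrow> real \<Rightarrow> real" where
  "W q \<xi> \<rho> = h2 (X q \<xi>) + (h2 (X q \<xi>) - 2 * \<rho>) * V q \<xi> \<rho>"

lemma X_in: "q \<in> {0..1} \<Longrightarrow> \<xi> \<in> {0..1} \<Longrightarrow> X q \<xi> \<in> {u0-r..u0+r}"
proof -
  assume q: "q \<in> {0..1}" "\<xi> \<in> {0..1}"
  have "0 \<le> a * q" "0 \<le> a * \<xi>" "a * q \<le> a * 1" "a * \<xi> \<le> a * 1"
    using q pos by (intro mult_nonneg_nonneg mult_left_mono; simp)+
  then show ?thesis using xe ar pos unfolding X_def atLeastAtMost_iff by (intro conjI; linarith)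
qed

lemma Y_in: "\<xi> \<in> {0..1} \<Longrightarrow> Y \<xi> \<in> {u0-r..u0+r}"
proof -
  assume q: "\<xi> \<in> {0..1}"
  have "0 \<le> a * \<xi>" "a * \<xi> \<le> a * 1"
    using q pos by (intro mult_nonneg_nonneg mult_left_mono; simp)+
  then show ?thesis using xe ar pos unfolding Y_def atLeastAtMost_iff by (intro conjI; linarith)
qed

text \<open>The gap contributes \<open>d\<close>, and the term with \<open>\<rho>\<close> costs at
  most \<open>a * M\<close>, which is at most \<open>d / 2\<close> by \<open>small1\<close>.\<close>

lemma den_ge:
  assumes "q \<in> {0..1}" "\<xi> \<in> {0..1}" "\<rho> \<in> {0..M}"
  shows "d / 2 \<le> den q \<xi> \<rho>"
proof -
  have "(1 - 2 * q) * \<rho> \<le> 1 * \<rho>" using assms by (intro mult_right_mono) auto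
  then have "(1 - 2 * q) * \<rho> \<le> M" using assms by auto
  then have "a * ((1 - 2 * q) * \<rho>) \<le> a * M" using pos by (intro mult_left_mono) auto
  then show ?thesis
    using gap[OF X_in[OF assms(1,2)] Y_in[OF assms(2)]] small1 by (simp add: den_def mult.assoc)
qed

lemma V_bounds:
  assumes "q \<in> {0..1}" "\<xi> \<in> {0..1}" "\<rho> \<in> {0..M}"
  shows "0 \<le> V q \<xi> \<rho>" "V q \<xi> \<rho> \<le> 2 * a * M / d" "V q \<xi> \<rho> \<le> 1"
proof -
  have D: "0 < den q \<xi> \<rho>" using den_ge[OF assms] pos by simp
  have N: "0 \<le> a * (1 - q) * \<rho>" using assms pos by simp
  have "(1 - q) * \<rho> \<le> 1 * M" using assms by (intro mult_mono) auto
  then have "a * ((1 - q) * \<rho>) \<le> a * M" using pos by (intro mult_left_mono) auto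
  then have "a * (1 - q) * \<rho> \<le> a * M" by (simp add: mult.assoc)
  then have "V q \<xi> \<rho> \<le> a * M / (d / 2)"
    unfolding V_def using N den_ge[OF assms] pos by (intro frac_le) auto
  also have "\<dots> = 2 * a * M / d" by simp
  finally show *: "V q \<xi> \<rho> \<le> 2 * a * M / d" .
  also have "\<dots> \<le> 1" using small1 pos by simp
  finally show "V q \<xi> \<rho> \<le> 1" .
  show "0 \<le> V q \<xi> \<rho>" unfolding V_def using D N by simp
qed

text \<open>By \<open>small2\<close> the term with \<open>V\<close> takes away at most half of the
  lower bound \<open>c\<close> of \<open>h2\<close>. Positivity of \<open>W\<close> is what makes
  \<open>\<rho>\<close> positive later, and with it all sign conditions on the spine.\<close>

lemma W_bounds:
  assumes "q \<in> {0..1}" "\<xi> \<in> {0..1}" "\<rho> \<in> {0..M}"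
  shows "c / 2 \<le> W q \<xi> \<rho>" "W q \<xi> \<rho> \<le> 2 * M"
proof -
  note V = V_bounds[OF assms] and h = h2_bounds[OF X_in[OF assms(1,2)]]
  let ?e = "h2 (X q \<xi>) - 2 * \<rho>"
  have e: "- (2 * M) \<le> ?e" "?e \<le> M" using h assms pos by auto
  have "?e * V q \<xi> \<rho> \<le> M * 1"
  proof (cases "0 \<le> ?e")
    case True then show ?thesis using V e by (intro mult_mono) auto
  next
    case False
    then have "?e * V q \<xi> \<rho> \<le> 0" using V by (intro mult_nonpos_nonneg) auto
    then show ?thesis using pos by simp
  qed
  then show "W q \<xi> \<rho> \<le> 2 * M" using h by (simp add: W_def)
  have "(2 * M) * V q \<xi> \<rho> \<le> (2 * M) * (2 * a * M / d)"
    using V pos by (intro mult_left_mono) auto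
  also have "\<dots> = (8 * a * M\<^sup>2) / (2 * d)" by (simp add: power2_eq_square)
  also have "\<dots> \<le> (c * d) / (2 * d)" using small2 pos by (intro divide_right_mono) auto
  also have "\<dots> = c / 2" using pos by simp
  finally have 1: "(2 * M) * V q \<xi> \<rho> \<le> c / 2" .
  have "- (2 * M) * V q \<xi> \<rho> \<le> ?e * V q \<xi> \<rho>" using V e by (intro mult_right_mono) auto
  then show "c / 2 \<le> W q \<xi> \<rho>" using h 1 by (simp add: W_def)
qed

text \<open>\<open>2 * M\<close> comes from the variation of \<open>h2\<close>,
  \<open>4 * M / d\<close> from that of \<open>\<rho>\<close> in front of \<open>V\<close>, and
  \<open>8 * M / d * (1 + M)\<close> from that of \<open>V\<close> in \<open>W\<close>. The part
  \<open>4 / d * (1 + M)\<close> is the constant of \<open>V\<close> itself, added so that one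
  number serves both functions.\<close>

definition K :: real where "K = 2 * M + 4 * M / d + (8 * M / d + 4 / d) * (1 + M)"

lemma V_lip:
  assumes q: "q \<in> {0..1}" and z: "\<xi> \<in> {0..1}" "\<rho> \<in> {0..M}" and z': "\<xi>' \<in> {0..1}" "\<rho>' \<in> {0..M}"
  shows "\<bar>V q \<xi> \<rho> - V q \<xi>' \<rho>'\<bar> \<le> a * (4 / d) * (1 + M) * (\<bar>\<xi> - \<xi>'\<bar> + \<bar>\<rho> - \<rho>'\<bar>)"
proof -
  define D1 D2 where "D1 = \<bar>\<xi> - \<xi>'\<bar>" and "D2 = \<bar>\<rho> - \<rho>'\<bar>"
  have D: "0 \<le> D1" "0 \<le> D2" by (auto simp: D1_def D2_def)
  define N N' E E' where "N = a * (1 - q) * \<rho>" and "N' = a * (1 - q) * \<rho>'"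
    and "E = den q \<xi> \<rho>" and "E' = den q \<xi>' \<rho>'"
  have E: "d / 2 \<le> E" "d / 2 \<le> E'" "0 < E" "0 < E'"
    using den_ge[OF q z] den_ge[OF q z'] pos by (auto simp: E_def E'_def)
  have "\<bar>N - N'\<bar> = a * ((1 - q) * D2)"
  proof -
    have "N - N' = a * (1 - q) * (\<rho> - \<rho>')" by (simp add: N_def N'_def algebra_simps)
    then show ?thesis using q pos by (simp add: abs_mult D2_def)
  qed
  also have "\<dots> \<le> a * (1 * D2)" using q pos D by (intro mult_left_mono mult_right_mono) auto
  finally have N: "\<bar>N - N'\<bar> \<le> a * D2" by simp
  have "\<bar>h1 (X q \<xi>) - h1 (X q \<xi>')\<bar> \<le> M * \<bar>X q \<xi> - X q \<xi>'\<bar>"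
    using q z z' by (intro h1_lip X_in)
  also have "\<bar>X q \<xi> - X q \<xi>'\<bar> = a * D1"
  proof -
    have "X q \<xi> - X q \<xi>' = a * (\<xi>' - \<xi>)" by (simp add: X_def algebra_simps)
    then show ?thesis using pos by (simp add: abs_mult D1_def abs_minus_commute)
  qed
  finally have h: "\<bar>h1 (X q \<xi>) - h1 (X q \<xi>')\<bar> \<le> M * (a * D1)" .
  have "\<bar>g1 (Y \<xi>) - g1 (Y \<xi>')\<bar> \<le> M * \<bar>Y \<xi> - Y \<xi>'\<bar>"
    using q z z' by (intro g1_lip Y_in)
  also have "\<bar>Y \<xi> - Y \<xi>'\<bar> = a * D1"
  proof -
    have "Y \<xi> - Y \<xi>' = a * (\<xi>' - \<xi>)" by (simp add: Y_def algebra_simps)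
    then show ?thesis using pos by (simp add: abs_mult D1_def abs_minus_commute)
  qed
  finally have g: "\<bar>g1 (Y \<xi>) - g1 (Y \<xi>')\<bar> \<le> M * (a * D1)" .
  have "\<bar>a * (1 - 2 * q) * \<rho> - a * (1 - 2 * q) * \<rho>'\<bar> = a * (\<bar>1 - 2 * q\<bar> * D2)"
  proof -
    have "a * (1 - 2 * q) * \<rho> - a * (1 - 2 * q) * \<rho>' = a * ((1 - 2 * q) * (\<rho> - \<rho>'))" by (simp add: algebra_simps)
    then show ?thesis using pos by (simp add: abs_mult D2_def)
  qed
  also have "\<dots> \<le> a * (1 * D2)" using q pos D by (intro mult_left_mono mult_right_mono) auto
  finally have "\<bar>a * (1 - 2 * q) * \<rho> - a * (1 - 2 * q) * \<rho>'\<bar> \<le> a * D2" by simp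
  then have EE: "\<bar>E' - E\<bar> \<le> a * (2 * M * D1 + D2)"
    using h g by (simp add: E_def E'_def den_def algebra_simps)
  have V': "0 \<le> N' / E'" "N' / E' \<le> 1"
    using V_bounds[OF q z'] by (auto simp: V_def N'_def E'_def)
  \<comment> \<open>The quotient difference is arranged so that the second quotient appears as a
    factor: it is already known to lie between 0 and 1, and only one denominator remains to be
    estimated.\<close>
  have "V q \<xi> \<rho> - V q \<xi>' \<rho>' = (N - N') / E + N' / E' * (E' - E) / E"
    using E by (simp add: V_def N_def[symmetric] N'_def[symmetric] E_def[symmetric] E'_def[symmetric] divide_simps)
      (simp add: algebra_simps)
  also have "\<bar>\<dots>\<bar> \<le> \<bar>N - N'\<bar> / E + N' / E' * \<bar>E' - E\<bar> / E"
  proof (intro order_trans[OF abs_triangle_ineq] add_mono)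
    show "\<bar>N' / E' * (E' - E) / E\<bar> \<le> N' / E' * \<bar>E' - E\<bar> / E"
      unfolding abs_divide[of _ E] abs_mult abs_of_nonneg[OF V'(1)] using E by simp
  qed (use E in \<open>simp add: abs_divide\<close>)
  also have "\<dots> \<le> a * D2 / (d / 2) + 1 * (a * (2 * M * D1 + D2)) / (d / 2)"
    using N EE E V' D pos by (intro add_mono frac_le mult_mono) auto
  also have "\<dots> = a * (4 / d) * (D2 + M * D1)"
    using pos by (simp add: field_simps)
  also have "\<dots> \<le> a * (4 / d) * ((1 + M) * (D1 + D2))"
    using pos D by (intro mult_left_mono) (auto simp: algebra_simps)
  finally show ?thesis by (simp only: D1_def D2_def mult.assoc)
qed

lemma W_lip:
  assumes q: "q \<in> {0..1}" and z: "\<xi> \<in> {0..1}" "\<rho> \<in> {0..M}" and z': "\<xi>' \<in> {0..1}" "\<rho>' \<in> {0..M}"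
  shows "\<bar>W q \<xi> \<rho> - W q \<xi>' \<rho>'\<bar> \<le> a * K * (\<bar>\<xi> - \<xi>'\<bar> + \<bar>\<rho> - \<rho>'\<bar>)"
proof -
  define D1 D2 where "D1 = \<bar>\<xi> - \<xi>'\<bar>" and "D2 = \<bar>\<rho> - \<rho>'\<bar>"
  have D: "0 \<le> D1" "0 \<le> D2" by (auto simp: D1_def D2_def)
  define v v' H H' where "v = V q \<xi> \<rho>" and "v' = V q \<xi>' \<rho>'" and "H = h2 (X q \<xi>)" and "H' = h2 (X q \<xi>')"
  have "\<bar>H - H'\<bar> \<le> M * \<bar>X q \<xi> - X q \<xi>'\<bar>"
    unfolding H_def H'_def using q z z' by (intro h2_lip X_in)
  also have "\<bar>X q \<xi> - X q \<xi>'\<bar> = a * D1"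
  proof -
    have "X q \<xi> - X q \<xi>' = a * (\<xi>' - \<xi>)" by (simp add: X_def algebra_simps)
    then show ?thesis using pos by (simp add: abs_mult D1_def abs_minus_commute)
  qed
  finally have H: "\<bar>H - H'\<bar> \<le> M * (a * D1)" .
  have v: "0 \<le> v" "v \<le> 1" "v \<le> 2 * a * M / d"
    using V_bounds[OF q z] by (auto simp: v_def)
  have vv: "\<bar>v - v'\<bar> \<le> a * (4 / d) * (1 + M) * (D1 + D2)"
    unfolding v_def v'_def D1_def D2_def by (rule V_lip[OF assms])
  have e': "\<bar>H' - 2 * \<rho>'\<bar> \<le> 2 * M"
    using h2_bounds[OF X_in[OF q z'(1)]] z' pos by (auto simp: H'_def)
  have "W q \<xi> \<rho> - W q \<xi>' \<rho>' = (H - H') * (1 + v) - 2 * (\<rho> - \<rho>') * v + (H' - 2 * \<rho>') * (v - v')"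
    by (simp add: W_def v_def v'_def H_def H'_def algebra_simps)
  also have "\<bar>\<dots>\<bar> \<le> \<bar>(H - H') * (1 + v)\<bar> + \<bar>2 * (\<rho> - \<rho>') * v\<bar> + \<bar>(H' - 2 * \<rho>') * (v - v')\<bar>"
    by linarith
  also have "\<dots> = \<bar>H - H'\<bar> * (1 + v) + 2 * D2 * v + \<bar>H' - 2 * \<rho>'\<bar> * \<bar>v - v'\<bar>"
    unfolding abs_mult D2_def using v by simp
  also have "\<dots> \<le> (M * (a * D1)) * 2 + 2 * D2 * (2 * a * M / d) + 2 * M * (a * (4 / d) * (1 + M) * (D1 + D2))"
    using H v vv e' D pos by (intro add_mono mult_mono) auto
  also have "\<dots> \<le> (M * (a * (D1 + D2))) * 2 + 2 * (D1 + D2) * (2 * a * M / d) + 2 * M * (a * (4 / d) * (1 + M) * (D1 + D2))"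
    using D pos by (intro add_mono mult_right_mono mult_left_mono) auto
  also have "\<dots> = a * (2 * M + 4 * M / d + 8 * M / d * (1 + M)) * (D1 + D2)"
    by (simp add: algebra_simps add_divide_distrib)
  also have "\<dots> \<le> a * K * (D1 + D2)"
    using D pos by (intro mult_right_mono mult_left_mono) (auto simp: K_def algebra_simps)
  finally show ?thesis by (simp add: D1_def D2_def)
qed

lemma K_ge: "(4 / d) * (1 + M) \<le> K"
proof -
  have "0 \<le> 2 * M + 4 * M / d + 8 * M / d * (1 + M)" using pos by auto
  then show ?thesis by (simp add: K_def algebra_simps)
qed

text \<open>Clipping the arguments makes \<open>V\<close> and \<open>W\<close> globally Lipschitz; the a priori bounds on their
  values show that the fixed point is not affected.\<close>

definition clip :: "real \<Rightarrow> real \<Rightarrow> real" where "clip b x = max 0 (min b x)"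

lemma clip_in: "0 \<le> b \<Longrightarrow> clip b x \<in> {0..b}"
  by (auto simp: clip_def)

lemma clip_eq: "x \<in> {0..b} \<Longrightarrow> clip b x = x"
  by (auto simp: clip_def)

lemma clip_lip: "\<bar>clip b x - clip b y\<bar> \<le> \<bar>x - y\<bar>"
  by (auto simp: clip_def max_def min_def)

lemma clip_cont: "continuous_on S f \<Longrightarrow> continuous_on S (\<lambda>x. clip b (f x))"
  unfolding clip_def by (intro continuous_intros)

lemma continuous_VW:
  assumes "continuous_on S q" "continuous_on S \<xi>" "continuous_on S \<rho>"
    and "\<And>x. x \<in> S \<Longrightarrow> q x \<in> {0..1} \<and> \<xi> x \<in> {0..1} \<and> \<rho> x \<in> {0..M}"
  shows "continuous_on S (\<lambda>x. V (q x) (\<xi> x) (\<rho> x))" "continuous_on S (\<lambda>x. W (q x) (\<xi> x) (\<rho> x))"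
proof -
  have X: "continuous_on S (\<lambda>x. X (q x) (\<xi> x))" and Y: "continuous_on S (\<lambda>x. Y (\<xi> x))"
    unfolding X_def Y_def by (intro continuous_intros assms)+
  have nz: "den (q x) (\<xi> x) (\<rho> x) \<noteq> 0" if "x \<in> S" for x
    using den_ge[of "q x" "\<xi> x" "\<rho> x"] assms(4)[OF that] pos by auto
  have "continuous_on S (\<lambda>x. den (q x) (\<xi> x) (\<rho> x))"
    unfolding den_def
    by (intro continuous_intros assms continuous_on_compose2[OF cont(2) X] continuous_on_compose2[OF cont(1) Y]) auto
  then show *: "continuous_on S (\<lambda>x. V (q x) (\<xi> x) (\<rho> x))"
    unfolding V_def using nz by (intro continuous_intros assms) auto
  show "continuous_on S (\<lambda>x. W (q x) (\<xi> x) (\<rho> x))"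
    unfolding W_def by (intro continuous_intros assms * continuous_on_compose2[OF cont(3) X]) auto
qed

lemma solution_exists:
  obtains \<xi> \<rho> where "continuous_on {0..1} \<xi>" "continuous_on {0..1} \<rho>"
    "\<And>q. q \<in> {0..1} \<Longrightarrow> \<xi> q \<in> {0..1} \<and> \<rho> q \<in> {c/6..M}"
    "\<And>q. q \<in> {0..1} \<Longrightarrow> \<xi> q = integral {0..q} (\<lambda>p. V p (\<xi> p) (\<rho> p))"
    "\<And>q. q \<in> {0..1} \<Longrightarrow> q ^ 3 * \<rho> q = integral {0..q} (\<lambda>p. p\<^sup>2 * W p (\<xi> p) (\<rho> p))"
proof -
  let ?V = "\<lambda>p z. V (clip 1 p) (clip 1 (fst z)) (clip M (snd z))"
  let ?W = "\<lambda>p z. W (clip 1 p) (clip 1 (fst z)) (clip M (snd z))"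
  have in01: "clip 1 x \<in> {0..1}" and inM: "clip M x \<in> {0..M}" for x
    using clip_in[of 1] clip_in[of M] pos by auto
  have Vb: "\<bar>?V p z\<bar> \<le> 1 + 2 * M" for p z
    using V_bounds[OF in01 in01 inM, of p "fst z" "snd z"] pos by auto
  have Wb: "\<bar>?W p z\<bar> \<le> 1 + 2 * M" for p z
    using W_bounds[OF in01 in01 inM, of p "fst z" "snd z"] pos by auto
  have lip: "a * K * (\<bar>clip 1 (fst z) - clip 1 (fst z')\<bar> + \<bar>clip M (snd z) - clip M (snd z')\<bar>) \<le> dist z z' / 4"
    for z z' :: "real \<times> real"
  proof -
    have "\<bar>clip 1 (fst z) - clip 1 (fst z')\<bar> \<le> dist z z'" "\<bar>clip M (snd z) - clip M (snd z')\<bar> \<le> dist z z'"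
      using clip_lip[of 1 "fst z" "fst z'"] clip_lip[of M "snd z" "snd z'"]
        dist_fst_le[of z z'] dist_snd_le[of z z'] by (auto simp: dist_real_def)
    then have "a * K * (\<bar>clip 1 (fst z) - clip 1 (fst z')\<bar> + \<bar>clip M (snd z) - clip M (snd z')\<bar>) \<le> a * K * (2 * dist z z')"
      using pos by (intro mult_left_mono) (auto simp: K_def)
    also have "\<dots> = (8 * a * K) * (dist z z' / 4)" by simp
    also have "\<dots> \<le> 1 * (dist z z' / 4)" using small3 by (intro mult_right_mono) (auto simp: K_def)
    finally show ?thesis by simp
  qed
  have Vl: "\<bar>?V p z - ?V p z'\<bar> \<le> dist z z' / 4" for p z z'
  proof -
    have "\<bar>?V p z - ?V p z'\<bar> \<le> a * (4 / d) * (1 + M) * (\<bar>clip 1 (fst z) - clip 1 (fst z')\<bar> + \<bar>clip M (snd z) - clip M (snd z')\<bar>)"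
      by (rule V_lip[OF in01 in01 inM in01 inM])
    also have "\<dots> \<le> a * K * (\<bar>clip 1 (fst z) - clip 1 (fst z')\<bar> + \<bar>clip M (snd z) - clip M (snd z')\<bar>)"
    proof (rule mult_right_mono)
      show "a * (4 / d) * (1 + M) \<le> a * K"
        using mult_left_mono[OF K_ge, of a] pos by (simp add: mult.assoc)
    qed simp
    also note lip
    finally show ?thesis .
  qed
  have Wl: "\<bar>?W p z - ?W p z'\<bar> \<le> dist z z' / 4" for p z z'
    by (rule order_trans[OF W_lip[OF in01 in01 inM in01 inM] lip])
  have cont: "continuous_on UNIV (\<lambda>(p, z). ?V p z)" "continuous_on UNIV (\<lambda>(p, z). ?W p z)"
    unfolding case_prod_unfold using in01 inM
    by (intro continuous_VW clip_cont continuous_intros; blast)+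
  obtain z where z: "continuous_on UNIV z"
    "\<And>q. q \<in> {0..1} \<Longrightarrow> fst (z q) = q * integral {0..1} (\<lambda>\<tau>. ?V (q * \<tau>) (z (q * \<tau>)))"
    "\<And>q. q \<in> {0..1} \<Longrightarrow> snd (z q) = integral {0..1} (\<lambda>\<tau>. \<tau>\<^sup>2 * ?W (q * \<tau>) (z (q * \<tau>)))"
    by (rule integral_fixpoint[OF cont Vb Wb Vl Wl]) blast
  define v where "v q = ?V q (z q)" for q
  define w where "w q = ?W q (z q)" for q
  have zf: "continuous_on S (\<lambda>x. fst (z x))" "continuous_on S (\<lambda>x. snd (z x))" for S
    using continuous_on_subset[OF z(1)] by (intro continuous_intros; blast)+
  have vw: "continuous_on S v" "continuous_on S w" for S
    unfolding v_def w_def using in01 inM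
    by (intro continuous_VW clip_cont zf continuous_on_id; blast)+
  have vw': "continuous_on S (\<lambda>x. v (q * x))" "continuous_on S (\<lambda>x. w (q * x))" for S q
    by (intro continuous_on_compose2[OF vw(1)[of UNIV]] continuous_on_compose2[OF vw(2)[of UNIV]] continuous_intros; simp)+
  have fst_z: "fst (z q) = integral {0..q} v" if "q \<in> {0..1}" for q
  proof -
    have "fst (z q) = integral {0..1} (\<lambda>\<tau>. q * v (q * \<tau>))" using z(2)[OF that] by (simp add: v_def)
    also have "\<dots> = integral {0..q} v" by (rule integral_stretch_unit[OF vw(1) that])
    finally show ?thesis .
  qed
  have snd_z: "snd (z q) = integral {0..1} (\<lambda>\<tau>. \<tau>\<^sup>2 * w (q * \<tau>))" if "q \<in> {0..1}" for q
    using z(3)[OF that] by (simp add: w_def)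
  have range1: "fst (z q) \<in> {0..1}" if "q \<in> {0..1}" for q
  proof -
    have "0 \<le> integral {0..q} v"
      using V_bounds(1)[OF in01 in01 inM]
      by (intro Henstock_Kurzweil_Integration.integral_nonneg integrable_continuous_real vw) (simp add: v_def)
    moreover have "integral {0..q} v \<le> integral {0..q} (\<lambda>_. 1)"
      using V_bounds(3)[OF in01 in01 inM]
      by (intro integral_le integrable_continuous_real vw) (auto simp: v_def)
    ultimately show ?thesis using that fst_z[OF that] by simp
  qed
  \<comment> \<open>The kernel has mass 1/3, so the bounds \<open>c / 2\<close> and
    \<open>2 * M\<close> of \<open>W\<close> become \<open>c / 6\<close> and
    \<open>2 * M / 3\<close> for the second component; the latter is below the clipping level
    \<open>M\<close>.\<close>
  have sq: "((\<lambda>\<tau>. \<tau>\<^sup>2 * b) has_integral b / 3) {0..1}" for b :: real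
  proof -
    have "((\<lambda>\<tau>. \<tau>\<^sup>2 * b) has_integral 1 ^ 3 / 3 * b - 0 ^ 3 / 3 * b) {0..1}"
      by (rule fundamental_theorem_of_calculus)
        (auto intro!: derivative_eq_intros simp flip: has_real_derivative_iff_has_vector_derivative simp: power2_eq_square)
    then show ?thesis by simp
  qed
  have range2: "snd (z q) \<in> {c/6..M}" if "q \<in> {0..1}" for q
  proof -
    have i: "(\<lambda>\<tau>. \<tau>\<^sup>2 * w (q * \<tau>)) integrable_on {0..1}"
      by (intro integrable_continuous_real continuous_intros vw')
    have wb: "c / 2 \<le> w p" "w p \<le> 2 * M" for p
      using W_bounds(1,2)[OF in01 in01 inM] by (auto simp: w_def)
    have "c / 2 / 3 \<le> integral {0..1} (\<lambda>\<tau>. \<tau>\<^sup>2 * w (q * \<tau>))"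
      by (rule has_integral_le[OF sq integrable_integral[OF i]]) (intro mult_left_mono wb zero_le_power2)
    moreover have "integral {0..1} (\<lambda>\<tau>. \<tau>\<^sup>2 * w (q * \<tau>)) \<le> 2 * M / 3"
      by (rule has_integral_le[OF integrable_integral[OF i] sq]) (intro mult_left_mono wb zero_le_power2)
    ultimately show ?thesis using snd_z[OF that] pos by simp
  qed
  have snd_z': "q ^ 3 * snd (z q) = integral {0..q} (\<lambda>p. p\<^sup>2 * w p)" if "q \<in> {0..1}" for q
  proof -
    have "q ^ 3 * snd (z q) = integral {0..1} (\<lambda>\<tau>. q ^ 3 * (\<tau>\<^sup>2 * w (q * \<tau>)))"
      using snd_z[OF that] by simp
    also have "\<dots> = integral {0..1} (\<lambda>\<tau>. q * ((q * \<tau>)\<^sup>2 * w (q * \<tau>)))"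
      by (simp add: power2_eq_square power3_eq_cube mult.assoc mult.left_commute)
    also have "\<dots> = integral {0..q} (\<lambda>p. p\<^sup>2 * w p)"
      by (rule integral_stretch_unit[OF _ that]) (intro continuous_intros vw)
    finally show ?thesis .
  qed
  have cl: "clip 1 q = q" "clip 1 (fst (z q)) = fst (z q)" "clip M (snd (z q)) = snd (z q)" if "q \<in> {0..1}" for q
  proof -
    have "snd (z q) \<in> {0..M}" using range2[OF that] pos by auto
    then show "clip 1 q = q" "clip 1 (fst (z q)) = fst (z q)" "clip M (snd (z q)) = snd (z q)"
      using that range1[OF that] by (auto intro: clip_eq)
  qed
  show thesis
  proof (rule that[of "\<lambda>q. fst (z q)" "\<lambda>q. snd (z q)"])
    fix q :: real assume q: "q \<in> {0..1}"
    show "fst (z q) \<in> {0..1} \<and> snd (z q) \<in> {c/6..M}" using range1 range2 q by blast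
    have sub: "p \<in> {0..1}" if "p \<in> {0..q}" for p using that q by auto
    show "fst (z q) = integral {0..q} (\<lambda>p. V p (fst (z p)) (snd (z p)))"
      unfolding fst_z[OF q] by (intro integral_cong) (simp add: v_def cl[OF sub])
    show "q ^ 3 * snd (z q) = integral {0..q} (\<lambda>p. p\<^sup>2 * W p (fst (z p)) (snd (z p)))"
      unfolding snd_z'[OF q] by (intro integral_cong) (simp add: w_def cl[OF sub])
  qed (rule zf)+
qed

end

text \<open>It makes \<open>u0\<close> the only zero of \<open>h - g\<close> in the interval and
  bounds the size of \<open>h - g\<close> away from it.\<close>

lemma (in spine_equation) gap_growth:
  assumes "\<And>x. (g has_real_derivative g1 x) (at x)" "\<And>x. (h has_real_derivative h1 x) (at x)"
    and "x \<in> {u0-r..u0+r}" "y \<in> {u0-r..u0+r}" "x < y"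
  shows "d * (y - x) \<le> (h y - g y) - (h x - g x)"
proof -
  have "((\<lambda>x. h x - g x) has_real_derivative h1 z - g1 z) (at z)" for z
    by (intro DERIV_diff assms)
  from MVT2[OF assms(5) this] obtain z where z: "x < z" "z < y"
    "(h y - g y) - (h x - g x) = (y - x) * (h1 z - g1 z)" by blast
  have "d \<le> h1 z - g1 z" using gap[of z z] z assms(3,4) by auto
  then have "(y - x) * d \<le> (y - x) * (h1 z - g1 z)" using assms(5) by (intro mult_left_mono) auto
  then show ?thesis using z(3) by (simp add: mult.commute)
qed

section \<open>From the solution of the integral equation to the data of a fissure\<close>

lemma (in spine_equation) fissure_data_exists:
  assumes fp_der: "\<And>x. (fp has_real_derivative g x) (at x)"
    and fm_der: "\<And>x. (fm has_real_derivative h x) (at x)"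
    and g_der: "\<And>x. (g has_real_derivative g1 x) (at x)"
    and h_der: "\<And>x. (h has_real_derivative h1 x) (at x)"
    and h1_der: "\<And>x. (h1 has_real_derivative h2 x) (at x)"
    and a_def: "a = 4 * \<epsilon>" and xe_range: "u0 + \<epsilon> < xe" "xe < u0 + 3 * \<epsilon>"
    and root: "h xe - g (xe - 2 * \<epsilon>) - 2 * \<epsilon> * h1 xe = 0"
    and eq0: "g u0 = h u0"
  obtains s t t' k k' where "fissure_data \<epsilon> \<epsilon> fp fm g h g1 h1 s t t' k k'"
    "s 0 = xe - \<epsilon>" "t (1/2) = u0 + \<epsilon>" "t 1 < u0 - \<epsilon>"
proof -
  have eps: "0 < \<epsilon>" using pos a_def by simp
  obtain \<xi> \<rho> where \<xi>_cont: "continuous_on {0..1} \<xi>" and \<rho>_cont: "continuous_on {0..1} \<rho>"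
    and range: "\<And>q. q \<in> {0..1} \<Longrightarrow> \<xi> q \<in> {0..1} \<and> \<rho> q \<in> {c/6..M}"
    and \<xi>_eq: "\<And>q. q \<in> {0..1} \<Longrightarrow> \<xi> q = integral {0..q} (\<lambda>p. V p (\<xi> p) (\<rho> p))"
    and \<rho>_eq: "\<And>q. q \<in> {0..1} \<Longrightarrow> q ^ 3 * \<rho> q = integral {0..q} (\<lambda>p. p\<^sup>2 * W p (\<xi> p) (\<rho> p))"
    by (rule solution_exists) blast
  define v where "v q = V q (\<xi> q) (\<rho> q)" for q
  define w where "w q = W q (\<xi> q) (\<rho> q)" for q
  define x where "x q = X q (\<xi> q)" for q
  define y where "y q = Y (\<xi> q)" for q
  have \<rho>_pos: "0 < \<rho> q" if "q \<in> {0..1}" for q using range[OF that] pos by auto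
  have in_M: "\<xi> q \<in> {0..1}" "\<rho> q \<in> {0..M}" if "q \<in> {0..1}" for q using range[OF that] pos by auto
  have x_in: "x q \<in> {u0-r..u0+r}" and y_in: "y q \<in> {u0-r..u0+r}" if "q \<in> {0..1}" for q
    unfolding x_def y_def using in_M[OF that] that by (auto intro!: X_in Y_in simp del: atLeastAtMost_iff)
  have v_cont: "continuous_on {0..1} v" and w_cont: "continuous_on {0..1} w"
    unfolding v_def w_def using in_M by (intro continuous_VW \<xi>_cont \<rho>_cont continuous_on_id; blast)+
  have v_1: "v 1 = 0" by (simp add: v_def V_def)
  have D_pos: "0 < den q (\<xi> q) (\<rho> q)" if "q \<in> {0..1}" for q
    using den_ge[of q "\<xi> q" "\<rho> q"] in_M[OF that] that pos by linarith
  have v_den: "v q * den q (\<xi> q) (\<rho> q) = a * (1 - q) * \<rho> q" if "q \<in> {0..1}" for q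
    using D_pos[OF that] by (simp add: v_def V_def)
  have v_pos: "0 < v q" if "0 \<le> q" "q < 1" for q
  proof -
    have "q \<in> {0..1}" using that by auto
    then show ?thesis using D_pos[of q] \<rho>_pos[of q] that pos by (simp add: v_def V_def)
  qed
  have \<xi>_der: "(\<xi> has_real_derivative v q) (at q within {0..1})" if q: "q \<in> {0..1}" for q
  proof -
    have "((\<lambda>u. integral {0..u} v) has_real_derivative v q) (at q within {0..1})"
      unfolding has_real_derivative_iff_has_vector_derivative
      by (rule integral_has_vector_derivative[OF v_cont q])
    then show ?thesis
      unfolding has_field_derivative_def
      by (rule has_derivative_transform[OF q, rotated])
        (use \<xi>_eq in \<open>simp add: v_def[abs_def]\<close>)
  qed
  \<comment> \<open>\<open>\<rho>\<close> itself is only known to be continuous, whereas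
    \<open>q ^ 3 * \<rho> q\<close> is an integral and thus differentiable. The derivative of
    \<open>q * \<rho> q\<close>, and hence of \<open>k\<close>, is obtained from
    \<open>J q / q\<^sup>2\<close> for positive \<open>q\<close>.\<close>
  define J where "J q = integral {0..q} (\<lambda>p. p\<^sup>2 * w p)" for q
  have J_eq: "J q = q ^ 3 * \<rho> q" if "q \<in> {0..1}" for q
    using \<rho>_eq[OF that] by (simp add: J_def w_def)
  have J_der: "(J has_real_derivative q\<^sup>2 * w q) (at q within {0..1})" if q: "q \<in> {0..1}" for q
    unfolding has_real_derivative_iff_has_vector_derivative J_def
    by (rule integral_has_vector_derivative[OF _ q]) (intro continuous_intros w_cont)
  define t where "t q = x q + \<epsilon>" for q
  define s where "s q = t q + 2 * \<epsilon> * (2 * q - 1)" for q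
  define t' where "t' q = - a * (1 + v q)" for q
  define k where "k q = (a * (q * \<rho> q) + h1 (x q)) / 2" for q
  define k' where "k' q = - a * \<rho> q * (1 + v q)" for q
  have s_y: "s q - \<epsilon> = y q" for q
    unfolding s_def t_def x_def y_def X_def Y_def using a_def by (simp add: algebra_simps)
  have t_x: "t q - \<epsilon> = x q" for q by (simp add: t_def)
  have x_der: "(x has_real_derivative t' q) (at q within {0..1})" if q: "q \<in> {0..1}" for q
    unfolding x_def X_def by (auto intro!: derivative_eq_intros \<xi>_der q simp: t'_def algebra_simps)
  have x_cont: "continuous_on {0..1} x" using x_der by (rule DERIV_continuous_on)
  have t_der: "(t has_real_derivative t' q) (at q within {0..1})" if q: "q \<in> {0..1}" for q
    unfolding t_def by (auto intro!: derivative_eq_intros x_der q)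
  have k_cont: "continuous_on {0..1} k"
    unfolding k_def by (intro continuous_intros \<rho>_cont continuous_on_compose2[OF cont(2) x_cont]) auto
  have k_der: "(k has_real_derivative k' q) (at q)" if q: "0 < q" "q < 1" for q
  proof -
    have q01: "q \<in> {0..1}" using q by simp
    have J: "(J has_real_derivative q\<^sup>2 * w q) (at q)"
      using J_der[OF q01] q by (simp add: at_within_Icc_at)
    have "((\<lambda>q. J q / q\<^sup>2) has_real_derivative (q\<^sup>2 * w q * q\<^sup>2 - J q * (2 * q)) / (q\<^sup>2 * q\<^sup>2)) (at q)"
      by (rule DERIV_divide[OF J]) (use q in \<open>auto intro!: derivative_eq_intros\<close>)
    also have "(q\<^sup>2 * w q * q\<^sup>2 - J q * (2 * q)) / (q\<^sup>2 * q\<^sup>2) = w q - 2 * \<rho> q"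
      unfolding J_eq[OF q01] using q by (simp add: field_simps power2_eq_square power3_eq_cube)
    finally have 1: "((\<lambda>q. q * \<rho> q) has_real_derivative w q - 2 * \<rho> q) (at q)"
      by (rule has_field_derivative_transform_within_open[of _ _ _ "{0<..<1}"])
        (use q in \<open>auto simp: J_eq power2_eq_square power3_eq_cube\<close>)
    have "(x has_real_derivative t' q) (at q)"
      using x_der[OF q01] q by (simp add: at_within_Icc_at)
    then have 2: "((\<lambda>q. h1 (x q)) has_real_derivative h2 (x q) * t' q) (at q)"
      by (rule DERIV_chain2[OF h1_der])
    have "(k has_real_derivative (a * (w q - 2 * \<rho> q) + h2 (x q) * t' q) / 2) (at q)"
      unfolding k_def by (intro DERIV_cdivide DERIV_add DERIV_cmult 1 2)
    also have "(a * (w q - 2 * \<rho> q) + h2 (x q) * t' q) / 2 = k' q"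
      by (simp add: k'_def t'_def w_def W_def x_def v_def field_simps)
    finally show ?thesis .
  qed
  have k2: "2 * k q = a * (q * \<rho> q) + h1 (x q)" for q
    by (simp add: k_def field_simps)
  have k'_s: "4 * \<epsilon> * (1 - q) * k' q = (t' q + 4 * \<epsilon>) * (2 * k q - g1 (s q - \<epsilon>))" if "q \<in> {0..1}" for q
  proof -
    have gap: "h1 (x q) - g1 (y q) = den q (\<xi> q) (\<rho> q) + a * (1 - 2 * q) * \<rho> q"
      by (simp add: den_def x_def y_def)
    have "(t' q + 4 * \<epsilon>) * (2 * k q - g1 (s q - \<epsilon>)) = - a * v q * (a * (q * \<rho> q) + (h1 (x q) - g1 (y q)))"
      unfolding s_y a_def[symmetric] k2 by (simp add: t'_def algebra_simps)
    also have "\<dots> = - a * (v q * den q (\<xi> q) (\<rho> q)) - a * v q * (a * (1 - q) * \<rho> q)"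
      unfolding gap by (simp add: algebra_simps)
    also have "\<dots> = a * (1 - q) * k' q"
      unfolding v_den[OF that] by (simp add: k'_def algebra_simps)
    finally show ?thesis by (simp add: a_def)
  qed
  have k'_t: "4 * \<epsilon> * q * k' q = t' q * (2 * k q - h1 (t q - \<epsilon>))" for q
    unfolding t_x a_def[symmetric] k2 by (simp add: k'_def t'_def)
  have s_der: "(s has_real_derivative t' q + a) (at q within {0..1})" if q: "q \<in> {0..1}" for q
    unfolding s_def a_def by (auto intro!: derivative_eq_intros t_der q)
  have t_cont: "continuous_on {0..1} t" using t_der by (rule DERIV_continuous_on)
  have s_cont: "continuous_on {0..1} s" using s_der by (rule DERIV_continuous_on)
  have gh_cont: "continuous_on UNIV g" "continuous_on UNIV h"
    using g_der h_der by (blast intro: DERIV_continuous_on has_field_derivative_at_within)+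
  \<comment> \<open>\<open>k_eq\<close> is a first integral: subtracting \<open>k'_s\<close> from
    \<open>k'_t\<close> shows that the difference of its sides is constant. At \<open>q = 0\<close>,
    where \<open>2 * k 0 = h1 xe\<close>, it is the equation \<open>root\<close>.\<close>
  have k_eq: "4 * \<epsilon> * (2 * q - 1) * k q = g (s q - \<epsilon>) - h (t q - \<epsilon>)" if q: "q \<in> {0..1}" for q
  proof -
    let ?E = "\<lambda>q. a * (2 * q - 1) * k q - (g (s q - \<epsilon>) - h (t q - \<epsilon>))"
    have "?E q = ?E 0"
    proof (rule const_on_unit[where f = ?E, OF _ _ q])
      show "continuous_on {0..1} ?E"
        by (intro continuous_intros k_cont s_cont t_cont continuous_on_compose2[OF gh_cont(1)]
            continuous_on_compose2[OF gh_cont(2)]) auto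
      fix q :: real assume q: "0 < q" "q < 1"
      then have q01: "q \<in> {0..1}" by simp
      have "(t has_real_derivative t' q) (at q)" "(s has_real_derivative t' q + a) (at q)"
        using t_der[OF q01] s_der[OF q01] q by (simp_all add: at_within_Icc_at)
      then have "((\<lambda>q. s q - \<epsilon>) has_real_derivative t' q + a) (at q)"
        "((\<lambda>q. t q - \<epsilon>) has_real_derivative t' q) (at q)"
        by (auto intro!: derivative_eq_intros)
      note gh = DERIV_chain2[OF g_der this(1)] DERIV_chain2[OF h_der this(2)]
      have "((\<lambda>q. a * (2 * q - 1)) has_real_derivative 2 * a) (at q)"
        by (auto intro!: derivative_eq_intros)
      from DERIV_mult[OF this k_der[OF q]]
      have "(?E has_real_derivative (2 * a * k q + k' q * (a * (2 * q - 1))) -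
          (g1 (s q - \<epsilon>) * (t' q + a) - h1 (t q - \<epsilon>) * t' q)) (at q)"
        by (intro DERIV_diff gh)
      also have "(2 * a * k q + k' q * (a * (2 * q - 1))) - (g1 (s q - \<epsilon>) * (t' q + a) - h1 (t q - \<epsilon>) * t' q) =
          2 * a * k q + (a * q * k' q) - (a * (1 - q) * k' q) - (g1 (s q - \<epsilon>) * (t' q + a) - h1 (t q - \<epsilon>) * t' q)"
        by (simp add: algebra_simps)
      also have "\<dots> = 0"
        unfolding k'_s[OF q01, folded a_def] k'_t[of q, folded a_def] by (simp add: algebra_simps)
      finally show "(?E has_real_derivative 0) (at q)" .
    qed
    also have "\<xi> 0 = 0" using \<xi>_eq[of 0] by simp
    then have "?E 0 = 0"
      using root unfolding s_y t_x k_def x_def y_def X_def Y_def by (simp add: a_def algebra_simps)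
    finally show ?thesis by (simp add: a_def)
  qed
  have \<xi>0: "\<xi> 0 = 0" using \<xi>_eq[of 0] by simp
  have s0: "s 0 = xe - \<epsilon>" using s_y[of 0] \<xi>0 unfolding y_def Y_def by (simp add: a_def)
  \<comment> \<open>At \<open>q = 1/2\<close> the spine is on the axis, so both ribs end at the
    abscissa \<open>x (1/2)\<close> and \<open>k_eq\<close> says that \<open>g\<close> and
    \<open>h\<close> agree there.\<close>
  have x_half: "x (1/2) = u0"
  proof (rule ccontr)
    assume ne: "x (1/2) \<noteq> u0"
    have eq: "g (x (1/2)) = h (x (1/2))"
      using k_eq[of "1/2"] t_x[of "1/2"] by (simp add: s_def)
    have u0: "u0 \<in> {u0-r..u0+r}" using ar pos by auto
    have x: "x (1/2) \<in> {u0-r..u0+r}" by (rule x_in) simp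
    show False
    proof (cases "x (1/2) < u0")
      case True
      have "0 < d * (u0 - x (1/2))" using True pos by simp
      then show False using gap_growth[OF g_der h_der x u0 True] eq eq0 by linarith
    next
      case False
      then have "u0 < x (1/2)" using ne by simp
      moreover from this have "0 < d * (x (1/2) - u0)" using pos by simp
      ultimately show False using gap_growth[OF g_der h_der u0 x] eq eq0 by fastforce
    qed
  qed
  \<comment> \<open>From \<open>q = 1/2\<close> to \<open>q = 1\<close> the abscissa
    \<open>x\<close> drops by \<open>a / 2 = 2 * \<epsilon>\<close> plus the increase of
    \<open>a * \<xi>\<close>. Strictness of that increase is exactly
    \<open>v_+ < u0 - \<epsilon>\<close>.\<close>
  have "\<xi> (1/2) < \<xi> 1"
  proof (rule DERIV_pos_imp_increasing_open[of "1/2" 1 \<xi>])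
    show "\<exists>y. (\<xi> has_real_derivative y) (at q) \<and> 0 < y" if "1/2 < q" "q < 1" for q
      using \<xi>_der[of q] v_pos[of q] that by (intro exI[of _ "v q"]) (simp add: at_within_Icc_at)
    show "continuous_on {1/2..1} \<xi>" by (rule continuous_on_subset[OF \<xi>_cont]) auto
  qed simp
  then have "a * \<xi> (1/2) < a * \<xi> 1" using pos by simp
  then have x1: "x 1 < u0 - 2 * \<epsilon>"
    using x_half unfolding x_def X_def by (simp add: a_def)
  then have t1: "t 1 < u0 - \<epsilon>" by (simp add: t_def)
  have "a * \<xi> 1 \<le> a * 1" using in_M(1)[of 1] pos by (intro mult_left_mono) auto
  then have x1_ge: "xe - 2 * a \<le> x 1" by (simp add: x_def X_def)
  have right: "g1 (z - \<epsilon>) \<le> (h (z + \<epsilon>) - g (z - \<epsilon>)) / (2 * \<epsilon>) \<and>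
      h1 (z + \<epsilon>) \<le> (h (z + \<epsilon>) - g (z - \<epsilon>)) / (2 * \<epsilon>)" if z: "s 0 < z" "z < s 0 + \<epsilon>" for z
  proof -
    have z': "xe - \<epsilon> < z" "z < xe" using z s0 by auto
    \<comment> \<open>The left side of the equation for \<open>u_-\<close>, now as a function of its
      argument. It vanishes at \<open>u_- = s 0\<close> and does not decrease to the right, which is
      the inequality for \<open>h1\<close>; the one for \<open>g1\<close> follows as
      \<open>g1\<close> lies below \<open>h1\<close>.\<close>
    let ?\<Phi> = "\<lambda>z. h (z + \<epsilon>) - g (z - \<epsilon>) - 2 * \<epsilon> * h1 (z + \<epsilon>)"
    have "?\<Phi> (xe - \<epsilon>) \<le> ?\<Phi> z"
    proof (rule DERIV_nonneg_imp_nondecreasing[of _ _ ?\<Phi>])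
      fix u assume u: "xe - \<epsilon> \<le> u" "u \<le> z"
      have I: "u + \<epsilon> \<in> {u0-r..u0+r}" "u - \<epsilon> \<in> {u0-r..u0+r}"
        using u z' xe_range ar eps a_def by auto
      have 1: "((\<lambda>z. h (z + \<epsilon>)) has_real_derivative h1 (u + \<epsilon>)) (at u)"
        using h_der[of "u + \<epsilon>"] by (simp add: DERIV_shift)
      have 2: "((\<lambda>z. h1 (z + \<epsilon>)) has_real_derivative h2 (u + \<epsilon>)) (at u)"
        using h1_der[of "u + \<epsilon>"] by (simp add: DERIV_shift)
      have 3: "((\<lambda>z. g (z - \<epsilon>)) has_real_derivative g1 (u - \<epsilon>)) (at u)"
        using g_der[of "u - \<epsilon>"] DERIV_shift[of g _ u "-\<epsilon>"] by simp
      have "(?\<Phi> has_real_derivative h1 (u + \<epsilon>) - g1 (u - \<epsilon>) - 2 * \<epsilon> * h2 (u + \<epsilon>)) (at u)"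
        by (intro DERIV_diff DERIV_cmult 1 2 3)
      moreover have "0 \<le> h1 (u + \<epsilon>) - g1 (u - \<epsilon>) - 2 * \<epsilon> * h2 (u + \<epsilon>)"
      proof -
        have "2 * \<epsilon> * h2 (u + \<epsilon>) \<le> 2 * \<epsilon> * M"
          using h2_bounds[OF I(1)] eps by (intro mult_left_mono) auto
        also have "\<dots> \<le> 2 * a * M" using eps pos by (simp add: a_def)
        finally show ?thesis using gap[OF I] small1 by linarith
      qed
      ultimately show "\<exists>y. (?\<Phi> has_real_derivative y) (at u) \<and> 0 \<le> y" by blast
    qed (use z' in simp)
    moreover have "?\<Phi> (xe - \<epsilon>) = 0" using root by simp
    ultimately have "2 * \<epsilon> * h1 (z + \<epsilon>) \<le> h (z + \<epsilon>) - g (z - \<epsilon>)" by linarith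
    then have 1: "h1 (z + \<epsilon>) \<le> (h (z + \<epsilon>) - g (z - \<epsilon>)) / (2 * \<epsilon>)"
      using eps by (simp add: pos_le_divide_eq mult.commute)
    have "g1 (z - \<epsilon>) \<le> h1 (z + \<epsilon>)"
      using gap[of "z + \<epsilon>" "z - \<epsilon>"] z' xe_range ar eps a_def pos by auto
    with 1 show ?thesis by linarith
  qed
  have left: "g1 (z + \<epsilon>) \<le> (g (z + \<epsilon>) - h (z - \<epsilon>)) / (2 * \<epsilon>) \<and>
      h1 (z - \<epsilon>) \<le> (g (z + \<epsilon>) - h (z - \<epsilon>)) / (2 * \<epsilon>)" if z: "t 1 - \<epsilon> < z" "z < t 1" for z
  proof -
    have z': "xe - 2 * a < z" "z < u0 - \<epsilon>" using z t1 x1_ge by (auto simp: t_def)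
    have I: "z - \<epsilon> \<in> {u0-r..u0+r}" "z + \<epsilon> \<in> {u0-r..u0+r}" "u0 \<in> {u0-r..u0+r}"
      using z' xe_range ar eps a_def by auto
    \<comment> \<open>Here \<open>z + \<epsilon>\<close> is left of \<open>u0\<close>, where
      \<open>h\<close> lies below \<open>g\<close>, so \<open>g (z + \<epsilon>)\<close> may be
      replaced by \<open>h (z + \<epsilon>)\<close>. The difference quotient of \<open>h\<close>
      then dominates \<open>h1 (z - \<epsilon>)\<close> because \<open>h1\<close> increases.\<close>
    have "z - \<epsilon> < z + \<epsilon>" using eps by simp
    from MVT2[OF this, of h h1] h_der obtain p where p: "z - \<epsilon> < p" "p < z + \<epsilon>"
      "h (z + \<epsilon>) - h (z - \<epsilon>) = (z + \<epsilon> - (z - \<epsilon>)) * h1 p" by blast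
    have "h1 (z - \<epsilon>) \<le> h1 p"
    proof (rule DERIV_nonneg_imp_nondecreasing[of _ _ h1])
      fix u assume "z - \<epsilon> \<le> u" "u \<le> p"
      then have "u \<in> {u0-r..u0+r}" using p I by auto
      then show "\<exists>y. (h1 has_real_derivative y) (at u) \<and> 0 \<le> y"
        using h1_der[of u] h2_bounds[of u] pos by (intro exI[of _ "h2 u"]) auto
    qed (use p in simp)
    then have "2 * \<epsilon> * h1 (z - \<epsilon>) \<le> 2 * \<epsilon> * h1 p" using eps by simp
    moreover have "h (z + \<epsilon>) \<le> g (z + \<epsilon>)"
    proof -
      have "0 \<le> d * (u0 - (z + \<epsilon>))" using z' pos by simp
      then show ?thesis using gap_growth[OF g_der h_der I(2,3)] z' eq0 by linarith
    qed
    ultimately have "2 * \<epsilon> * h1 (z - \<epsilon>) \<le> g (z + \<epsilon>) - h (z - \<epsilon>)" using p(3) by simp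
    then have 1: "h1 (z - \<epsilon>) \<le> (g (z + \<epsilon>) - h (z - \<epsilon>)) / (2 * \<epsilon>)"
      using eps by (simp add: pos_le_divide_eq mult.commute)
    have "g1 (z + \<epsilon>) \<le> h1 (z - \<epsilon>)" using gap[OF I(1,2)] pos by linarith
    with 1 show ?thesis by linarith
  qed
  show thesis
  proof (rule that[of s t t' k k'])
    \<comment> \<open>The width \<open>\<delta>\<close> of the tangent domains is taken to be
      \<open>\<epsilon>\<close>: both concavity inequalities hold that far, since all arguments stay
      within distance \<open>r\<close> of \<open>u0\<close>.\<close>
    show "fissure_data \<epsilon> \<epsilon> fp fm g h g1 h1 s t t' k k'"
    proof
      show "continuous_on {0..1} t'" unfolding t'_def by (intro continuous_intros v_cont)
      show "t' 1 = - 4 * \<epsilon>" by (simp add: t'_def v_1 a_def)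
      show "t' q < - 4 * \<epsilon>" if "0 \<le> q" "q < 1" for q
        using v_pos[OF that] pos by (simp add: t'_def a_def)
      show "k' q \<le> 0" if "0 < q" "q < 1" for q
        using v_pos[of q] \<rho>_pos[of q] that pos by (simp add: k'_def)
    qed (use eps fp_der fm_der g_der h_der t_der k_cont k_der k'_s k'_t k_eq right left s_def in auto)
    show "t (1/2) = u0 + \<epsilon>" using x_half by (simp add: t_def)
  qed (fact s0 t1)+
qed

section \<open>Small strips\<close>

lemma smooth_fun_derivative:
  assumes "smooth_fun f"
  shows "((deriv ^^ n) f has_real_derivative (deriv ^^ Suc n) f x) (at x)"
  using assms by (auto simp: smooth_fun_def DERIV_deriv_iff_field_differentiable)

lemma lipschitz_on_interval:
  fixes f :: "real \<Rightarrow> real"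
  assumes "\<And>x. (f has_real_derivative f' x) (at x)" "\<And>x. x \<in> {a..b} \<Longrightarrow> \<bar>f' x\<bar> \<le> M"
    and "x \<in> {a..b}" "y \<in> {a..b}"
  shows "\<bar>f x - f y\<bar> \<le> M * \<bar>x - y\<bar>"
  using field_differentiable_bound[of "{a..b}" f f' M x y] assms
  by (auto intro: has_field_derivative_at_within)

lemma bounded_on_interval:
  fixes f :: "real \<Rightarrow> real"
  assumes "\<And>x. (f has_real_derivative f' x) (at x)"
  shows "\<exists>B. \<forall>x\<in>{a..b}. \<bar>f x\<bar> \<le> B"
proof -
  have "continuous_on {a..b} f"
    by (rule DERIV_continuous_on[OF has_field_derivative_at_within[OF assms]])
  then have "bounded (f ` {a..b})"
    by (intro compact_imp_bounded compact_continuous_image) auto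
  then obtain B where "\<forall>y\<in>f ` {a..b}. norm y \<le> B" by (auto simp: bounded_iff)
  then show ?thesis by (intro exI[of _ B]) simp
qed

lemma eventually_small: "0 < D \<Longrightarrow> \<forall>\<^sub>F \<epsilon> in at_right 0. C * \<epsilon> \<le> (D::real)"
proof -
  assume D: "0 < D"
  have "((\<lambda>\<epsilon>. C * \<epsilon>) \<longlongrightarrow> C * 0) (at_right 0)" by (intro tendsto_intros)
  then have "\<forall>\<^sub>F \<epsilon> in at_right 0. C * \<epsilon> < D" using D by (intro order_tendstoD(2)) auto
  then show ?thesis by eventually_elim simp
qed

text \<open>The constants depend on the functions near \<open>u0\<close> only and are fixed before
  \<open>a\<close> and \<open>xe\<close>, hence before the width of the strip. \<open>c\<close> and
  \<open>d\<close> are half the values at \<open>u0\<close>, which leaves room for variation;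
  \<open>K\<close> stands for the bracket in \<open>small3\<close>.\<close>

lemma local_bounds:
  fixes g1 h1 h2 :: "real \<Rightarrow> real"
  assumes g1: "\<And>x. (g1 has_real_derivative g2 x) (at x)" and g2: "\<And>x. (g2 has_real_derivative g3 x) (at x)"
    and h1: "\<And>x. (h1 has_real_derivative h2 x) (at x)" and h2: "\<And>x. (h2 has_real_derivative h3 x) (at x)"
    and h3: "\<And>x. (h3 has_real_derivative h4 x) (at x)"
    and less: "g1 u0 < h1 u0" and pos: "0 < h2 u0"
  obtains r M d c K where "0 < r" "0 < M" "0 < d" "0 < c"
    "\<And>a xe. 0 < a \<Longrightarrow> 2 * a \<le> r \<Longrightarrow> 2 * a * M \<le> d \<Longrightarrow> 8 * a * M\<^sup>2 \<le> c * d \<Longrightarrow> 8 * a * K \<le> 1 \<Longrightarrow>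
      u0 \<le> xe \<Longrightarrow> xe \<le> u0 + r \<Longrightarrow> spine_equation a xe u0 r M d c g1 h1 h2"
proof -
  define c where "c = h2 u0 / 2"
  define d where "d = (h1 u0 - g1 u0) / 2"
  have cd: "0 < c" "0 < d" using less pos by (auto simp: c_def d_def)
  have near: "\<exists>e>0. \<forall>x. \<bar>x - u0\<bar> < e \<longrightarrow> \<bar>f x - f u0\<bar> < b" if "isCont f u0" "0 < b" for f :: "real \<Rightarrow> real" and b
    using that unfolding continuous_at_eps_delta by (auto simp: dist_real_def)
  obtain e1 where e1: "0 < e1" "\<And>x. \<bar>x - u0\<bar> < e1 \<Longrightarrow> \<bar>h2 x - h2 u0\<bar> < c"
    using near[OF DERIV_isCont[OF h2] cd(1)] by blast
  obtain e2 where e2: "0 < e2" "\<And>x. \<bar>x - u0\<bar> < e2 \<Longrightarrow> \<bar>h1 x - h1 u0\<bar> < d / 2"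
    using near[OF DERIV_isCont[OF h1], of "d / 2"] cd(2) by auto
  obtain e3 where e3: "0 < e3" "\<And>x. \<bar>x - u0\<bar> < e3 \<Longrightarrow> \<bar>g1 x - g1 u0\<bar> < d / 2"
    using near[OF DERIV_isCont[OF g1], of "d / 2"] cd(2) by auto
  define r where "r = min e1 (min e2 e3) / 2"
  have r: "0 < r" "r < e1" "r < e2" "r < e3" using e1(1) e2(1) e3(1) by (auto simp: r_def)
  have I: "\<bar>x - u0\<bar> < e1 \<and> \<bar>x - u0\<bar> < e2 \<and> \<bar>x - u0\<bar> < e3" if "x \<in> {u0-r..u0+r}" for x
  proof -
    have "\<bar>x - u0\<bar> \<le> r" using that by auto
    then show ?thesis using r by linarith
  qed
  obtain B1 where B1: "\<And>x. x \<in> {u0-r..u0+r} \<Longrightarrow> \<bar>g2 x\<bar> \<le> B1" 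
    using bounded_on_interval[OF g2, of "u0-r" "u0+r"] by blast
  obtain B2 where B2: "\<And>x. x \<in> {u0-r..u0+r} \<Longrightarrow> \<bar>h2 x\<bar> \<le> B2" 
    using bounded_on_interval[OF h2, of "u0-r" "u0+r"] by blast
  obtain B3 where B3: "\<And>x. x \<in> {u0-r..u0+r} \<Longrightarrow> \<bar>h3 x\<bar> \<le> B3" 
    using bounded_on_interval[OF h3, of "u0-r" "u0+r"] by blast
  define M where "M = max 1 (max B1 (max B2 B3))"
  have M: "0 < M" "B1 \<le> M" "B2 \<le> M" "B3 \<le> M" by (auto simp: M_def)
  show thesis
  proof (rule that[OF r(1) M(1) cd(2,1)])
    fix a xe
    assume *: "0 < a" "2 * a \<le> r" "2 * a * M \<le> d" "8 * a * M\<^sup>2 \<le> c * d"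
      "8 * a * (2 * M + 4 * M / d + (8 * M / d + 4 / d) * (1 + M)) \<le> 1" "u0 \<le> xe" "xe \<le> u0 + r"
    show "spine_equation a xe u0 r M d c g1 h1 h2"
    proof
      show "continuous_on UNIV g1" "continuous_on UNIV h1" "continuous_on UNIV h2"
        by (rule DERIV_continuous_on[OF has_field_derivative_at_within[OF g1]]
            DERIV_continuous_on[OF has_field_derivative_at_within[OF h1]]
            DERIV_continuous_on[OF has_field_derivative_at_within[OF h2]])+
      show "c \<le> h2 x \<and> h2 x \<le> M" if "x \<in> {u0-r..u0+r}" for x
      proof
        have "\<bar>h2 x - h2 u0\<bar> < c" using I[OF that] e1 by blast
        then show "c \<le> h2 x" unfolding c_def by linarith
        show "h2 x \<le> M" using B2[OF that] M by linarith
      qed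
      show "d \<le> h1 x - g1 y" if "x \<in> {u0-r..u0+r}" "y \<in> {u0-r..u0+r}" for x y
      proof -
        have "\<bar>h1 x - h1 u0\<bar> < d / 2" "\<bar>g1 y - g1 u0\<bar> < d / 2"
          using I[OF that(1)] I[OF that(2)] e2 e3 by blast+
        moreover have "h1 u0 - g1 u0 = 2 * d" by (simp add: d_def)
        ultimately show ?thesis by linarith
      qed
      fix x y assume xy: "x \<in> {u0-r..u0+r}" "y \<in> {u0-r..u0+r}"
      show "\<bar>g1 x - g1 y\<bar> \<le> M * \<bar>x - y\<bar>"
        by (rule lipschitz_on_interval[OF g1 order_trans[OF B1 M(2)] xy])
      show "\<bar>h1 x - h1 y\<bar> \<le> M * \<bar>x - y\<bar>"
        by (rule lipschitz_on_interval[OF h1 order_trans[OF B2 M(3)] xy])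
      show "\<bar>h2 x - h2 y\<bar> \<le> M * \<bar>x - y\<bar>"
        by (rule lipschitz_on_interval[OF h2 order_trans[OF B3 M(4)] xy])
    qed (use * M cd in auto)
  qed
qed

text \<open>The gap dominates the derivative of the equation's left side, so that side increases
  strictly. At \<open>u0\<close> it is negative because \<open>h1\<close> increases and
  \<open>h < g\<close> just left of \<open>u0\<close>. At \<open>u0 + 2 * \<epsilon>\<close> the
  difference \<open>h - g\<close>, taken at \<open>u0 + \<epsilon>\<close>, is at least
  \<open>d * \<epsilon>\<close> and beats the error \<open>d * \<epsilon> / 2\<close> of replacing a
  mean value of \<open>h1\<close> by its value at the end.\<close>

lemma (in spine_equation) fissure_root_unique:
  assumes g_der: "\<And>x. (g has_real_derivative g1 x) (at x)"
    and h_der: "\<And>x. (h has_real_derivative h1 x) (at x)"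
    and h1_der: "\<And>x. (h1 has_real_derivative h2 x) (at x)"
    and a_def: "a = 4 * \<epsilon>" and eq0: "g u0 = h u0"
  shows "\<exists>!u. u \<in> {u0<..<u0 + 2 * \<epsilon>} \<and> h (u + \<epsilon>) - g (u - \<epsilon>) - 2 * \<epsilon> * h1 (u + \<epsilon>) = 0"
proof -
  have eps: "0 < \<epsilon>" "8 * \<epsilon> \<le> r" "8 * \<epsilon> * M \<le> d" using pos ar small1 a_def by auto
  have h1_mono: "h1 x \<le> h1 y" if "x \<in> {u0-r..u0+r}" "y \<in> {u0-r..u0+r}" "x \<le> y" for x y
  proof (rule DERIV_nonneg_imp_nondecreasing[OF that(3)])
    fix u assume "x \<le> u" "u \<le> y"
    then have "u \<in> {u0-r..u0+r}" using that by auto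
    then show "\<exists>y. (h1 has_real_derivative y) (at u) \<and> 0 \<le> y"
      using h1_der[of u] h2_bounds[of u] pos by (intro exI[of _ "h2 u"]) auto
  qed
  define \<Phi> where "\<Phi> u = h (u + \<epsilon>) - g (u - \<epsilon>) - 2 * \<epsilon> * h1 (u + \<epsilon>)" for u
  define \<Phi>' where "\<Phi>' u = h1 (u + \<epsilon>) - g1 (u - \<epsilon>) - 2 * \<epsilon> * h2 (u + \<epsilon>)" for u
  have der: "(\<Phi> has_real_derivative \<Phi>' u) (at u)" for u
  proof -
    have 1: "((\<lambda>z. h (z + \<epsilon>)) has_real_derivative h1 (u + \<epsilon>)) (at u)"
      using h_der[of "u + \<epsilon>"] by (simp add: DERIV_shift)
    have 2: "((\<lambda>z. h1 (z + \<epsilon>)) has_real_derivative h2 (u + \<epsilon>)) (at u)"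
      using h1_der[of "u + \<epsilon>"] by (simp add: DERIV_shift)
    have 3: "((\<lambda>z. g (z - \<epsilon>)) has_real_derivative g1 (u - \<epsilon>)) (at u)"
      using g_der[of "u - \<epsilon>"] DERIV_shift[of g _ u "-\<epsilon>"] by simp
    show ?thesis unfolding \<Phi>_def \<Phi>'_def by (intro DERIV_diff DERIV_cmult 1 2 3)
  qed
  have \<Phi>'_pos: "0 < \<Phi>' u" if "u0 \<le> u" "u \<le> u0 + 2 * \<epsilon>" for u
  proof -
    have I: "u + \<epsilon> \<in> {u0-r..u0+r}" "u - \<epsilon> \<in> {u0-r..u0+r}" using that eps by auto
    have "2 * \<epsilon> * h2 (u + \<epsilon>) \<le> 2 * \<epsilon> * M" using h2_bounds[OF I(1)] eps by (intro mult_left_mono) auto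
    also have "\<dots> < 8 * \<epsilon> * M" using eps pos by simp
    finally have "2 * \<epsilon> * h2 (u + \<epsilon>) < 8 * \<epsilon> * M" .
    then show ?thesis using gap[OF I] eps unfolding \<Phi>'_def by linarith
  qed
  have mono: "\<Phi> x < \<Phi> y" if "u0 \<le> x" "x < y" "y \<le> u0 + 2 * \<epsilon>" for x y
  proof (rule DERIV_pos_imp_increasing[OF that(2)])
    fix u assume "x \<le> u" "u \<le> y"
    then show "\<exists>y. (\<Phi> has_real_derivative y) (at u) \<and> 0 < y"
      using der[of u] \<Phi>'_pos[of u] that by (intro exI[of _ "\<Phi>' u"]) auto
  qed
  have mvt: "\<exists>p. x - \<epsilon> < p \<and> p < x + \<epsilon> \<and> h (x + \<epsilon>) - h (x - \<epsilon>) = 2 * \<epsilon> * h1 p" for x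
  proof -
    have "x - \<epsilon> < x + \<epsilon>" using eps by simp
    from MVT2[OF this, of h h1] h_der show ?thesis by force
  qed
  have lo: "\<Phi> u0 < 0"
  proof -
    obtain p where p: "u0 - \<epsilon> < p" "p < u0 + \<epsilon>" "h (u0 + \<epsilon>) - h (u0 - \<epsilon>) = 2 * \<epsilon> * h1 p"
      using mvt by blast
    have "h1 p \<le> h1 (u0 + \<epsilon>)" using p eps by (intro h1_mono) auto
    then have 1: "2 * \<epsilon> * h1 p \<le> 2 * \<epsilon> * h1 (u0 + \<epsilon>)" using eps by simp
    have "d * (u0 - (u0 - \<epsilon>)) \<le> (h u0 - g u0) - (h (u0 - \<epsilon>) - g (u0 - \<epsilon>))"
      using eps by (intro gap_growth g_der h_der) auto
    moreover have "0 < d * (u0 - (u0 - \<epsilon>))" using eps pos by simp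
    ultimately show ?thesis using 1 p(3) eq0 by (simp add: \<Phi>_def)
  qed
  have hi: "0 < \<Phi> (u0 + 2 * \<epsilon>)"
  proof -
    obtain p where p: "u0 + 2 * \<epsilon> - \<epsilon> < p" "p < u0 + 2 * \<epsilon> + \<epsilon>"
        "h (u0 + 2 * \<epsilon> + \<epsilon>) - h (u0 + 2 * \<epsilon> - \<epsilon>) = 2 * \<epsilon> * h1 p"
      using mvt by blast
    have "\<bar>h1 (u0 + 2 * \<epsilon> + \<epsilon>) - h1 p\<bar> \<le> M * \<bar>u0 + 2 * \<epsilon> + \<epsilon> - p\<bar>"
      using p eps by (intro h1_lip) auto
    also have "\<dots> \<le> M * (2 * \<epsilon>)" using p pos by (intro mult_left_mono) auto
    finally have "h1 (u0 + 2 * \<epsilon> + \<epsilon>) - h1 p \<le> d / 4" using eps by (simp add: mult.commute)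
    then have "2 * \<epsilon> * (h1 (u0 + 2 * \<epsilon> + \<epsilon>) - h1 p) \<le> 2 * \<epsilon> * (d / 4)"
      using eps by (intro mult_left_mono) auto
    then have 1: "2 * \<epsilon> * h1 (u0 + 2 * \<epsilon> + \<epsilon>) - 2 * \<epsilon> * h1 p \<le> d * \<epsilon> / 2"
      by (simp add: algebra_simps)
    have "d * ((u0 + 2 * \<epsilon> - \<epsilon>) - u0) \<le> (h (u0 + 2 * \<epsilon> - \<epsilon>) - g (u0 + 2 * \<epsilon> - \<epsilon>)) - (h u0 - g u0)"
      using eps by (intro gap_growth g_der h_der) auto
    then have 2: "d * \<epsilon> \<le> h (u0 + 2 * \<epsilon> - \<epsilon>) - g (u0 + 2 * \<epsilon> - \<epsilon>)" using eq0 by simp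
    have "0 < d * \<epsilon>" using eps pos by simp
    then show ?thesis unfolding \<Phi>_def using 1 2 p(3) by linarith
  qed
  have "continuous_on {u0..u0 + 2 * \<epsilon>} \<Phi>"
    by (rule DERIV_continuous_on[OF has_field_derivative_at_within[OF der]])
  then obtain u where u: "u0 \<le> u" "u \<le> u0 + 2 * \<epsilon>" "\<Phi> u = 0"
    using IVT'[of \<Phi> u0 0 "u0 + 2 * \<epsilon>"] lo hi eps by auto
  then have "u \<in> {u0<..<u0 + 2 * \<epsilon>}" using lo hi by (cases "u = u0"; cases "u = u0 + 2 * \<epsilon>") auto
  then show ?thesis
    unfolding \<Phi>_def[symmetric]
  proof (intro ex1I[of _ u] conjI)
    fix w assume w: "w \<in> {u0<..<u0 + 2 * \<epsilon>} \<and> \<Phi> w = 0"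
    show "w = u"
    proof (rule ccontr)
      assume "w \<noteq> u"
      then show False using mono[of w u] mono[of u w] u w by fastforce
    qed
  qed (use u in auto)
qed

theorem proposition6p3:
  fixes fp fm :: "real \<Rightarrow> real" and u0 :: real
  assumes "smooth_fun fp" and "smooth_fun fm"
    and "deriv fp u0 = deriv fm u0"
    and "(deriv ^^ 2) fp u0 < (deriv ^^ 2) fm u0"
    and "(deriv ^^ 3) fm u0 > 0"
  shows "\<forall>\<^sub>F \<epsilon> in at_right 0.
    \<exists>um. fissure_root \<epsilon> fp fm u0 um \<and> (\<forall>w. fissure_root \<epsilon> fp fm u0 w \<longrightarrow> w = um) \<and>
     (\<exists>vp T A.
        NW_fissure \<epsilon> T (vp + \<epsilon>) (um + \<epsilon>) \<and>
        T (u0 + \<epsilon>) = 0 \<and> T (um + \<epsilon>) = - \<epsilon> \<and>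
        vp < u0 - \<epsilon> \<and> T (vp + \<epsilon>) = \<epsilon> \<and>
        foliated_by_ribs \<epsilon> T (vp + \<epsilon>) (um + \<epsilon>) (Omega_NW \<epsilon> vp um) \<and>
        spine_value \<epsilon> fp fm T (vp + \<epsilon>) (um + \<epsilon>) (u0 + \<epsilon>) A \<and>
        bellman_candidate \<epsilon> fp fm (Omega_NW \<epsilon> vp um)
          (herringbone_fun \<epsilon> fp fm T A (vp + \<epsilon>) (um + \<epsilon>)) \<and>
        (\<exists>\<delta>>0. \<exists>F.
           (\<forall>x\<in>Omega_L \<epsilon> um (um + \<delta>). F x = left_tangent_fun \<epsilon> fp fm x) \<and>
           (\<forall>x\<in>Omega_R \<epsilon> (vp - \<delta>) vp. F x = right_tangent_fun \<epsilon> fp fm x) \<and>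
           (\<forall>x\<in>Omega_NW \<epsilon> vp um.
              F x = herringbone_fun \<epsilon> fp fm T A (vp + \<epsilon>) (um + \<epsilon>) x) \<and>
           C1_on (Omega_L \<epsilon> um (um + \<delta>) \<union> Omega_NW \<epsilon> vp um \<union> Omega_R \<epsilon> (vp - \<delta>) vp) F \<and>
           bellman_candidate \<epsilon> fp fm
             (Omega_L \<epsilon> um (um + \<delta>) \<union> Omega_NW \<epsilon> vp um \<union> Omega_R \<epsilon> (vp - \<delta>) vp) F))"
proof -
  note p = smooth_fun_derivative[OF assms(1)] and m = smooth_fun_derivative[OF assms(2)]
  have fp: "(fp has_real_derivative deriv fp x) (at x)" and fm: "(fm has_real_derivative deriv fm x) (at x)" for x
    using p[of 0 x] m[of 0 x] by simp_all
  have g: "(deriv fp has_real_derivative (deriv ^^ 2) fp x) (at x)"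
    and h: "(deriv fm has_real_derivative (deriv ^^ 2) fm x) (at x)" for x
    using p[of 1 x] m[of 1 x] by (simp_all add: numeral_2_eq_2)
  have g1: "((deriv ^^ 2) fp has_real_derivative (deriv ^^ 3) fp x) (at x)"
    and h1: "((deriv ^^ 2) fm has_real_derivative (deriv ^^ 3) fm x) (at x)" for x
    using p[of 2 x] m[of 2 x] by (simp_all add: eval_nat_numeral)
  have g2: "((deriv ^^ 3) fp has_real_derivative (deriv ^^ 4) fp x) (at x)"
    and h2: "((deriv ^^ 3) fm has_real_derivative (deriv ^^ 4) fm x) (at x)" for x
    using p[of 3 x] m[of 3 x] by (simp_all add: eval_nat_numeral)
  obtain r M d c K where pos: "0 < r" "0 < M" "0 < d" "0 < c"
    and se: "\<And>a xe. 0 < a \<Longrightarrow> 2 * a \<le> r \<Longrightarrow> 2 * a * M \<le> d \<Longrightarrow> 8 * a * M\<^sup>2 \<le> c * d \<Longrightarrow> 8 * a * K \<le> 1 \<Longrightarrow>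
      u0 \<le> xe \<Longrightarrow> xe \<le> u0 + r \<Longrightarrow> spine_equation a xe u0 r M d c ((deriv ^^ 2) fp) ((deriv ^^ 2) fm) ((deriv ^^ 3) fm)"
    using local_bounds[OF g1 g2 h1 h2 m[of 4] assms(4,5)] by metis
  have "\<forall>\<^sub>F \<epsilon> in at_right 0. (0::real) < \<epsilon>" by (simp add: eventually_at_right_less)
  moreover have "\<forall>\<^sub>F \<epsilon> in at_right 0. 8 * \<epsilon> \<le> r" using pos by (intro eventually_small)
  moreover have "\<forall>\<^sub>F \<epsilon> in at_right 0. (8 * M) * \<epsilon> \<le> d" using pos by (intro eventually_small)
  moreover have "\<forall>\<^sub>F \<epsilon> in at_right 0. (32 * M\<^sup>2) * \<epsilon> \<le> c * d" using pos by (intro eventually_small) simp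
  moreover have "\<forall>\<^sub>F \<epsilon> in at_right 0. (32 * K) * \<epsilon> \<le> 1" by (intro eventually_small) simp
  ultimately show ?thesis
  proof eventually_elim
    case (elim \<epsilon>)
    have se': "spine_equation (4 * \<epsilon>) xe u0 r M d c ((deriv ^^ 2) fp) ((deriv ^^ 2) fm) ((deriv ^^ 3) fm)"
      if "u0 \<le> xe" "xe \<le> u0 + r" for xe
      using elim that by (intro se) (auto simp: algebra_simps)
    \<comment> \<open>The locale needs an endpoint \<open>xe\<close> before the root is known. It is
      entered with \<open>xe = u0\<close> to obtain the root, and again with
      \<open>xe = um + \<epsilon>\<close> to construct the spine.\<close>
    have "u0 \<le> u0" "u0 \<le> u0 + r" using pos by auto
    from spine_equation.fissure_root_unique[OF se'[OF this] g h h1 refl assms(3)]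
    obtain um where um: "fissure_root \<epsilon> fp fm u0 um" "\<forall>w. fissure_root \<epsilon> fp fm u0 w \<longrightarrow> w = um"
      unfolding fissure_root_def by blast
    from um(1) have range: "u0 + \<epsilon> < um + \<epsilon>" "um + \<epsilon> < u0 + 3 * \<epsilon>"
      and root: "deriv fm (um + \<epsilon>) - deriv fp (um + \<epsilon> - 2 * \<epsilon>) - 2 * \<epsilon> * (deriv ^^ 2) fm (um + \<epsilon>) = 0"
      by (auto simp: fissure_root_def)
    have "u0 \<le> um + \<epsilon>" "um + \<epsilon> \<le> u0 + r" using range elim by auto
    note sp = se'[OF this]
    obtain s t t' k k' where data: "fissure_data \<epsilon> \<epsilon> fp fm (deriv fp) (deriv fm) ((deriv ^^ 2) fp) ((deriv ^^ 2) fm) s t t' k k'"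
      and ends: "s 0 = um + \<epsilon> - \<epsilon>" "t (1/2) = u0 + \<epsilon>" "t 1 < u0 - \<epsilon>"
      by (rule spine_equation.fissure_data_exists[OF sp fp fm g h h1 refl range root assms(3)])
    obtain Qs Qt Qu kU kL m n where
      fol: "fissure_foliation \<epsilon> \<epsilon> fp fm (deriv fp) (deriv fm) ((deriv ^^ 2) fp) ((deriv ^^ 2) fm) s t t' k k' Qs Qt Qu kU kL m n"
      by (rule fissure_data.foliation_exists[OF data])
    interpret fissure_foliation \<epsilon> \<epsilon> fp fm "deriv fp" "deriv fm" "(deriv ^^ 2) fp" "(deriv ^^ 2) fm" s t t' k k' Qs Qt Qu kU kL m n
      by (rule fol)
    have s0: "s 0 = um" using ends by simp
    note concl = fissure_conclusion[unfolded s0 ends(2)]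
    have T: "T (t 1 + \<epsilon>) = \<epsilon>" "T (um + \<epsilon>) = - \<epsilon>" using concl(1) by (auto simp: NW_fissure_def)
    show ?case
      by (rule exI[of _ um], rule conjI[OF um(1)], rule conjI[OF um(2)], rule exI[of _ "t 1"],
          rule exI[of _ T], rule exI[of _ A], intro conjI, (fact concl T ends(3))+,
          rule exI[of _ \<epsilon>], rule conjI[OF eps], rule exI[of _ F], intro conjI, (fact concl)+)
  qed
qed

end
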